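(* Let $R$ be a graded-commutative noetherian ring and let $\mathsf T=(\mathsf T,\otimes,\mathbf 1)$ be a tensor triangulated category with a canonical $R$-action. If $R$ stratifies $\mathsf T$ (in the sense of tensor triangulated categories), then for any objects $X,Y$ in $\mathsf T$ there is an equality $$\operatorname{supp}_R(X\otimes Y)=\operatorname{supp}_RX\cap\operatorname{supp}_RY.$$
   Context: Graded-commutative: $R$ is $\mathbb Z$-graded with $rs=(-1)^{|r||s|}sr$ for homogeneous $r,s$. $\operatorname{Spec}R$ is the set of homogeneous prime ideals; $\mathcal V(\mathfrak a)=\{\mathfrak p\in\operatorname{Spec}R\mid\mathfrak p\supseteq\mathfrak a\}$ for a homogeneous ideal $\mathfrak a$. $R$-modules are graded and $M_{\mathfrak p}$ is homogeneous localization. A subset $\mathcal V\subseteq\operatorname{Spec}R$ is specialization closed if $\mathfrak p\in\mathcal V$, $\mathfrak p\subseteq\mathfrak q$ imply $\mathfrak q\in\mathcal V$. In a triangulated category $\mathsf T$ with arbitrary coproducts and suspension $\Sigma$: a localizing subcategory is a full triangulated subcategory closed under coproducts; an object $C$ is compact if $\operatorname{Hom}_{\mathsf T}(C,-)$ commutes with coproducts; $\mathsf T^c$ is the full subcategory of compact objects; $\mathsf T$ is compactly generated if the smallest localizing subcategory containing some set of compact objects is $\mathsf T$. $\operatorname{Hom}^*_{\mathsf T}(X,Y)=\bigoplus_i\operatorname{Hom}_{\mathsf T}(X,\Sigma^iY)$ and $\operatorname{End}^*_{\mathsf T}(X)=\operatorname{Hom}^*_{\mathsf T}(X,X)$. A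 tensor triangulated category $(\mathsf T,\otimes,\mathbf 1)$ is a compactly generated triangulated category with arbitrary coproducts and a symmetric monoidal structure with product $\otimes$ and unit $\mathbf 1$ such that $\otimes$ is exact in each variable (compatibly with $\Sigma$, in the usual sense) and preserves coproducts in each variable, $\mathbf 1$ is compact, and compact objects are strongly dualizable (i.e. with $\mathcal Hom(X,-)$ the right adjoint of $-\otimes X$, the canonical map $\mathcal Hom(C,\mathbf 1)\otimes X\to\mathcal Hom(C,X)$ is an isomorphism for $C$ compact and all $X$). Then $\operatorname{End}^*_{\mathsf T}(\mathbf 1)$ is graded-commutative and acts on $\mathsf T$ via the homomorphisms $X\otimes-\colon\operatorname{End}^*_{\mathsf T}(\mathbf 1)\to\operatorname{End}^*_{\mathsf T}(X)$. An $R$-action on $\mathsf T$ is canonical if it arises by composing a homomorphism of graded rings $R\to\operatorname{End}^*_{\mathsf T}(\mathbf 1)$ with this action; all $\operatorname{Hom}^*_{\mathsf T}(X,Y)$ are then graded $R$-modules. For specialization closed $\mathcal V$, let $\mathsf T_{\mathcal V}=\{X\in\mathsf T\mid\operatorname{Hom}^*_{\mathsf T}(C,X)_{\mathfrak p}=0\text{ for all }C\in\mathsf T^c,\ \mathfrak p\in\operatorname{Spec}R\setminus\mathcal V\}$. This is a localizing subcategory and there is a localization functor $L_{\mathcal V}\colon\mathsf T\to\mathsf T$ with $\operatorname{Ker}L_{\mathcal V}=\mathsf T_{\mathcal V}$, giving functorial exact triangles $\varGamma_{\mathcal V}X\to X\to L_{\mathcal V}X\to$ with $\varGamma_{\mathcal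 V}X\in\mathsf T_{\mathcal V}$ and $\operatorname{Hom}_{\mathsf T}(\mathsf T_{\mathcal V},L_{\mathcal V}X)=0$. For $\mathfrak p\in\operatorname{Spec}R$ put $\mathcal Z(\mathfrak p)=\{\mathfrak q\in\operatorname{Spec}R\mid\mathfrak q\not\subseteq\mathfrak p\}$, $X_{\mathfrak p}=L_{\mathcal Z(\mathfrak p)}X$, $\varGamma_{\mathfrak p}X=\varGamma_{\mathcal V(\mathfrak p)}(X_{\mathfrak p})$. $\varGamma_{\mathfrak p}\mathsf T$ is the essential image of $\varGamma_{\mathfrak p}$. The support of $X$ is $\operatorname{supp}_RX=\{\mathfrak p\in\operatorname{Spec}R\mid\varGamma_{\mathfrak p}X\neq0\}$. A localizing subcategory $\mathsf S$ is tensor ideal if $X\otimes Y\in\mathsf S$ for all $X\in\mathsf T$, $Y\in\mathsf S$. Each $\varGamma_{\mathfrak p}\mathsf T$ is a tensor ideal localizing subcategory. The tensor triangulated category $\mathsf T$ is stratified by $R$ if for each $\mathfrak p\in\operatorname{Spec}R$ the category $\varGamma_{\mathfrak p}\mathsf T$ is either zero or has no proper nonzero tensor ideal localizing subcategories. *)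

theory Defs
  imports "HOL-Algebra.Ring_Divisibility" "HOL-Library.Equipollence" "HOL-Library.FuncSet"
begin

section \<open>Size conventions\<close>

text \<open>
  ``Arbitrary coproducts'' means coproducts of small families, and Hom is a small set.  A set is
  small if its cardinality is less than that of a fixed type \<open>'u\<close>, whose cardinality is assumed to
  be regular and uncountable.  Any small set injects into \<open>'u\<close>, so it suffices to index families by
  small subsets of \<open>'u\<close>.  (For a type the size of a Grothendieck universe this is the usual notion;
  strong inaccessibility is not needed.)
\<close>

definition small :: "'u itself \<Rightarrow> 'a set \<Rightarrow> bool" where
  "small U A \<longleftrightarrow> A \<prec> (UNIV :: 'u set)"

definition regular_universe :: "'u itself \<Rightarrow> bool" where
  "regular_universe U \<longleftrightarrow>
     small U (UNIV :: nat set) \<and>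
     (\<forall>\<F> :: 'u set set. small U \<F> \<and> (\<forall>A\<in>\<F>. small U A) \<longrightarrow> small U (\<Union>\<F>))"


section \<open>Graded rings, homogeneous primes, homogeneous localization\<close>

record 'a graded_ring = "'a ring" +
  component :: "int \<Rightarrow> 'a set"

locale graded_ring = ring R for R :: "('a, 'k) graded_ring_scheme" (structure) +
  assumes component_subgroup: "additive_subgroup (component R i) R"
    and component_mult: "\<lbrakk>r \<in> component R i; s \<in> component R j\<rbrakk> \<Longrightarrow> r \<otimes> s \<in> component R (i + j)"
    and component_one: "\<one> \<in> component R 0"
    and decomposition: "r \<in> carrier R \<Longrightarrow>
      \<exists>!a. (\<forall>i. a i \<in> component R i) \<and> finite {i. a i \<noteq> \<zero>} \<and> r = (\<Oplus>i\<in>{i. a i \<noteq> \<zero>}. a i)"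

locale graded_commutative_ring = graded_ring +
  assumes graded_comm: "\<lbrakk>r \<in> component R i; s \<in> component R j\<rbrakk> \<Longrightarrow>
      r \<otimes> s = (if odd (i * j) then \<ominus> (s \<otimes> r) else s \<otimes> r)"

definition graded_ring_hom ::
  "('a, 'k) graded_ring_scheme \<Rightarrow> ('b, 'l) graded_ring_scheme \<Rightarrow> ('a \<Rightarrow> 'b) set" where
  "graded_ring_hom R S =
     {h \<in> ring_hom R S. \<forall>i. \<forall>r \<in> component R i. h r \<in> component S i}"

definition homogeneous :: "('a, 'k) graded_ring_scheme \<Rightarrow> 'a set" where
  "homogeneous R = (\<Union>i. component R i)"

definition homogeneous_ideal :: "('a, 'k) graded_ring_scheme \<Rightarrow> 'a set \<Rightarrow> bool" where
  "homogeneous_ideal R I \<longleftrightarrow> ideal I R \<and>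
     (\<forall>r\<in>I. \<exists>a. (\<forall>i. a i \<in> component R i \<inter> I) \<and> finite {i. a i \<noteq> \<zero>\<^bsub>R\<^esub>} \<and>
       r = (\<Oplus>\<^bsub>R\<^esub>i\<in>{i. a i \<noteq> \<zero>\<^bsub>R\<^esub>}. a i))"

definition Spec :: "('a, 'k) graded_ring_scheme \<Rightarrow> 'a set set" where
  "Spec R = {p. homogeneous_ideal R p \<and> p \<noteq> carrier R \<and>
     (\<forall>r\<in>homogeneous R. \<forall>s\<in>homogeneous R. r \<otimes>\<^bsub>R\<^esub> s \<in> p \<longrightarrow> r \<in> p \<or> s \<in> p)}"

definition closed_set :: "('a, 'k) graded_ring_scheme \<Rightarrow> 'a set \<Rightarrow> 'a set set" where
  "closed_set R I = {p \<in> Spec R. I \<subseteq> p}"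

definition not_below :: "('a, 'k) graded_ring_scheme \<Rightarrow> 'a set \<Rightarrow> 'a set set" where
  "not_below R p = {q \<in> Spec R. \<not> q \<subseteq> p}"

text \<open>
  The localization inverts the homogeneous elements outside \<open>p\<close>; the class of \<open>(m, s)\<close> is the left
  fraction \<open>s\<^sup>-\<^sup>1 m\<close>, and the Ore form of the equivalence relation avoids signs.  As everywhere in
  \<open>HOL-Algebra\<close>, the multiplicative fields of a module record carry no information.
\<close>

definition denominators :: "('a, 'k) graded_ring_scheme \<Rightarrow> 'a set \<Rightarrow> 'a set" where
  "denominators R p = homogeneous R - p"

definition fraction_rel ::
  "('a, 'k) graded_ring_scheme \<Rightarrow> 'a set \<Rightarrow> ('a, 'b, 'l) module_scheme \<Rightarrow> (('b \<times> 'a) \<times> ('b \<times> 'a)) set"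
  where
  "fraction_rel R p M =
     {((m, s), (n, t)). m \<in> carrier M \<and> n \<in> carrier M \<and> s \<in> denominators R p \<and> t \<in> denominators R p \<and>
        (\<exists>a \<in> denominators R p. \<exists>b \<in> denominators R p.
           a \<otimes>\<^bsub>R\<^esub> s = b \<otimes>\<^bsub>R\<^esub> t \<and> a \<odot>\<^bsub>M\<^esub> m = b \<odot>\<^bsub>M\<^esub> n)}"

definition localized_module ::
  "('a, 'k) graded_ring_scheme \<Rightarrow> 'a set \<Rightarrow> ('a, 'b, 'l) module_scheme \<Rightarrow> ('b \<times> 'a) set set" where
  "localized_module R p M = (carrier M \<times> denominators R p) // fraction_rel R p M"

definition localizes_to_zero ::
  "('a, 'k) graded_ring_scheme \<Rightarrow> 'a set \<Rightarrow> ('a, 'b, 'l) module_scheme \<Rightarrow> bool" where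
  "localizes_to_zero R p M \<longleftrightarrow>
     localized_module R p M = {fraction_rel R p M `` {(\<zero>\<^bsub>M\<^esub>, \<one>\<^bsub>R\<^esub>)}}"


section \<open>Categories\<close>

record ('o, 'm) category =
  Dom :: "'m \<Rightarrow> 'o"
  Cod :: "'m \<Rightarrow> 'o"
  Ident :: "'o \<Rightarrow> 'm"
  Compose :: "'m \<Rightarrow> 'm \<Rightarrow> 'm"  (infixr "\<cdot>\<index>" 75)

definition Hom :: "('o, 'm, 'c) category_scheme \<Rightarrow> 'o \<Rightarrow> 'o \<Rightarrow> 'm set" where
  "Hom T X Y = {f. Dom T f = X \<and> Cod T f = Y}"

locale category = fixes T :: "('o, 'm, 'c) category_scheme" (structure)
  assumes Ident_in_Hom: "Ident T X \<in> Hom T X X"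
    and Compose_in_Hom: "\<lbrakk>f \<in> Hom T X Y; g \<in> Hom T Y Z\<rbrakk> \<Longrightarrow> g \<cdot> f \<in> Hom T X Z"
    and Ident_left: "f \<in> Hom T X Y \<Longrightarrow> Ident T Y \<cdot> f = f"
    and Ident_right: "f \<in> Hom T X Y \<Longrightarrow> f \<cdot> Ident T X = f"
    and Compose_assoc: "\<lbrakk>f \<in> Hom T W X; g \<in> Hom T X Y; h \<in> Hom T Y Z\<rbrakk> \<Longrightarrow>
      (h \<cdot> g) \<cdot> f = h \<cdot> (g \<cdot> f)"

definition inverse_arrows :: "('o, 'm, 'c) category_scheme \<Rightarrow> 'm \<Rightarrow> 'm \<Rightarrow> bool" where
  "inverse_arrows T f g \<longleftrightarrow> g \<in> Hom T (Cod T f) (Dom T f) \<and>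
     g \<cdot>\<^bsub>T\<^esub> f = Ident T (Dom T f) \<and> f \<cdot>\<^bsub>T\<^esub> g = Ident T (Cod T f)"

definition is_iso :: "('o, 'm, 'c) category_scheme \<Rightarrow> 'm \<Rightarrow> bool" where
  "is_iso T f \<longleftrightarrow> (\<exists>g. inverse_arrows T f g)"

definition inverse_arrow :: "('o, 'm, 'c) category_scheme \<Rightarrow> 'm \<Rightarrow> 'm" where
  "inverse_arrow T f = (THE g. inverse_arrows T f g)"

definition isomorphic :: "('o, 'm, 'c) category_scheme \<Rightarrow> 'o \<Rightarrow> 'o \<Rightarrow> bool" where
  "isomorphic T X Y \<longleftrightarrow> (\<exists>f \<in> Hom T X Y. is_iso T f)"

definition zero_object :: "('o, 'm, 'c) category_scheme \<Rightarrow> 'o \<Rightarrow> bool" where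
  "zero_object T Z \<longleftrightarrow> (\<forall>X. (\<exists>!f. f \<in> Hom T X Z) \<and> (\<exists>!f. f \<in> Hom T Z X))"

definition is_coproduct ::
  "('o, 'm, 'c) category_scheme \<Rightarrow> 'i set \<Rightarrow> ('i \<Rightarrow> 'o) \<Rightarrow> 'o \<Rightarrow> ('i \<Rightarrow> 'm) \<Rightarrow> bool" where
  "is_coproduct T I X P \<iota> \<longleftrightarrow>
     (\<forall>i\<in>I. \<iota> i \<in> Hom T (X i) P) \<and>
     (\<forall>Y f. (\<forall>i\<in>I. f i \<in> Hom T (X i) Y) \<longrightarrow>
        (\<exists>!u. u \<in> Hom T P Y \<and> (\<forall>i\<in>I. u \<cdot>\<^bsub>T\<^esub> \<iota> i = f i)))"


section \<open>Additive categories\<close>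

record ('o, 'm) additive_category = "('o, 'm) category" +
  Zero :: "'o \<Rightarrow> 'o \<Rightarrow> 'm"
  Plus :: "'m \<Rightarrow> 'm \<Rightarrow> 'm"  (infixl "\<boxplus>\<index>" 65)

definition Hom_group :: "('o, 'm, 'c) additive_category_scheme \<Rightarrow> 'o \<Rightarrow> 'o \<Rightarrow> 'm monoid" where
  "Hom_group T X Y = \<lparr>carrier = Hom T X Y, mult = Plus T, one = Zero T X Y\<rparr>"

definition Neg :: "('o, 'm, 'c) additive_category_scheme \<Rightarrow> 'm \<Rightarrow> 'm" where
  "Neg T f = m_inv (Hom_group T (Dom T f) (Cod T f)) f"

locale additive_category = category T for T :: "('o, 'm, 'c) additive_category_scheme" (structure) +
  assumes Hom_comm_group: "comm_group (Hom_group T X Y)"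
    and Compose_Plus_left: "\<lbrakk>f \<in> Hom T X Y; g \<in> Hom T Y Z; h \<in> Hom T Y Z\<rbrakk> \<Longrightarrow>
      (g \<boxplus> h) \<cdot> f = g \<cdot> f \<boxplus> h \<cdot> f"
    and Compose_Plus_right: "\<lbrakk>f \<in> Hom T X Y; g \<in> Hom T X Y; h \<in> Hom T Y Z\<rbrakk> \<Longrightarrow>
      h \<cdot> (f \<boxplus> g) = h \<cdot> f \<boxplus> h \<cdot> g"
    and ex_zero_object: "\<exists>Z. zero_object T Z"
    and ex_biproduct: "\<exists>P i j p q.
      i \<in> Hom T X P \<and> j \<in> Hom T Y P \<and> p \<in> Hom T P X \<and> q \<in> Hom T P Y \<and>
      p \<cdot> i = Ident T X \<and> q \<cdot> j = Ident T Y \<and> q \<cdot> i = Zero T X Y \<and> p \<cdot> j = Zero T Y X \<and>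
      i \<cdot> p \<boxplus> j \<cdot> q = Ident T P"


section \<open>Triangulated categories\<close>

text \<open>
  The suspension is an automorphism of the category (Verdier's convention), so that \<open>\<Sigma>\<^sup>i\<close> is defined
  for every integer \<open>i\<close> with \<open>\<Sigma>\<^sup>i \<Sigma>\<^sup>j = \<Sigma>\<^sup>i\<^sup>+\<^sup>j\<close>.  \<open>Triangle T f g h\<close> says that
  \<open>f\<close>, \<open>g\<close>, \<open>h\<close> form an exact triangle \<open>X \<rightarrow> Y \<rightarrow> Z \<rightarrow> \<Sigma>X\<close>.
\<close>

record ('o, 'm) triangulated_category = "('o, 'm) additive_category" +
  Susp :: "'o \<Rightarrow> 'o"
  SuspA :: "'m \<Rightarrow> 'm"
  Triangle :: "'m \<Rightarrow> 'm \<Rightarrow> 'm \<Rightarrow> bool"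

locale triangulated_category = additive_category T
  for T :: "('o, 'm, 'c) triangulated_category_scheme" (structure) +
  assumes Susp_bij: "bij (Susp T)"
    and SuspA_bij: "bij (SuspA T)"
    and SuspA_in_Hom: "f \<in> Hom T X Y \<Longrightarrow> SuspA T f \<in> Hom T (Susp T X) (Susp T Y)"
    and SuspA_Ident: "SuspA T (Ident T X) = Ident T (Susp T X)"
    and SuspA_Compose: "\<lbrakk>f \<in> Hom T X Y; g \<in> Hom T Y Z\<rbrakk> \<Longrightarrow>
      SuspA T (g \<cdot> f) = SuspA T g \<cdot> SuspA T f"
    and SuspA_Plus: "\<lbrakk>f \<in> Hom T X Y; g \<in> Hom T X Y\<rbrakk> \<Longrightarrow>
      SuspA T (f \<boxplus> g) = SuspA T f \<boxplus> SuspA T g"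
    and Triangle_shape: "Triangle T f g h \<Longrightarrow>
      Cod T f = Dom T g \<and> Cod T g = Dom T h \<and> Cod T h = Susp T (Dom T f)"
    and Triangle_iso: "\<lbrakk>Triangle T f g h;
      f' \<in> Hom T X' Y'; g' \<in> Hom T Y' Z'; h' \<in> Hom T Z' (Susp T X');
      a \<in> Hom T (Dom T f) X'; b \<in> Hom T (Dom T g) Y'; c \<in> Hom T (Dom T h) Z';
      is_iso T a; is_iso T b; is_iso T c;
      b \<cdot> f = f' \<cdot> a; c \<cdot> g = g' \<cdot> b; SuspA T a \<cdot> h = h' \<cdot> c\<rbrakk> \<Longrightarrow> Triangle T f' g' h'"
    and TR1_Ident: "zero_object T Z \<Longrightarrow> Triangle T (Ident T X) (Zero T X Z) (Zero T Z (Susp T X))"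
    and TR1_cone: "\<exists>g h. Triangle T f g h"
    and TR2: "Triangle T f g h \<longleftrightarrow> Triangle T g h (Neg T (SuspA T f))"
    and TR3: "\<lbrakk>Triangle T f g h; Triangle T f' g' h';
      a \<in> Hom T (Dom T f) (Dom T f'); b \<in> Hom T (Dom T g) (Dom T g'); b \<cdot> f = f' \<cdot> a\<rbrakk> \<Longrightarrow>
      \<exists>c \<in> Hom T (Dom T h) (Dom T h'). c \<cdot> g = g' \<cdot> b \<and> SuspA T a \<cdot> h = h' \<cdot> c"
    and TR4: "\<lbrakk>Triangle T f f' f''; Triangle T g g' g''; Cod T f = Dom T g;
      Triangle T (g \<cdot> f) h' h''\<rbrakk> \<Longrightarrow>
      \<exists>u v. u \<in> Hom T (Cod T f') (Cod T h') \<and> v \<in> Hom T (Cod T h') (Cod T g') \<and>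
        Triangle T u v (SuspA T f' \<cdot> g'') \<and>
        u \<cdot> f' = h' \<cdot> g \<and> h'' \<cdot> u = f'' \<and> v \<cdot> h' = g' \<and> g'' \<cdot> v = SuspA T f \<cdot> h''"

definition int_pow :: "('a \<Rightarrow> 'a) \<Rightarrow> int \<Rightarrow> 'a \<Rightarrow> 'a" where
  "int_pow F i = (if 0 \<le> i then F ^^ nat i else inv_into UNIV F ^^ nat (- i))"

abbreviation Susp_pow :: "('o, 'm, 'c) triangulated_category_scheme \<Rightarrow> int \<Rightarrow> 'o \<Rightarrow> 'o" where
  "Susp_pow T \<equiv> int_pow (Susp T)"

abbreviation SuspA_pow :: "('o, 'm, 'c) triangulated_category_scheme \<Rightarrow> int \<Rightarrow> 'm \<Rightarrow> 'm" where
  "SuspA_pow T \<equiv> int_pow (SuspA T)"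

text \<open>
  An element of \<open>Hom\<^sup>*(X, Y) = \<Oplus>\<^sub>i Hom(X, \<Sigma>\<^sup>i Y)\<close> is the finitely supported family of its components.
\<close>

definition graded_Hom :: "('o, 'm, 'c) triangulated_category_scheme \<Rightarrow> 'o \<Rightarrow> 'o \<Rightarrow> (int \<Rightarrow> 'm) set"
  where
  "graded_Hom T X Y = {f. (\<forall>i. f i \<in> Hom T X (Susp_pow T i Y)) \<and>
     finite {i. f i \<noteq> Zero T X (Susp_pow T i Y)}}"

definition graded_Compose ::
  "('o, 'm, 'c) triangulated_category_scheme \<Rightarrow> 'o \<Rightarrow> 'o \<Rightarrow> 'o \<Rightarrow> (int \<Rightarrow> 'm) \<Rightarrow> (int \<Rightarrow> 'm) \<Rightarrow> int \<Rightarrow> 'm"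
  where
  "graded_Compose T X Y Z g f =
     (\<lambda>k. finprod (Hom_group T X (Susp_pow T k Z)) (\<lambda>i. SuspA_pow T i (g (k - i)) \<cdot>\<^bsub>T\<^esub> f i)
            {i. f i \<noteq> Zero T X (Susp_pow T i Y)})"

definition graded_End :: "('o, 'm, 'c) triangulated_category_scheme \<Rightarrow> 'o \<Rightarrow> (int \<Rightarrow> 'm) graded_ring"
  where
  "graded_End T X =
     \<lparr>carrier = graded_Hom T X X,
      mult = graded_Compose T X X X,
      one = (\<lambda>i. if i = 0 then Ident T X else Zero T X (Susp_pow T i X)),
      zero = (\<lambda>i. Zero T X (Susp_pow T i X)),
      add = (\<lambda>f g i. f i \<boxplus>\<^bsub>T\<^esub> g i),
      component = (\<lambda>i. {f \<in> graded_Hom T X X. \<forall>j. j \<noteq> i \<longrightarrow> f j = Zero T X (Susp_pow T j X)})\<rparr>"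

text \<open>An action of \<open>R\<close> is given by ring homomorphisms \<open>\<rho> X : R \<rightarrow> End\<^sup>*(X)\<close>;
  \<open>R\<close> acts on \<open>Hom\<^sup>*(X, Y)\<close> from the left through \<open>\<rho> Y\<close>.\<close>

definition Hom_module ::
  "('o, 'm, 'c) triangulated_category_scheme \<Rightarrow> ('o \<Rightarrow> 'r \<Rightarrow> int \<Rightarrow> 'm) \<Rightarrow> 'o \<Rightarrow> 'o \<Rightarrow> ('r, int \<Rightarrow> 'm) module"
  where
  "Hom_module T \<rho> X Y =
     \<lparr>carrier = graded_Hom T X Y,
      mult = undefined,
      one = undefined,
      zero = (\<lambda>i. Zero T X (Susp_pow T i Y)),
      add = (\<lambda>f g i. f i \<boxplus>\<^bsub>T\<^esub> g i),
      smult = (\<lambda>r f. graded_Compose T X Y Y (\<rho> Y r) f)\<rparr>"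


section \<open>Compact generation\<close>

definition localizing ::
  "'u itself \<Rightarrow> ('o, 'm, 'c) triangulated_category_scheme \<Rightarrow> 'o set \<Rightarrow> bool" where
  "localizing U T S \<longleftrightarrow>
     (\<forall>X. zero_object T X \<longrightarrow> X \<in> S) \<and>
     (\<forall>X. X \<in> S \<longleftrightarrow> Susp T X \<in> S) \<and>
     (\<forall>f g h. Triangle T f g h \<and> Dom T f \<in> S \<and> Cod T f \<in> S \<longrightarrow> Cod T g \<in> S) \<and>
     (\<forall>(I :: 'u set) X P \<iota>. small U I \<and> is_coproduct T I X P \<iota> \<and> (\<forall>i\<in>I. X i \<in> S) \<longrightarrow> P \<in> S)"

text \<open>\<open>C\<close> is compact if the canonical map \<open>\<Oplus>\<^sub>i Hom(C, X\<^sub>i) \<rightarrow> Hom(C, \<Coprod>\<^sub>i X\<^sub>i)\<close> is bijective.\<close>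

definition compact_object ::
  "'u itself \<Rightarrow> ('o, 'm, 'c) triangulated_category_scheme \<Rightarrow> 'o \<Rightarrow> bool" where
  "compact_object U T C \<longleftrightarrow>
     (\<forall>(I :: 'u set) X P \<iota>. small U I \<and> is_coproduct T I X P \<iota> \<longrightarrow>
        bij_betw
          (\<lambda>f. finprod (Hom_group T C P) (\<lambda>i. \<iota> i \<cdot>\<^bsub>T\<^esub> f i) {i \<in> I. f i \<noteq> Zero T C (X i)})
          {f \<in> (\<Pi>\<^sub>E i\<in>I. Hom T C (X i)). finite {i \<in> I. f i \<noteq> Zero T C (X i)}}
          (Hom T C P))"

locale compactly_generated_category = triangulated_category T
  for U :: "'u itself" and T :: "('o, 'm, 'c) triangulated_category_scheme" (structure) +
  assumes universe: "regular_universe U"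
    and small_Hom: "small U (Hom T X Y)"
    and ex_coproduct: "small U (I :: 'u set) \<Longrightarrow> \<exists>P \<iota>. is_coproduct T I F P \<iota>"
    and compactly_generated: "\<exists>G. small U G \<and> (\<forall>C\<in>G. compact_object U T C) \<and>
      \<Inter> {S. localizing U T S \<and> G \<subseteq> S} = UNIV"


section \<open>Tensor triangulated categories\<close>

text \<open>
  \<open>Assoc\<close>, \<open>LUnit\<close>, \<open>RUnit\<close> and \<open>Braid\<close> are the structure isomorphisms
  \<open>(X \<otimes> Y) \<otimes> Z \<rightarrow> X \<otimes> (Y \<otimes> Z)\<close>, \<open>1 \<otimes> X \<rightarrow> X\<close>, \<open>X \<otimes> 1 \<rightarrow> X\<close>, \<open>X \<otimes> Y \<rightarrow> Y \<otimes> X\<close>, and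
  \<open>SuspTensor\<close> is the exactness datum \<open>\<Sigma>X \<otimes> Y \<rightarrow> \<Sigma>(X \<otimes> Y)\<close>.
\<close>

record ('o, 'm) tensor_category = "('o, 'm) triangulated_category" +
  Tensor :: "'o \<Rightarrow> 'o \<Rightarrow> 'o"  (infixr "\<boxtimes>\<index>" 70)
  TensorA :: "'m \<Rightarrow> 'm \<Rightarrow> 'm"  (infixr "\<star>\<index>" 80)
  Unit :: "'o"
  Assoc :: "'o \<Rightarrow> 'o \<Rightarrow> 'o \<Rightarrow> 'm"
  LUnit :: "'o \<Rightarrow> 'm"
  RUnit :: "'o \<Rightarrow> 'm"
  Braid :: "'o \<Rightarrow> 'o \<Rightarrow> 'm"
  SuspTensor :: "'o \<Rightarrow> 'o \<Rightarrow> 'm"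

locale symmetric_monoidal_category = category T
  for T :: "('o, 'm, 'c) tensor_category_scheme" (structure) +
  assumes TensorA_in_Hom: "\<lbrakk>f \<in> Hom T X Y; g \<in> Hom T X' Y'\<rbrakk> \<Longrightarrow>
      f \<star> g \<in> Hom T (X \<boxtimes> X') (Y \<boxtimes> Y')"
    and TensorA_Ident: "Ident T X \<star> Ident T Y = Ident T (X \<boxtimes> Y)"
    and TensorA_Compose: "\<lbrakk>f \<in> Hom T X Y; g \<in> Hom T Y Z; f' \<in> Hom T X' Y'; g' \<in> Hom T Y' Z'\<rbrakk> \<Longrightarrow>
      (g \<cdot> f) \<star> (g' \<cdot> f') = (g \<star> g') \<cdot> (f \<star> f')"
    and Assoc_in_Hom: "Assoc T X Y Z \<in> Hom T ((X \<boxtimes> Y) \<boxtimes> Z) (X \<boxtimes> (Y \<boxtimes> Z))"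
    and Assoc_iso: "is_iso T (Assoc T X Y Z)"
    and Assoc_natural: "\<lbrakk>f \<in> Hom T X X'; g \<in> Hom T Y Y'; h \<in> Hom T Z Z'\<rbrakk> \<Longrightarrow>
      Assoc T X' Y' Z' \<cdot> ((f \<star> g) \<star> h) = (f \<star> (g \<star> h)) \<cdot> Assoc T X Y Z"
    and LUnit_in_Hom: "LUnit T X \<in> Hom T (Unit T \<boxtimes> X) X"
    and LUnit_iso: "is_iso T (LUnit T X)"
    and LUnit_natural: "f \<in> Hom T X Y \<Longrightarrow>
      LUnit T Y \<cdot> (Ident T (Unit T) \<star> f) = f \<cdot> LUnit T X"
    and RUnit_in_Hom: "RUnit T X \<in> Hom T (X \<boxtimes> Unit T) X"
    and RUnit_iso: "is_iso T (RUnit T X)"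
    and RUnit_natural: "f \<in> Hom T X Y \<Longrightarrow>
      RUnit T Y \<cdot> (f \<star> Ident T (Unit T)) = f \<cdot> RUnit T X"
    and Braid_in_Hom: "Braid T X Y \<in> Hom T (X \<boxtimes> Y) (Y \<boxtimes> X)"
    and Braid_natural: "\<lbrakk>f \<in> Hom T X X'; g \<in> Hom T Y Y'\<rbrakk> \<Longrightarrow>
      Braid T X' Y' \<cdot> (f \<star> g) = (g \<star> f) \<cdot> Braid T X Y"
    and Braid_symmetric: "Braid T Y X \<cdot> Braid T X Y = Ident T (X \<boxtimes> Y)"
    and pentagon: "Assoc T W X (Y \<boxtimes> Z) \<cdot> Assoc T (W \<boxtimes> X) Y Z =
      (Ident T W \<star> Assoc T X Y Z) \<cdot> Assoc T W (X \<boxtimes> Y) Z \<cdot> (Assoc T W X Y \<star> Ident T Z)"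
    and unit_triangle: "(Ident T X \<star> LUnit T Y) \<cdot> Assoc T X (Unit T) Y = RUnit T X \<star> Ident T Y"
    and hexagon: "Assoc T Y Z X \<cdot> Braid T X (Y \<boxtimes> Z) \<cdot> Assoc T X Y Z =
      (Ident T Y \<star> Braid T X Z) \<cdot> Assoc T Y X Z \<cdot> (Braid T X Y \<star> Ident T Z)"

definition SuspTensorR :: "('o, 'm, 'c) tensor_category_scheme \<Rightarrow> 'o \<Rightarrow> 'o \<Rightarrow> 'm" where
  \<comment> \<open>\<open>X \<otimes> \<Sigma>Y \<rightarrow> \<Sigma>(X \<otimes> Y)\<close>\<close>
  "SuspTensorR T X Y =
     SuspA T (Braid T Y X) \<cdot>\<^bsub>T\<^esub> SuspTensor T Y X \<cdot>\<^bsub>T\<^esub> Braid T X (Susp T Y)"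

text \<open>
  \<open>is_internal_hom T X Y H e\<close>: \<open>e : H \<otimes> X \<rightarrow> Y\<close> exhibits \<open>H\<close> as the value at \<open>Y\<close> of the right
  adjoint of \<open>- \<otimes> X\<close>.  In the definition of strong dualizability, \<open>u\<close> is the canonical map
  \<open>\<H>om(C, 1) \<otimes> X \<rightarrow> \<H>om(C, X)\<close>, i.e. the adjoint of
  \<open>(\<H>om(C, 1) \<otimes> X) \<otimes> C \<cong> (\<H>om(C, 1) \<otimes> C) \<otimes> X \<rightarrow> 1 \<otimes> X \<cong> X\<close>.
\<close>

definition is_internal_hom ::
  "('o, 'm, 'c) tensor_category_scheme \<Rightarrow> 'o \<Rightarrow> 'o \<Rightarrow> 'o \<Rightarrow> 'm \<Rightarrow> bool" where
  "is_internal_hom T X Y H e \<longleftrightarrow> e \<in> Hom T (H \<boxtimes>\<^bsub>T\<^esub> X) Y \<and>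
     (\<forall>W. \<forall>f \<in> Hom T (W \<boxtimes>\<^bsub>T\<^esub> X) Y. \<exists>!u. u \<in> Hom T W H \<and> e \<cdot>\<^bsub>T\<^esub> (u \<star>\<^bsub>T\<^esub> Ident T X) = f)"

definition strongly_dualizable :: "('o, 'm, 'c) tensor_category_scheme \<Rightarrow> 'o \<Rightarrow> bool" where
  "strongly_dualizable T C \<longleftrightarrow>
     (\<exists>D d. is_internal_hom T C (Unit T) D d \<and>
       (\<forall>X. \<exists>H e u. is_internal_hom T C X H e \<and> u \<in> Hom T (D \<boxtimes>\<^bsub>T\<^esub> X) H \<and> is_iso T u \<and>
         e \<cdot>\<^bsub>T\<^esub> (u \<star>\<^bsub>T\<^esub> Ident T C) =
           LUnit T X \<cdot>\<^bsub>T\<^esub> (d \<star>\<^bsub>T\<^esub> Ident T X) \<cdot>\<^bsub>T\<^esub> inverse_arrow T (Assoc T D C X) \<cdot>\<^bsub>T\<^esub>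
           (Ident T D \<star>\<^bsub>T\<^esub> Braid T X C) \<cdot>\<^bsub>T\<^esub> Assoc T D X C))"

text \<open>
  The compatibility of the tensor product with the suspension is that of Hovey, Palmieri and
  Strickland (Axiomatic Stable Homotopy Theory, Appendix A); the sign in
  \<open>SuspTensor_anticommutes\<close> is what makes \<open>End\<^sup>*(1)\<close> graded-commutative.
\<close>

locale tensor_triangulated_category =
  compactly_generated_category U T + symmetric_monoidal_category T
  for U :: "'u itself" and T :: "('o, 'm, 'c) tensor_category_scheme" (structure) +
  assumes TensorA_Plus_left: "\<lbrakk>f \<in> Hom T X Y; g \<in> Hom T X Y; h \<in> Hom T X' Y'\<rbrakk> \<Longrightarrow>
      (f \<boxplus> g) \<star> h = f \<star> h \<boxplus> g \<star> h"
    and TensorA_Plus_right: "\<lbrakk>f \<in> Hom T X Y; g \<in> Hom T X Y; h \<in> Hom T X' Y'\<rbrakk> \<Longrightarrow>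
      h \<star> (f \<boxplus> g) = h \<star> f \<boxplus> h \<star> g"
    and SuspTensor_in_Hom: "SuspTensor T X Y \<in> Hom T (Susp T X \<boxtimes> Y) (Susp T (X \<boxtimes> Y))"
    and SuspTensor_iso: "is_iso T (SuspTensor T X Y)"
    and SuspTensor_natural: "\<lbrakk>f \<in> Hom T X X'; g \<in> Hom T Y Y'\<rbrakk> \<Longrightarrow>
      SuspTensor T X' Y' \<cdot> (SuspA T f \<star> g) = SuspA T (f \<star> g) \<cdot> SuspTensor T X Y"
    and SuspTensor_RUnit: "SuspA T (RUnit T X) \<cdot> SuspTensor T X (Unit T) = RUnit T (Susp T X)"
    and SuspTensor_Assoc:
      "SuspA T (Assoc T X Y Z) \<cdot> SuspTensor T (X \<boxtimes> Y) Z \<cdot> (SuspTensor T X Y \<star> Ident T Z) =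
       SuspTensor T X (Y \<boxtimes> Z) \<cdot> Assoc T (Susp T X) Y Z"
    and SuspTensor_anticommutes:
      "SuspA T (SuspTensorR T X Y) \<cdot> SuspTensor T X (Susp T Y) =
       Neg T (SuspA T (SuspTensor T X Y) \<cdot> SuspTensorR T (Susp T X) Y)"
    and Tensor_exact_left: "Triangle T f g h \<Longrightarrow>
      Triangle T (f \<star> Ident T W) (g \<star> Ident T W) (SuspTensor T (Dom T f) W \<cdot> (h \<star> Ident T W))"
    and Tensor_exact_right: "Triangle T f g h \<Longrightarrow>
      Triangle T (Ident T W \<star> f) (Ident T W \<star> g) (SuspTensorR T W (Dom T f) \<cdot> (Ident T W \<star> h))"
    and Tensor_coproduct_left: "\<lbrakk>small U (I :: 'u set); is_coproduct T I F P \<iota>\<rbrakk> \<Longrightarrow>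
      is_coproduct T I (\<lambda>i. F i \<boxtimes> W) (P \<boxtimes> W) (\<lambda>i. \<iota> i \<star> Ident T W)"
    and Tensor_coproduct_right: "\<lbrakk>small U (I :: 'u set); is_coproduct T I F P \<iota>\<rbrakk> \<Longrightarrow>
      is_coproduct T I (\<lambda>i. W \<boxtimes> F i) (W \<boxtimes> P) (\<lambda>i. Ident T W \<star> \<iota> i)"
    and Unit_compact: "compact_object U T (Unit T)"
    and compact_strongly_dualizable: "compact_object U T C \<Longrightarrow> strongly_dualizable T C"

text \<open>The iterated isomorphism \<open>X \<otimes> \<Sigma>\<^sup>i Y \<rightarrow> \<Sigma>\<^sup>i (X \<otimes> Y)\<close>, first for natural and then for integral \<open>i\<close>.
  For \<open>i = -n < 0\<close> it is \<open>\<Sigma>\<^sup>-\<^sup>n\<close> of the inverse of \<open>X \<otimes> \<Sigma>\<^sup>n (\<Sigma>\<^sup>-\<^sup>n Y) \<rightarrow> \<Sigma>\<^sup>n (X \<otimes> \<Sigma>\<^sup>-\<^sup>n Y)\<close>.\<close>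

primrec SuspTensorR_nat :: "('o, 'm, 'c) tensor_category_scheme \<Rightarrow> 'o \<Rightarrow> 'o \<Rightarrow> nat \<Rightarrow> 'm" where
  "SuspTensorR_nat T X Y 0 = Ident T (X \<boxtimes>\<^bsub>T\<^esub> Y)"
| "SuspTensorR_nat T X Y (Suc n) =
     SuspA T (SuspTensorR_nat T X Y n) \<cdot>\<^bsub>T\<^esub> SuspTensorR T X ((Susp T ^^ n) Y)"

definition SuspTensorR_int :: "('o, 'm, 'c) tensor_category_scheme \<Rightarrow> 'o \<Rightarrow> 'o \<Rightarrow> int \<Rightarrow> 'm" where
  "SuspTensorR_int T X Y i =
     (if 0 \<le> i then SuspTensorR_nat T X Y (nat i)
      else SuspA_pow T i (inverse_arrow T (SuspTensorR_nat T X (Susp_pow T i Y) (nat (- i)))))"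

definition tensor_action ::
  "('o, 'm, 'c) tensor_category_scheme \<Rightarrow> 'o \<Rightarrow> (int \<Rightarrow> 'm) \<Rightarrow> int \<Rightarrow> 'm" where
  \<comment> \<open>\<open>X \<otimes> - : End\<^sup>*(1) \<rightarrow> End\<^sup>*(X)\<close>, in degree \<open>i\<close> the composite
      \<open>X \<cong> X \<otimes> 1 \<rightarrow> X \<otimes> \<Sigma>\<^sup>i 1 \<cong> \<Sigma>\<^sup>i (X \<otimes> 1) \<cong> \<Sigma>\<^sup>i X\<close>\<close>
  "tensor_action T X \<psi> =
     (\<lambda>i. SuspA_pow T i (RUnit T X) \<cdot>\<^bsub>T\<^esub> SuspTensorR_int T X (Unit T) i \<cdot>\<^bsub>T\<^esub>
          (Ident T X \<star>\<^bsub>T\<^esub> \<psi> i) \<cdot>\<^bsub>T\<^esub> inverse_arrow T (RUnit T X))"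

definition canonical_action ::
  "('r, 'k) graded_ring_scheme \<Rightarrow> ('o, 'm, 'c) tensor_category_scheme \<Rightarrow> ('o \<Rightarrow> 'r \<Rightarrow> int \<Rightarrow> 'm) \<Rightarrow> bool"
  where
  "canonical_action R T \<rho> \<longleftrightarrow>
     (\<exists>\<phi> \<in> graded_ring_hom R (graded_End T (Unit T)).
        \<forall>X. \<forall>r \<in> carrier R. \<rho> X r = tensor_action T X (\<phi> r))"


section \<open>Local cohomology functors, support, stratification\<close>

definition supported_on ::
  "'u itself \<Rightarrow> ('r, 'k) graded_ring_scheme \<Rightarrow> ('o, 'm, 'c) tensor_category_scheme \<Rightarrow>
    ('o \<Rightarrow> 'r \<Rightarrow> int \<Rightarrow> 'm) \<Rightarrow> 'r set set \<Rightarrow> 'o set" where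
  "supported_on U R T \<rho> V =
     {X. \<forall>C. compact_object U T C \<longrightarrow>
        (\<forall>p \<in> Spec R - V. localizes_to_zero R p (Hom_module T \<rho> C X))}"

text \<open>
  For specialization closed \<open>V\<close> the localization triangle \<open>\<Gamma>\<^sub>V X \<rightarrow> X \<rightarrow> L\<^sub>V X \<rightarrow>\<close> exists and is determined
  by \<open>X\<close> up to unique isomorphism; \<open>\<Gamma>\<^sub>V X\<close> and \<open>L\<^sub>V X\<close> are the vertices of a chosen one.
\<close>

definition localization_triangle ::
  "'u itself \<Rightarrow> ('r, 'k) graded_ring_scheme \<Rightarrow> ('o, 'm, 'c) tensor_category_scheme \<Rightarrow>
    ('o \<Rightarrow> 'r \<Rightarrow> int \<Rightarrow> 'm) \<Rightarrow> 'r set set \<Rightarrow> 'o \<Rightarrow> 'o \<times> 'o \<Rightarrow> bool" where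
  "localization_triangle U R T \<rho> V X = (\<lambda>(G, L).
     (\<exists>f g h. f \<in> Hom T G X \<and> g \<in> Hom T X L \<and> Triangle T f g h) \<and>
     G \<in> supported_on U R T \<rho> V \<and>
     (\<forall>W \<in> supported_on U R T \<rho> V. Hom T W L = {Zero T W L}))"

definition chosen_localization ::
  "'u itself \<Rightarrow> ('r, 'k) graded_ring_scheme \<Rightarrow> ('o, 'm, 'c) tensor_category_scheme \<Rightarrow>
    ('o \<Rightarrow> 'r \<Rightarrow> int \<Rightarrow> 'm) \<Rightarrow> 'r set set \<Rightarrow> 'o \<Rightarrow> 'o \<times> 'o" where
  "chosen_localization U R T \<rho> V X = (SOME GL. localization_triangle U R T \<rho> V X GL)"

definition Gamma_V ::
  "'u itself \<Rightarrow> ('r, 'k) graded_ring_scheme \<Rightarrow> ('o, 'm, 'c) tensor_category_scheme \<Rightarrow>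
    ('o \<Rightarrow> 'r \<Rightarrow> int \<Rightarrow> 'm) \<Rightarrow> 'r set set \<Rightarrow> 'o \<Rightarrow> 'o" where
  "Gamma_V U R T \<rho> V X = fst (chosen_localization U R T \<rho> V X)"

definition L_V ::
  "'u itself \<Rightarrow> ('r, 'k) graded_ring_scheme \<Rightarrow> ('o, 'm, 'c) tensor_category_scheme \<Rightarrow>
    ('o \<Rightarrow> 'r \<Rightarrow> int \<Rightarrow> 'm) \<Rightarrow> 'r set set \<Rightarrow> 'o \<Rightarrow> 'o" where
  "L_V U R T \<rho> V X = snd (chosen_localization U R T \<rho> V X)"

definition Gamma ::
  "'u itself \<Rightarrow> ('r, 'k) graded_ring_scheme \<Rightarrow> ('o, 'm, 'c) tensor_category_scheme \<Rightarrow>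
    ('o \<Rightarrow> 'r \<Rightarrow> int \<Rightarrow> 'm) \<Rightarrow> 'r set \<Rightarrow> 'o \<Rightarrow> 'o" where
  "Gamma U R T \<rho> p X = Gamma_V U R T \<rho> (closed_set R p) (L_V U R T \<rho> (not_below R p) X)"

definition Gamma_image ::
  "'u itself \<Rightarrow> ('r, 'k) graded_ring_scheme \<Rightarrow> ('o, 'm, 'c) tensor_category_scheme \<Rightarrow>
    ('o \<Rightarrow> 'r \<Rightarrow> int \<Rightarrow> 'm) \<Rightarrow> 'r set \<Rightarrow> 'o set" where
  "Gamma_image U R T \<rho> p = {Y. \<exists>X. isomorphic T (Gamma U R T \<rho> p X) Y}"

definition supp ::
  "'u itself \<Rightarrow> ('r, 'k) graded_ring_scheme \<Rightarrow> ('o, 'm, 'c) tensor_category_scheme \<Rightarrow>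
    ('o \<Rightarrow> 'r \<Rightarrow> int \<Rightarrow> 'm) \<Rightarrow> 'o \<Rightarrow> 'r set set" where
  "supp U R T \<rho> X = {p \<in> Spec R. \<not> zero_object T (Gamma U R T \<rho> p X)}"

definition tensor_ideal :: "('o, 'm, 'c) tensor_category_scheme \<Rightarrow> 'o set \<Rightarrow> bool" where
  "tensor_ideal T S \<longleftrightarrow> (\<forall>X. \<forall>Y\<in>S. X \<boxtimes>\<^bsub>T\<^esub> Y \<in> S)"

definition stratified ::
  "'u itself \<Rightarrow> ('r, 'k) graded_ring_scheme \<Rightarrow> ('o, 'm, 'c) tensor_category_scheme \<Rightarrow>
    ('o \<Rightarrow> 'r \<Rightarrow> int \<Rightarrow> 'm) \<Rightarrow> bool" where
  "stratified U R T \<rho> \<longleftrightarrow>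
     (\<forall>p \<in> Spec R.
        (\<forall>X \<in> Gamma_image U R T \<rho> p. zero_object T X) \<or>
        (\<forall>S. localizing U T S \<and> tensor_ideal T S \<and> S \<subseteq> Gamma_image U R T \<rho> p \<longrightarrow>
           (\<forall>X\<in>S. zero_object T X) \<or> S = Gamma_image U R T \<rho> p))"

end

theory Submission
  imports Defs
begin

text \<open>
  Localization at the primes in \<open>V\<close> is smashing: for \<open>V = \<Z>(p)\<close> and \<open>V = \<V>(p)\<close> there is a single exact
  triangle \<open>E \<rightarrow> 1 \<rightarrow> H\<close> such that \<open>\<Gamma>\<^sub>V X = E \<otimes> X\<close> and \<open>L\<^sub>V X = H \<otimes> X\<close>.  Hence \<open>\<Gamma>\<^sub>p X\<close> is
  \<open>E\<^sub>1 \<otimes> (H\<^sub>2 \<otimes> X)\<close>, one inclusion is immediate, and \<open>\<Gamma>\<^sub>p T\<close> consists of the objects \<open>W\<close> with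
  \<open>H\<^sub>1 \<otimes> W = 0 = E\<^sub>2 \<otimes> W\<close>.  If \<open>\<Gamma>\<^sub>p (X \<otimes> Y) = 0\<close> with \<open>\<Gamma>\<^sub>p Y \<noteq> 0\<close>, then the localizing tensor ideal
  of those \<open>W\<close> in \<open>\<Gamma>\<^sub>p T\<close> with \<open>X \<otimes> W = 0\<close> contains \<open>\<Gamma>\<^sub>p Y\<close>; by stratification it contains
  \<open>\<Gamma>\<^sub>p 1\<close>, so \<open>\<Gamma>\<^sub>p X = 0\<close>.

  To construct \<open>H\<close> for the set \<open>S\<close> of homogeneous elements to be inverted, let \<open>F\<^sub>r\<close> be the fibre of
  \<open>r : 1 \<rightarrow> \<Sigma>\<^sup>d 1\<close> and let \<open>u : 1 \<rightarrow> Q\<close> be the cone of \<open>\<Coprod>\<^sub>r F\<^sub>r \<rightarrow> 1\<close>.  As \<open>u\<close> factors through every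
  \<open>r\<close>, in particular through \<open>r\<^sup>2\<close>, which vanishes on \<open>F\<^sub>r\<close>, the homotopy colimit \<open>H\<close> of
  \<open>1 \<rightarrow> Q \<rightarrow> Q \<otimes> Q \<rightarrow> \<dots>\<close> satisfies \<open>H \<otimes> F\<^sub>r = 0\<close>.
  For \<open>\<Z>(p)\<close> the set \<open>S\<close> is the complement of \<open>p\<close>; for \<open>\<V>(p)\<close> one takes the powers of each of
  finitely many homogeneous generators of \<open>p\<close> and tensors the resulting objects \<open>E\<close>.
\<close>

section \<open>Categories and isomorphisms\<close>

text \<open>\<open>Gamma_V\<close> and \<open>L_V\<close> come from an arbitrary choice of
  localization triangle, so they can be computed only by exhibiting one such triangle and showing
  that every other one has isomorphic vertices. Moreover \<open>supported_on\<close> speaks of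
  localized modules at many primes at once, whereas the telescope is built from one multiplicative
  set. The two are matched on single maps f out of suspended compact objects: having, at each prime
  outside V, an annihilator outside that prime must amount to being annihilated by one element of
  the multiplicative set. Passing from many primes to one element is a prime avoidance argument for
  the homogeneous annihilator of f. A second obstacle is that endomorphisms of the unit commute with
  suspensions and with each other only up to sign, while their composition is matched with the
  action only up to an automorphism. What is extracted is always the vanishing or the invertibility
  of a map, which neither affects, so the signs of the action are never computed.\<close>

context category begin

lemma Hom_iff: "f \<in> Hom T X Y \<longleftrightarrow> Dom T f = X \<and> Cod T f = Y"
  by (simp add: Hom_def)

lemma Dom_Ident [simp]: "Dom T (Ident T X) = X"
  and Cod_Ident [simp]: "Cod T (Ident T X) = X"
  using Ident_in_Hom[of X] by (auto simp: Hom_iff)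

lemma Dom_Compose [simp]: "Cod T f = Dom T g \<Longrightarrow> Dom T (g \<cdot> f) = Dom T f"
  and Cod_Compose [simp]: "Cod T f = Dom T g \<Longrightarrow> Cod T (g \<cdot> f) = Cod T g"
  using Compose_in_Hom[of f "Dom T f" "Cod T f" g "Cod T g"] by (auto simp: Hom_iff)

lemma Compose_Ident_left [simp]: "Cod T f = X \<Longrightarrow> Ident T X \<cdot> f = f"
  using Ident_left[of f "Dom T f"] by (simp add: Hom_iff)

lemma Compose_Ident_right [simp]: "Dom T f = X \<Longrightarrow> f \<cdot> Ident T X = f"
  using Ident_right[of f "Dom T f" "Cod T f"] by (simp add: Hom_iff)

lemma assoc: "\<lbrakk>Cod T f = Dom T g; Cod T g = Dom T h\<rbrakk> \<Longrightarrow> (h \<cdot> g) \<cdot> f = h \<cdot> (g \<cdot> f)"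
  using Compose_assoc[of f "Dom T f" "Cod T f" g "Cod T g" h "Cod T h"] by (simp add: Hom_iff)

lemma inverse_arrows_unique:
  assumes "inverse_arrows T f g" "inverse_arrows T f g'"
  shows "g = g'"
proof -
  have [simp]: "Dom T g = Cod T f" "Cod T g = Dom T f" "Dom T g' = Cod T f" "Cod T g' = Dom T f"
    using assms by (auto simp: inverse_arrows_def Hom_iff)
  have "g = g \<cdot> (f \<cdot> g')"
    using assms by (simp add: inverse_arrows_def)
  also have "\<dots> = (g \<cdot> f) \<cdot> g'"
    by (simp add: assoc)
  also have "\<dots> = g'"
    using assms by (simp add: inverse_arrows_def)
  finally show ?thesis .
qed

lemma isoI:
  assumes "Dom T g = Cod T f" "Cod T g = Dom T f" "g \<cdot> f = Ident T (Dom T f)" "f \<cdot> g = Ident T (Cod T f)"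
  shows "is_iso T f"
  using assms by (auto simp: is_iso_def inverse_arrows_def Hom_iff)

lemma inverse_arrowI:
  assumes "Dom T g = Cod T f" "Cod T g = Dom T f" "g \<cdot> f = Ident T (Dom T f)" "f \<cdot> g = Ident T (Cod T f)"
  shows "inverse_arrow T f = g"
  unfolding inverse_arrow_def
  using assms by (intro the_equality) (auto simp: inverse_arrows_def Hom_iff intro: inverse_arrows_unique)

lemma inverse_arrow:
  assumes "is_iso T f"
  shows "inverse_arrows T f (inverse_arrow T f)"
  using assms unfolding is_iso_def inverse_arrow_def
  by (metis (mono_tags, lifting) inverse_arrows_unique theI)

lemma Dom_inverse_arrow [simp]: "is_iso T f \<Longrightarrow> Dom T (inverse_arrow T f) = Cod T f"
  and Cod_inverse_arrow [simp]: "is_iso T f \<Longrightarrow> Cod T (inverse_arrow T f) = Dom T f"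
  and inverse_arrow_left [simp]: "is_iso T f \<Longrightarrow> inverse_arrow T f \<cdot> f = Ident T (Dom T f)"
  and inverse_arrow_right [simp]: "is_iso T f \<Longrightarrow> f \<cdot> inverse_arrow T f = Ident T (Cod T f)"
  using inverse_arrow[of f] by (auto simp: inverse_arrows_def Hom_iff)

lemma inverse_arrow_left_assoc [simp]:
  "\<lbrakk>is_iso T f; Cod T g = Dom T f\<rbrakk> \<Longrightarrow> inverse_arrow T f \<cdot> (f \<cdot> g) = g"
  by (subst assoc[symmetric]) auto

lemma inverse_arrow_right_assoc [simp]:
  "\<lbrakk>is_iso T f; Cod T g = Cod T f\<rbrakk> \<Longrightarrow> f \<cdot> (inverse_arrow T f \<cdot> g) = g"
  by (subst assoc[symmetric]) auto

lemma iso_Ident [simp]: "is_iso T (Ident T X)"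
  by (rule isoI[of "Ident T X"]) auto

lemma iso_inverse_arrow [simp]: "is_iso T f \<Longrightarrow> is_iso T (inverse_arrow T f)"
  by (rule isoI[of f]) auto

lemma iso_Compose [simp]:
  assumes "is_iso T f" "is_iso T g" "Cod T f = Dom T g"
  shows "is_iso T (g \<cdot> f)"
  using assms by (intro isoI[of "inverse_arrow T f \<cdot> inverse_arrow T g"]) (auto simp: assoc)

lemma iso_cancel_left:
  assumes "is_iso T g" "Cod T f = Dom T g" "Cod T f' = Dom T g"
  shows "g \<cdot> f = g \<cdot> f' \<longleftrightarrow> f = f'"
  using assms inverse_arrow_left_assoc by metis

lemma iso_cancel_right:
  assumes "is_iso T g" "Dom T f = Cod T g" "Dom T f' = Cod T g"
  shows "f \<cdot> g = f' \<cdot> g \<longleftrightarrow> f = f'"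
proof
  assume "f \<cdot> g = f' \<cdot> g"
  then have "(f \<cdot> g) \<cdot> inverse_arrow T g = (f' \<cdot> g) \<cdot> inverse_arrow T g" by simp
  then show "f = f'" using assms by (simp add: assoc)
qed simp

lemma iso_iso_right:
  assumes "is_iso T f" "Cod T f = Dom T g" "is_iso T (g \<cdot> f)"
  shows "is_iso T g"
  using iso_Compose[of "inverse_arrow T f" "g \<cdot> f"] assms by (simp add: assoc)

lemma isomorphic_iff: "isomorphic T X Y \<longleftrightarrow> (\<exists>f. Dom T f = X \<and> Cod T f = Y \<and> is_iso T f)"
  by (auto simp: isomorphic_def Hom_iff)

lemma isomorphicI: "is_iso T f \<Longrightarrow> isomorphic T (Dom T f) (Cod T f)"
  by (auto simp: isomorphic_iff)

lemma isomorphic_refl [simp]: "isomorphic T X X"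
  using isomorphicI[OF iso_Ident] by simp

lemma isomorphic_sym: "isomorphic T X Y \<Longrightarrow> isomorphic T Y X"
  by (metis Dom_inverse_arrow Cod_inverse_arrow iso_inverse_arrow isomorphic_iff)

lemma isomorphic_trans [trans]: "isomorphic T X Y \<Longrightarrow> isomorphic T Y Z \<Longrightarrow> isomorphic T X Z"
  unfolding isomorphic_iff by (metis Dom_Compose Cod_Compose iso_Compose)

text \<open>Isomorphism in the arrow category. Being zero, being invertible and having a given cone
  are invariant under it, so tensor factors can be permuted and units removed without naming the
  coherence isomorphisms that do so.\<close>

definition arrow_iso :: "'m \<Rightarrow> 'm \<Rightarrow> bool" where
  "arrow_iso f g \<longleftrightarrow> (\<exists>a b. is_iso T a \<and> is_iso T b \<and> Dom T a = Dom T f \<and> Cod T a = Dom T g \<and>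
     Dom T b = Cod T f \<and> Cod T b = Cod T g \<and> b \<cdot> f = g \<cdot> a)"

lemma arrow_isoI:
  "\<lbrakk>is_iso T a; is_iso T b; Dom T a = Dom T f; Cod T a = Dom T g; Dom T b = Cod T f; Cod T b = Cod T g;
    b \<cdot> f = g \<cdot> a\<rbrakk> \<Longrightarrow> arrow_iso f g"
  unfolding arrow_iso_def by blast

lemma arrow_iso_pre: "is_iso T a \<Longrightarrow> Cod T a = Dom T f \<Longrightarrow> arrow_iso (f \<cdot> a) f"
  by (rule arrow_isoI[of a "Ident T (Cod T f)"]) auto

lemma arrow_iso_sym: 
  assumes "arrow_iso f g"
  shows "arrow_iso g f"
proof -
  obtain a b where ab [simp]: "is_iso T a" "is_iso T b" "Dom T a = Dom T f" "Cod T a = Dom T g"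
     "Dom T b = Cod T f" "Cod T b = Cod T g" and eq: "b \<cdot> f = g \<cdot> a"
    using assms unfolding arrow_iso_def by blast
  have "b \<cdot> (f \<cdot> inverse_arrow T a) = (g \<cdot> a) \<cdot> inverse_arrow T a"
    by (subst eq[symmetric]) (simp add: assoc)
  also have "\<dots> = b \<cdot> (inverse_arrow T b \<cdot> g)"
    by (simp add: assoc)
  finally have "f \<cdot> inverse_arrow T a = inverse_arrow T b \<cdot> g"
    by (subst (asm) iso_cancel_left) auto
  then show ?thesis
    by (intro arrow_isoI[of "inverse_arrow T a" "inverse_arrow T b"]) auto
qed

lemma arrow_iso_trans [trans]:
  assumes "arrow_iso f g" "arrow_iso g h"
  shows "arrow_iso f h"
proof -
  obtain a b where ab [simp]: "is_iso T a" "is_iso T b" "Dom T a = Dom T f" "Cod T a = Dom T g"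
     "Dom T b = Cod T f" "Cod T b = Cod T g" and eq: "b \<cdot> f = g \<cdot> a"
    using assms unfolding arrow_iso_def by blast
  obtain c d where cd [simp]: "is_iso T c" "is_iso T d" "Dom T c = Dom T g" "Cod T c = Dom T h"
     "Dom T d = Cod T g" "Cod T d = Cod T h" and eq': "d \<cdot> g = h \<cdot> c"
    using assms unfolding arrow_iso_def by blast
  have "(d \<cdot> b) \<cdot> f = (d \<cdot> g) \<cdot> a" using eq by (simp add: assoc)
  also have "\<dots> = h \<cdot> (c \<cdot> a)" using eq' by (simp add: assoc)
  finally show ?thesis
    by (intro arrow_isoI[of "c \<cdot> a" "d \<cdot> b"]) auto
qed

lemma arrow_iso_is_iso:
  assumes "arrow_iso f g" "is_iso T f"
  shows "is_iso T g"
proof -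
  obtain a b where ab [simp]: "is_iso T a" "is_iso T b" "Dom T a = Dom T f" "Cod T a = Dom T g"
     "Dom T b = Cod T f" "Cod T b = Cod T g" and eq: "b \<cdot> f = g \<cdot> a"
    using assms unfolding arrow_iso_def by blast
  have "is_iso T (g \<cdot> a)" using eq assms by (metis ab iso_Compose)
  then show ?thesis using iso_iso_right[of a g] by simp
qed

lemma arrow_iso_Ident: "isomorphic T X Y \<Longrightarrow> arrow_iso (Ident T X) (Ident T Y)"
  unfolding isomorphic_iff by (auto intro!: arrow_isoI)

end

section \<open>Additive categories\<close>

context additive_category begin

lemma Dom_Zero [simp]: "Dom T (Zero T X Y) = X"
  and Cod_Zero [simp]: "Cod T (Zero T X Y) = Y"
proof -
  interpret comm_group "Hom_group T X Y" by (rule Hom_comm_group)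
  show "Dom T (Zero T X Y) = X" "Cod T (Zero T X Y) = Y"
    using one_closed by (auto simp: Hom_group_def Hom_iff)
qed

lemma Dom_Plus [simp]: "Dom T f = Dom T g \<Longrightarrow> Cod T f = Cod T g \<Longrightarrow> Dom T (f \<boxplus> g) = Dom T g"
  and Cod_Plus [simp]: "Dom T f = Dom T g \<Longrightarrow> Cod T f = Cod T g \<Longrightarrow> Cod T (f \<boxplus> g) = Cod T g"
proof -
  interpret comm_group "Hom_group T (Dom T g) (Cod T g)" by (rule Hom_comm_group)
  assume "Dom T f = Dom T g" "Cod T f = Cod T g"
  then show "Dom T (f \<boxplus> g) = Dom T g" "Cod T (f \<boxplus> g) = Cod T g"
    using m_closed[of f g] by (auto simp: Hom_group_def Hom_iff)
qed

lemma Plus_Zero_right [simp]: "Dom T f = X \<Longrightarrow> Cod T f = Y \<Longrightarrow> f \<boxplus> Zero T X Y = f"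
  and Plus_Zero_left [simp]: "Dom T f = X \<Longrightarrow> Cod T f = Y \<Longrightarrow> Zero T X Y \<boxplus> f = f"
proof -
  interpret comm_group "Hom_group T X Y" by (rule Hom_comm_group)
  assume "Dom T f = X" "Cod T f = Y"
  then show "f \<boxplus> Zero T X Y = f" "Zero T X Y \<boxplus> f = f"
    using r_one[of f] l_one[of f] by (auto simp: Hom_group_def Hom_iff)
qed

lemma Plus_comm: "Dom T f = Dom T g \<Longrightarrow> Cod T f = Cod T g \<Longrightarrow> f \<boxplus> g = g \<boxplus> f"
proof -
  interpret comm_group "Hom_group T (Dom T g) (Cod T g)" by (rule Hom_comm_group)
  assume "Dom T f = Dom T g" "Cod T f = Cod T g"
  then show ?thesis using m_comm[of f g] by (auto simp: Hom_group_def Hom_iff)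
qed

lemma Plus_assoc:
  "\<lbrakk>Dom T f = Dom T g; Cod T f = Cod T g; Dom T g = Dom T h; Cod T g = Cod T h\<rbrakk> \<Longrightarrow>
    (f \<boxplus> g) \<boxplus> h = f \<boxplus> (g \<boxplus> h)"
proof -
  interpret comm_group "Hom_group T (Dom T h) (Cod T h)" by (rule Hom_comm_group)
  assume "Dom T f = Dom T g" "Cod T f = Cod T g" "Dom T g = Dom T h" "Cod T g = Cod T h"
  then show ?thesis using m_assoc[of f g h] by (auto simp: Hom_group_def Hom_iff)
qed

lemma Dom_Neg [simp]: "Dom T (Neg T f) = Dom T f"
  and Cod_Neg [simp]: "Cod T (Neg T f) = Cod T f"
  and Plus_Neg_right [simp]: "f \<boxplus> Neg T f = Zero T (Dom T f) (Cod T f)"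
  and Plus_Neg_left [simp]: "Neg T f \<boxplus> f = Zero T (Dom T f) (Cod T f)"
proof -
  interpret comm_group "Hom_group T (Dom T f) (Cod T f)" by (rule Hom_comm_group)
  show "Dom T (Neg T f) = Dom T f" "Cod T (Neg T f) = Cod T f"
   "f \<boxplus> Neg T f = Zero T (Dom T f) (Cod T f)" "Neg T f \<boxplus> f = Zero T (Dom T f) (Cod T f)"
    using inv_closed[of f] r_inv[of f] l_inv[of f] by (auto simp: Neg_def Hom_group_def Hom_iff)
qed

lemma Plus_cancel_left:
  assumes "f \<boxplus> g = f \<boxplus> h" "Dom T f = Dom T g" "Cod T f = Cod T g" "Dom T g = Dom T h" "Cod T g = Cod T h"
  shows "g = h"
proof -
  have "g = (Neg T f \<boxplus> f) \<boxplus> g" by (simp add: assms)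
  also have "\<dots> = Neg T f \<boxplus> (f \<boxplus> h)" by (subst Plus_assoc) (simp_all add: assms)
  also have "\<dots> = (Neg T f \<boxplus> f) \<boxplus> h" by (subst Plus_assoc) (simp_all add: assms)
  also have "\<dots> = h" by (simp add: assms)
  finally show ?thesis .
qed

lemma Plus_cancel_self:
  assumes "f \<boxplus> f = f"
  shows "f = Zero T (Dom T f) (Cod T f)"
  using Plus_cancel_left[of f f "Zero T (Dom T f) (Cod T f)"] assms by simp

lemma Neg_unique:
  assumes "f \<boxplus> g = Zero T (Dom T f) (Cod T f)" "Dom T f = Dom T g" "Cod T f = Cod T g"
  shows "g = Neg T f"
  by (rule Plus_cancel_left[of f]) (simp_all add: assms)

lemma Neg_Neg [simp]: "Neg T (Neg T f) = f"
  using Neg_unique[of "Neg T f" f] by simp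

lemma Neg_Zero [simp]: "Neg T (Zero T X Y) = Zero T X Y"
  using Neg_unique[of "Zero T X Y" "Zero T X Y"] by simp

lemma Neg_eq_Zero_iff: "Neg T f = Zero T X Y \<longleftrightarrow> f = Zero T X Y"
  by (metis Neg_Neg Neg_Zero)

lemma diff_eq_Zero:
  assumes "f \<boxplus> Neg T g = Zero T X Y" "Dom T f = X" "Cod T f = Y" "Dom T g = X" "Cod T g = Y"
  shows "f = g"
proof -
  have "Neg T g = Neg T f" using assms by (intro Neg_unique) simp_all
  then have "Neg T (Neg T g) = Neg T (Neg T f)" by simp
  then show ?thesis by simp
qed

lemma distrib_left:
  "\<lbrakk>Cod T f = Dom T g; Dom T g = Dom T h; Cod T g = Cod T h\<rbrakk> \<Longrightarrow> (g \<boxplus> h) \<cdot> f = g \<cdot> f \<boxplus> h \<cdot> f"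
  using Compose_Plus_left[of f "Dom T f" "Cod T f" g "Cod T g" h] by (auto simp: Hom_iff)

lemma distrib_right:
  "\<lbrakk>Cod T f = Dom T h; Dom T f = Dom T g; Cod T f = Cod T g\<rbrakk> \<Longrightarrow> h \<cdot> (f \<boxplus> g) = h \<cdot> f \<boxplus> h \<cdot> g"
  using Compose_Plus_right[of f "Dom T f" "Cod T f" g h "Cod T h"] by (auto simp: Hom_iff)

lemma Zero_Compose [simp]: "Cod T f = X \<Longrightarrow> Zero T X Y \<cdot> f = Zero T (Dom T f) Y"
  using Plus_cancel_self[of "Zero T X Y \<cdot> f"] distrib_left[of f "Zero T X Y" "Zero T X Y"] by simp

lemma Compose_Zero [simp]: "Dom T f = Y \<Longrightarrow> f \<cdot> Zero T X Y = Zero T X (Cod T f)"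
  using Plus_cancel_self[of "f \<cdot> Zero T X Y"] distrib_right[of "Zero T X Y" f "Zero T X Y"] by simp

lemma Neg_Compose: "Cod T f = Dom T g \<Longrightarrow> Neg T g \<cdot> f = Neg T (g \<cdot> f)"
  by (rule Neg_unique[of "g \<cdot> f" "Neg T g \<cdot> f"]) (simp_all flip: distrib_left)

lemma Compose_Neg: "Cod T f = Dom T g \<Longrightarrow> g \<cdot> Neg T f = Neg T (g \<cdot> f)"
  by (rule Neg_unique[of "g \<cdot> f" "g \<cdot> Neg T f"]) (simp_all flip: distrib_right)

lemma zero_object_iff: "zero_object T Z \<longleftrightarrow> Ident T Z = Zero T Z Z"
proof
  assume "zero_object T Z"
  then have "\<exists>!f. f \<in> Hom T Z Z" by (simp add: zero_object_def)
  then show "Ident T Z = Zero T Z Z" by (metis Ident_in_Hom Hom_iff Dom_Zero Cod_Zero)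
next
  assume eq: "Ident T Z = Zero T Z Z"
  have 1: "f = Zero T X Z" if "Dom T f = X" "Cod T f = Z" for f X
    using Compose_Ident_left[OF that(2)] that by (simp add: eq)
  have 2: "f = Zero T Z X" if "Dom T f = Z" "Cod T f = X" for f X
    using Compose_Ident_right[OF that(1)] that by (simp add: eq)
  show "zero_object T Z"
    unfolding zero_object_def Hom_iff
    using 1 2 by (intro allI conjI ex1I[of _ "Zero T _ Z"] ex1I[of _ "Zero T Z _"]) auto
qed

lemma zero_object_Dom: "zero_object T (Dom T f) \<Longrightarrow> f = Zero T (Dom T f) (Cod T f)"
  using Compose_Ident_right[of f "Dom T f"] by (simp add: zero_object_iff)

lemma zero_object_Cod: "zero_object T (Cod T f) \<Longrightarrow> f = Zero T (Dom T f) (Cod T f)"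
  using Compose_Ident_left[of f "Cod T f"] by (simp add: zero_object_iff)

lemma arrow_iso_Zero:
  assumes "arrow_iso f g" "f = Zero T (Dom T f) (Cod T f)"
  shows "g = Zero T (Dom T g) (Cod T g)"
proof -
  obtain a b where ab [simp]: "is_iso T a" "is_iso T b" "Dom T a = Dom T f" "Cod T a = Dom T g"
     "Dom T b = Cod T f" "Cod T b = Cod T g" and eq: "b \<cdot> f = g \<cdot> a"
    using assms unfolding arrow_iso_def by blast
  have "g \<cdot> a = Zero T (Dom T g) (Cod T g) \<cdot> a"
    by (subst eq[symmetric], subst assms(2)) simp
  then show ?thesis by (rule iffD1[OF iso_cancel_right, rotated -1]) simp_all
qed

lemma zero_object_isomorphic: "isomorphic T X Y \<Longrightarrow> zero_object T X \<Longrightarrow> zero_object T Y"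
  using arrow_iso_Zero[OF arrow_iso_Ident, of X Y] by (simp add: zero_object_iff)

text \<open>Graded commutativity and the passage of an action through suspensions introduce signs
  that depend on degrees. Only vanishing of composites is extracted from such identities, so the
  sign is left undetermined.\<close>

definition eq_upto_sign :: "'m \<Rightarrow> 'm \<Rightarrow> bool" where
  "eq_upto_sign f g \<longleftrightarrow> f = g \<or> f = Neg T g"

lemma eq_upto_sign_refl [simp]: "eq_upto_sign f f"
  by (simp add: eq_upto_sign_def)

lemma eq_upto_sign_sym: "eq_upto_sign f g \<Longrightarrow> eq_upto_sign g f"
  by (auto simp: eq_upto_sign_def)

lemma eq_upto_sign_trans [trans]: "eq_upto_sign f g \<Longrightarrow> eq_upto_sign g h \<Longrightarrow> eq_upto_sign f h"
  by (auto simp: eq_upto_sign_def)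

lemma eq_upto_sign_Compose_left: "eq_upto_sign f g \<Longrightarrow> Cod T f = Dom T h \<Longrightarrow> eq_upto_sign (h \<cdot> f) (h \<cdot> g)"
  by (auto simp: eq_upto_sign_def Compose_Neg)

lemma eq_upto_sign_Compose_right: "eq_upto_sign f g \<Longrightarrow> Cod T h = Dom T f \<Longrightarrow> eq_upto_sign (f \<cdot> h) (g \<cdot> h)"
  by (auto simp: eq_upto_sign_def Neg_Compose)

lemma eq_upto_sign_Zero: "eq_upto_sign f g \<Longrightarrow> g = Zero T X Y \<Longrightarrow> f = Zero T X Y"
  by (auto simp: eq_upto_sign_def)

section \<open>Universal property and reindexing of coproducts\<close>

lemma coproduct_unique:
  assumes "is_coproduct T I X P \<iota>" "Dom T u = P" "Dom T v = P" "Cod T u = Cod T v"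
    "\<And>i. i \<in> I \<Longrightarrow> u \<cdot> \<iota> i = v \<cdot> \<iota> i"
  shows "u = v"
proof -
  have "\<forall>i\<in>I. u \<cdot> \<iota> i \<in> Hom T (X i) (Cod T u)"
    using assms(1,2) by (auto simp: is_coproduct_def Hom_iff)
  then have "\<exists>!w. w \<in> Hom T P (Cod T u) \<and> (\<forall>i\<in>I. w \<cdot> \<iota> i = u \<cdot> \<iota> i)"
    using assms(1) unfolding is_coproduct_def by (elim conjE allE[of _ "Cod T u"] allE[of _ "\<lambda>i. u \<cdot> \<iota> i"]) auto
  moreover have "u \<in> Hom T P (Cod T u) \<and> (\<forall>i\<in>I. u \<cdot> \<iota> i = u \<cdot> \<iota> i)"
    "v \<in> Hom T P (Cod T u) \<and> (\<forall>i\<in>I. v \<cdot> \<iota> i = u \<cdot> \<iota> i)"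
    using assms by (auto simp: Hom_iff)
  ultimately show ?thesis by blast
qed

lemma coproduct_ex:
  assumes "is_coproduct T I X P \<iota>" "\<And>i. i \<in> I \<Longrightarrow> Dom T (f i) = X i \<and> Cod T (f i) = Y"
  obtains u where "Dom T u = P" "Cod T u = Y" "\<And>i. i \<in> I \<Longrightarrow> u \<cdot> \<iota> i = f i"
proof -
  have "\<forall>i\<in>I. f i \<in> Hom T (X i) Y" using assms by (auto simp: Hom_iff)
  then have "\<exists>u. u \<in> Hom T P Y \<and> (\<forall>i\<in>I. u \<cdot> \<iota> i = f i)"
    using assms(1) unfolding is_coproduct_def by blast
  then show thesis using that by (auto simp: Hom_iff)
qed

lemma coproduct_inj: "is_coproduct T I X P \<iota> \<Longrightarrow> i \<in> I \<Longrightarrow> Dom T (\<iota> i) = X i"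
  "is_coproduct T I X P \<iota> \<Longrightarrow> i \<in> I \<Longrightarrow> Cod T (\<iota> i) = P"
  by (auto simp: is_coproduct_def Hom_iff)

lemma coproductI:
  assumes "\<And>i. i \<in> I \<Longrightarrow> Dom T (\<iota> i) = X i \<and> Cod T (\<iota> i) = P"
    and "\<And>Y f. (\<And>i. i \<in> I \<Longrightarrow> Dom T (f i) = X i \<and> Cod T (f i) = Y) \<Longrightarrow>
      \<exists>u. Dom T u = P \<and> Cod T u = Y \<and> (\<forall>i\<in>I. u \<cdot> \<iota> i = f i)"
    and "\<And>u v. \<lbrakk>Dom T u = P; Dom T v = P; Cod T u = Cod T v; \<And>i. i \<in> I \<Longrightarrow> u \<cdot> \<iota> i = v \<cdot> \<iota> i\<rbrakk> \<Longrightarrow> u = v"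
  shows "is_coproduct T I X P \<iota>"
  unfolding is_coproduct_def Hom_iff
proof (intro conjI allI impI ballI)
  fix Y f assume f: "\<forall>i\<in>I. Dom T (f i) = X i \<and> Cod T (f i) = Y"
  obtain u where "Dom T u = P" "Cod T u = Y" "\<forall>i\<in>I. u \<cdot> \<iota> i = f i"
    using assms(2)[of f Y] f by blast
  then show "\<exists>!u. (Dom T u = P \<and> Cod T u = Y) \<and> (\<forall>i\<in>I. u \<cdot> \<iota> i = f i)"
    using assms(3) by (intro ex1I[of _ u]) auto
qed (use assms in auto)

text \<open>Coproducts, compactness and closure of localizing classes are postulated for index sets
  inside \<open>'u\<close>. Transport along an injection makes them available for families indexed
  by natural numbers, integers or maps.\<close>

lemma is_coproduct_reindex:
  assumes "inj_on h J" "is_coproduct T (h ` J) (\<lambda>i. X (inv_into J h i)) P (\<lambda>i. \<iota> (inv_into J h i))"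
  shows "is_coproduct T J X P \<iota>"
proof (rule coproductI)
  show "Dom T (\<iota> j) = X j \<and> Cod T (\<iota> j) = P" if "j \<in> J" for j
    using coproduct_inj[OF assms(2), of "h j"] that assms(1) by simp
next
  fix Y f assume f: "\<And>j. j \<in> J \<Longrightarrow> Dom T (f j) = X j \<and> Cod T (f j) = Y"
  obtain u where "Dom T u = P" "Cod T u = Y" "\<And>i. i \<in> h ` J \<Longrightarrow> u \<cdot> \<iota> (inv_into J h i) = f (inv_into J h i)"
    using coproduct_ex[OF assms(2), of "\<lambda>i. f (inv_into J h i)" Y] f assms(1) by (auto simp: inv_into_into)
  then show "\<exists>u. Dom T u = P \<and> Cod T u = Y \<and> (\<forall>j\<in>J. u \<cdot> \<iota> j = f j)"
    using assms(1) by (metis imageI inv_into_f_f)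
next
  fix u v assume "Dom T u = P" "Dom T v = P" "Cod T u = Cod T v" "\<And>j. j \<in> J \<Longrightarrow> u \<cdot> \<iota> j = v \<cdot> \<iota> j"
  then show "u = v"
    by (rule coproduct_unique[OF assms(2)]) (assumption | metis inv_into_into)+
qed

lemma is_coproduct_cong:
  assumes "\<And>i. i \<in> I \<Longrightarrow> X i = X' i" "\<And>i. i \<in> I \<Longrightarrow> \<iota> i = \<iota>' i"
  shows "is_coproduct T I X P \<iota> \<longleftrightarrow> is_coproduct T I X' P \<iota>'"
  unfolding is_coproduct_def by (simp add: assms cong: ball_cong)

lemma is_coproduct_reindex':
  assumes "inj_on h J" "is_coproduct T J X P \<iota>"
  shows "is_coproduct T (h ` J) (\<lambda>i. X (inv_into J h i)) P (\<lambda>i. \<iota> (inv_into J h i))"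
proof (rule is_coproduct_reindex[of "inv_into J h"])
  show "inj_on (inv_into J h) (h ` J)" by (rule inj_on_inv_into) simp
  have *: "inv_into J h ` h ` J = J" using assms(1) by auto
  have **: "inv_into J h (inv_into (h ` J) (inv_into J h) j) = j" if "j \<in> J" for j
    using f_inv_into_f[of j "inv_into J h" "h ` J"] that unfolding * by simp
  show "is_coproduct T (inv_into J h ` h ` J) (\<lambda>j. X (inv_into J h (inv_into (h ` J) (inv_into J h) j))) P
     (\<lambda>j. \<iota> (inv_into J h (inv_into (h ` J) (inv_into J h) j)))"
    unfolding * using assms(2) by (rule iffD1[OF is_coproduct_cong, rotated -1]) (simp_all add: **)
qed

end

section \<open>Suspension and exact triangles\<close>

text \<open>Suspension is bijective, so a statement at \<open>i + 1\<close> can be cancelled back to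
  \<open>i\<close>. With an equivalence as the step, one argument serves both directions of the
  integers.\<close>

lemma int_shift_induct:
  assumes "P (0::int)" "\<And>i. P (i + 1) \<longleftrightarrow> P i"
  shows "P i"
proof (induction i rule: int_induct[where k=0])
  case (step2 i)
  then show ?case using assms(2)[of "i - 1"] by simp
qed (use assms in auto)

lemma int_pow_0 [simp]: "int_pow F 0 x = x"
  by (simp add: int_pow_def)

lemma int_pow_Suc:
  assumes "bij F" shows "int_pow F (i + 1) x = F (int_pow F i x)"
proof (cases "0 \<le> i")
  case True
  then show ?thesis by (simp add: int_pow_def nat_add_distrib)
next
  case False
  then obtain k where k: "nat (- i) = Suc k" by (metis gr0_implies_Suc neg_0_less_iff_less not_le zero_less_nat_eq)
  then have "i + 1 = - int k" by linarith
  then have "int_pow F (i + 1) x = (inv_into UNIV F ^^ k) x"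
    by (cases "k = 0") (simp_all add: int_pow_def nat_diff_distrib)
  moreover have "F (int_pow F i x) = (inv_into UNIV F ^^ k) x"
    using False k assms by (simp add: int_pow_def bij_is_surj surj_f_inv_f)
  ultimately show ?thesis by simp
qed

lemma int_pow_add:
  assumes "bij F" shows "int_pow F (i + j) x = int_pow F i (int_pow F j x)"
proof (induction i rule: int_shift_induct)
  case (2 i)
  have "int_pow F (i + 1 + j) x = F (int_pow F (i + j) x)"
    using int_pow_Suc[OF assms, of "i + j"] by (simp add: ac_simps)
  then show ?case using assms by (simp add: int_pow_Suc bij_is_inj inj_eq)
qed simp

context triangulated_category begin

lemma Dom_SuspA [simp]: "Dom T (SuspA T f) = Susp T (Dom T f)"
  and Cod_SuspA [simp]: "Cod T (SuspA T f) = Susp T (Cod T f)"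
  using SuspA_in_Hom[of f "Dom T f" "Cod T f"] by (auto simp: Hom_iff)

declare SuspA_Ident [simp]

lemma SuspA_Comp: "Cod T f = Dom T g \<Longrightarrow> SuspA T (g \<cdot> f) = SuspA T g \<cdot> SuspA T f"
  using SuspA_Compose[of f "Dom T f" "Cod T f" g "Cod T g"] by (auto simp: Hom_iff)

lemma SuspA_Plus': "Dom T f = Dom T g \<Longrightarrow> Cod T f = Cod T g \<Longrightarrow> SuspA T (f \<boxplus> g) = SuspA T f \<boxplus> SuspA T g"
  using SuspA_Plus[of f "Dom T f" "Cod T f" g] by (auto simp: Hom_iff)

lemma Susp_eq_iff [simp]: "Susp T X = Susp T Y \<longleftrightarrow> X = Y"
  using Susp_bij by (simp add: bij_is_inj inj_eq)

lemma SuspA_eq_iff [simp]: "SuspA T f = SuspA T g \<longleftrightarrow> f = g"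
  using SuspA_bij by (simp add: bij_is_inj inj_eq)

lemma SuspA_surj: obtains g where "f = SuspA T g"
  using SuspA_bij by (metis bij_pointE)

lemma SuspA_Zero [simp]: "SuspA T (Zero T X Y) = Zero T (Susp T X) (Susp T Y)"
  using Plus_cancel_self[of "SuspA T (Zero T X Y)"] SuspA_Plus'[of "Zero T X Y" "Zero T X Y"] by simp

lemma SuspA_Neg: "SuspA T (Neg T f) = Neg T (SuspA T f)"
  by (rule Neg_unique) (simp_all flip: SuspA_Plus')

lemma SuspA_eq_Zero_iff [simp]: "SuspA T f = Zero T (Susp T X) (Susp T Y) \<longleftrightarrow> f = Zero T X Y"
  by (metis SuspA_Zero SuspA_eq_iff)

lemma iso_SuspA: 
  assumes "is_iso T f" shows "is_iso T (SuspA T f)"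
  using assms
  by (intro isoI[of "SuspA T (inverse_arrow T f)"]) (simp_all flip: SuspA_Comp)

lemma zero_object_Susp [simp]: "zero_object T (Susp T X) \<longleftrightarrow> zero_object T X"
  unfolding zero_object_iff by (metis SuspA_Ident SuspA_eq_Zero_iff)

lemma eq_upto_sign_SuspA: "eq_upto_sign f g \<Longrightarrow> eq_upto_sign (SuspA T f) (SuspA T g)"
  by (auto simp: eq_upto_sign_def SuspA_Neg)

lemma Susp_pow_Suc: "Susp_pow T (i + 1) X = Susp T (Susp_pow T i X)"
  and SuspA_pow_Suc: "SuspA_pow T (i + 1) f = SuspA T (SuspA_pow T i f)"
  by (rule int_pow_Suc[OF Susp_bij], rule int_pow_Suc[OF SuspA_bij])

lemma Susp_pow_add: "Susp_pow T (i + j) X = Susp_pow T i (Susp_pow T j X)"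
  and SuspA_pow_add: "SuspA_pow T (i + j) f = SuspA_pow T i (SuspA_pow T j f)"
  by (rule int_pow_add[OF Susp_bij], rule int_pow_add[OF SuspA_bij])

lemma Susp_pow_1 [simp]: "Susp_pow T 1 X = Susp T X"
  and SuspA_pow_1 [simp]: "SuspA_pow T 1 f = SuspA T f"
  using Susp_pow_Suc[of 0 X] SuspA_pow_Suc[of 0 f] by auto

lemma Susp_pow_Susp [simp]: "Susp_pow T i (Susp T X) = Susp T (Susp_pow T i X)"
  and SuspA_pow_SuspA [simp]: "SuspA_pow T i (SuspA T f) = SuspA T (SuspA_pow T i f)"
  using Susp_pow_add[of i 1 X] Susp_pow_Suc[of i X] SuspA_pow_add[of i 1 f] SuspA_pow_Suc[of i f] by auto

lemma Susp_pow_pow [simp]: "Susp_pow T i (Susp_pow T j X) = Susp_pow T (i + j) X"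
  and SuspA_pow_pow [simp]: "SuspA_pow T i (SuspA_pow T j f) = SuspA_pow T (i + j) f"
  by (simp_all add: Susp_pow_add SuspA_pow_add)

lemma Dom_SuspA_pow [simp]: "Dom T (SuspA_pow T i f) = Susp_pow T i (Dom T f)"
  by (induction i rule: int_shift_induct) (simp_all add: Susp_pow_Suc SuspA_pow_Suc)

lemma Cod_SuspA_pow [simp]: "Cod T (SuspA_pow T i f) = Susp_pow T i (Cod T f)"
  by (induction i rule: int_shift_induct) (simp_all add: Susp_pow_Suc SuspA_pow_Suc)

lemma SuspA_pow_Ident [simp]: "SuspA_pow T i (Ident T X) = Ident T (Susp_pow T i X)"
  by (induction i rule: int_shift_induct) 
    (simp_all add: Susp_pow_Suc SuspA_pow_Suc flip: SuspA_Ident)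

lemma SuspA_pow_Comp: "Cod T f = Dom T g \<Longrightarrow> SuspA_pow T i (g \<cdot> f) = SuspA_pow T i g \<cdot> SuspA_pow T i f"
  by (induction i rule: int_shift_induct) (simp_all add: SuspA_pow_Suc flip: SuspA_Comp)

lemma SuspA_pow_Plus:
  "Dom T f = Dom T g \<Longrightarrow> Cod T f = Cod T g \<Longrightarrow> SuspA_pow T i (f \<boxplus> g) = SuspA_pow T i f \<boxplus> SuspA_pow T i g"
  by (induction i rule: int_shift_induct) (simp_all add: SuspA_pow_Suc flip: SuspA_Plus')

lemma SuspA_pow_Zero [simp]: "SuspA_pow T i (Zero T X Y) = Zero T (Susp_pow T i X) (Susp_pow T i Y)"
  by (induction i rule: int_shift_induct) 
    (simp_all add: Susp_pow_Suc SuspA_pow_Suc flip: SuspA_Zero)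

lemma SuspA_pow_eq_iff [simp]: "SuspA_pow T i f = SuspA_pow T i g \<longleftrightarrow> f = g"
  by (induction i rule: int_shift_induct) (simp_all add: SuspA_pow_Suc)

lemma SuspA_pow_eq_Zero_iff [simp]:
  "SuspA_pow T i f = Zero T (Susp_pow T i X) (Susp_pow T i Y) \<longleftrightarrow> f = Zero T X Y"
  by (metis SuspA_pow_Zero SuspA_pow_eq_iff)

lemma SuspA_pow_Neg: "SuspA_pow T i (Neg T f) = Neg T (SuspA_pow T i f)"
  by (rule Neg_unique) (simp_all flip: SuspA_pow_Plus)

lemma eq_upto_sign_SuspA_pow: "eq_upto_sign f g \<Longrightarrow> eq_upto_sign (SuspA_pow T i f) (SuspA_pow T i g)"
  by (auto simp: eq_upto_sign_def SuspA_pow_Neg)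

lemma iso_SuspA_pow [simp]:
  assumes "is_iso T f" shows "is_iso T (SuspA_pow T i f)"
  using assms
  by (intro isoI[of "SuspA_pow T i (inverse_arrow T f)"]) (simp_all flip: SuspA_pow_Comp)

lemma inverse_arrow_SuspA:
  assumes "is_iso T f" shows "inverse_arrow T (SuspA T f) = SuspA T (inverse_arrow T f)"
  using assms by (intro inverse_arrowI) (simp_all flip: SuspA_Comp)

section \<open>Exact triangles with named vertices\<close>

definition tri :: "'o \<Rightarrow> 'o \<Rightarrow> 'o \<Rightarrow> 'm \<Rightarrow> 'm \<Rightarrow> 'm \<Rightarrow> bool" where
  "tri X Y Z f g h \<longleftrightarrow> Triangle T f g h \<and> Dom T f = X \<and> Cod T f = Y \<and> Dom T g = Y \<and> Cod T g = Z \<and>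
     Dom T h = Z \<and> Cod T h = Susp T X"

lemma triI: "Triangle T f g h \<Longrightarrow> tri (Dom T f) (Cod T f) (Cod T g) f g h"
  using Triangle_shape[of f g h] by (simp add: tri_def)

lemma triD:
  assumes "tri X Y Z f g h"
  shows "Triangle T f g h" "Dom T f = X" "Cod T f = Y" "Dom T g = Y" "Cod T g = Z" "Dom T h = Z"
    "Cod T h = Susp T X"
  using assms by (auto simp: tri_def)

lemma tri_ex: 
  obtains Z g h where "tri (Dom T f) (Cod T f) Z f g h"
  using TR1_cone[of f] triI by blast

lemma tri_rot: "tri X Y Z f g h \<Longrightarrow> tri Y Z (Susp T X) g h (Neg T (SuspA T f))"
  using TR2[of f g h] by (simp add: tri_def)

text \<open>\<open>TR2\<close> is an equivalence, but reading it backwards requires a desuspended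
  first map. Surjectivity of \<open>SuspA\<close> supplies \<open>k\<close> with suspension
  \<open>Neg T h\<close>; the sign of the rotation then cancels.\<close>

lemma tri_rot_back:
  assumes "tri X Y Z f g h"
  obtains W k where "Z = Susp T W" "SuspA T k = Neg T h" "tri W X Y k f g"
proof -
  obtain k where k: "Neg T h = SuspA T k" using SuspA_surj by blast
  have d: "Susp T (Dom T k) = Z" "Susp T (Cod T k) = Susp T X"
    using k triD[OF assms] by (metis Dom_Neg Dom_SuspA, metis Cod_Neg Cod_SuspA)
  have "Triangle T k f g"
    using TR2[of k f g] triD(1)[OF assms] by (simp flip: k)
  then have "tri (Dom T k) X Y k f g"
    using triD[OF assms] d by (auto simp: tri_def)
  then show thesis using that d k by metis
qed

lemma tri_Ident: "zero_object T Z \<Longrightarrow> tri X X Z (Ident T X) (Zero T X Z) (Zero T Z (Susp T X))"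
  using TR1_Ident by (simp add: tri_def)

lemma tri_TR3:
  assumes "tri X Y Z f g h" "tri X' Y' Z' f' g' h'"
    "Dom T a = X" "Cod T a = X'" "Dom T b = Y" "Cod T b = Y'" "b \<cdot> f = f' \<cdot> a"
  obtains c where "Dom T c = Z" "Cod T c = Z'" "c \<cdot> g = g' \<cdot> b" "SuspA T a \<cdot> h = h' \<cdot> c"
  using TR3[of f g h f' g' h' a b] assms by (auto simp: tri_def Hom_iff)

lemma tri_iso:
  assumes "tri X Y Z f g h" "Dom T f' = X'" "Cod T f' = Y'" "Dom T g' = Y'" "Cod T g' = Z'" "Dom T h' = Z'"
    "Cod T h' = Susp T X'" "is_iso T a" "is_iso T b" "is_iso T c"
    "Dom T a = X" "Cod T a = X'" "Dom T b = Y" "Cod T b = Y'" "Dom T c = Z" "Cod T c = Z'"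
    "b \<cdot> f = f' \<cdot> a" "c \<cdot> g = g' \<cdot> b" "SuspA T a \<cdot> h = h' \<cdot> c"
  shows "tri X' Y' Z' f' g' h'"
  using Triangle_iso[of f g h f' X' Y' g' Z' h' a b c] assms by (auto simp: tri_def Hom_iff)

text \<open>The isomorphisms are absorbed into the other two maps, so the cone object itself stays
  the same.\<close>

lemma tri_arrow_iso:
  assumes "tri X Y Z f g h" "arrow_iso f f'"
  obtains g' h' where "tri (Dom T f') (Cod T f') Z f' g' h'"
proof -
  note [simp] = triD(2-)[OF assms(1)]
  obtain a b where ab [simp]: "is_iso T a" "is_iso T b" "Dom T a = X" "Cod T a = Dom T f'"
     "Dom T b = Y" "Cod T b = Cod T f'" and eq: "b \<cdot> f = f' \<cdot> a"
    using assms unfolding arrow_iso_def by auto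
  have "tri (Dom T f') (Cod T f') Z f' (g \<cdot> inverse_arrow T b) (SuspA T a \<cdot> h)"
    by (rule tri_iso[OF assms(1), where a=a and b=b and c="Ident T Z"]) (simp_all add: eq assoc)
  then show thesis by (rule that)
qed

lemma tri_comp:
  assumes "tri X Y Z f g h"
  shows "g \<cdot> f = Zero T X Z"
proof -
  note [simp] = triD(2-)[OF assms(1)]
  obtain O' where O': "zero_object T O'" using ex_zero_object by blast
  \<comment> \<open>Comparing with the triangle of an identity, whose cone is zero, makes
    \<open>g \<cdot> f\<close> factor through a zero map.\<close>
  obtain c where "Dom T c = O'" "Cod T c = Z" "c \<cdot> Zero T X O' = g \<cdot> f"
    by (rule tri_TR3[OF tri_Ident[OF O'] assms, where a = "Ident T X" and b = f]) auto
  then show ?thesis by simp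
qed

lemma tri_comp':
  assumes "tri X Y Z f g h"
  shows "h \<cdot> g = Zero T Y (Susp T X)" "SuspA T f \<cdot> h = Zero T Z (Susp T Y)"
proof -
  show "h \<cdot> g = Zero T Y (Susp T X)" using tri_comp[OF tri_rot[OF assms]] .
  note [simp] = triD(2-)[OF assms(1)]
  have "Neg T (SuspA T f) \<cdot> h = Zero T Z (Susp T Y)"
    using tri_comp[OF tri_rot[OF tri_rot[OF assms]]] .
  then show "SuspA T f \<cdot> h = Zero T Z (Susp T Y)"
    by (simp add: Neg_Compose Neg_eq_Zero_iff)
qed

text \<open>Exactness of Hom(W, -) at the middle term: \<open>TR3\<close> compares with the triangle
  W \<rightarrow> 0 \<rightarrow> \<Sigma>W, and the fill-in is desuspended. Both rotated triangles
  carry a minus sign, and these cancel.\<close>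

lemma tri_factor:
  assumes "tri X Y Z f g h" "Cod T x = Y" "g \<cdot> x = Zero T (Dom T x) Z"
  obtains y where "Dom T y = Dom T x" "Cod T y = X" "f \<cdot> y = x"
proof -
  note [simp] = triD(2-)[OF assms(1)]
  obtain O' where O': "zero_object T O'" using ex_zero_object by blast
  define W where "W = Dom T x"
  have 1: "tri W O' (Susp T W) (Zero T W O') (Zero T O' (Susp T W)) (Neg T (Ident T (Susp T W)))"
    using tri_rot[OF tri_Ident[OF O', of W]] by simp
  obtain c where c [simp]: "Dom T c = Susp T W" "Cod T c = Susp T X"
    "SuspA T x \<cdot> Neg T (Ident T (Susp T W)) = Neg T (SuspA T f) \<cdot> c"
    by (rule tri_TR3[OF 1 tri_rot[OF assms(1)], of x "Zero T O' Z"]) (use assms W_def in auto)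
  obtain y where y: "c = SuspA T y" using SuspA_surj by blast
  have [simp]: "Dom T y = W" "Cod T y = X" using c y by auto
  have "Neg T (SuspA T x) = Neg T (SuspA T (f \<cdot> y))"
    using c(3) y W_def by (simp add: Compose_Neg Neg_Compose SuspA_Comp)
  then have "f \<cdot> y = x" by (metis Neg_Neg SuspA_eq_iff)
  then show thesis by (rule that[rotated -1]) (simp_all flip: W_def)
qed

text \<open>The contravariant counterpart compares with 0 \<rightarrow> W \<rightarrow> W. Taking
  \<Sigma>0 as the cone of the identity lets \<open>TR2\<close> rotate back to exactly this
  triangle.\<close>

lemma tri_cofactor:
  assumes "tri X Y Z f g h" "Dom T x = Y" "x \<cdot> f = Zero T X (Cod T x)"
  obtains y where "Dom T y = Z" "Cod T y = Cod T x" "y \<cdot> g = x"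
proof -
  note [simp] = triD(2-)[OF assms(1)]
  obtain O' where O': "zero_object T O'" using ex_zero_object by blast
  define W where "W = Cod T x"
  have "tri W W (Susp T O') (Ident T W) (Zero T W (Susp T O')) (Zero T (Susp T O') (Susp T W))"
    by (rule tri_Ident) (simp add: O')
  then have 1: "tri O' W W (Zero T O' W) (Ident T W) (Zero T W (Susp T O'))"
    using TR2[of "Zero T O' W" "Ident T W" "Zero T W (Susp T O')"] by (simp add: tri_def)
  obtain c where c: "Dom T c = Z" "Cod T c = W" "c \<cdot> g = Ident T W \<cdot> x"
    by (rule tri_TR3[OF assms(1) 1, of "Zero T X O'" x]) (use assms W_def in auto)
  then show thesis using that[of c] W_def by simp
qed

text \<open>Any such \<open>x\<close> lifts through the desuspension of the cone, which is zero; so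
  \<open>f\<close> is a monomorphism when its cone vanishes.\<close>

lemma tri_rot_back_factor:
  assumes "tri X Y Z f g h" "Cod T x = X" "f \<cdot> x = Zero T (Dom T x) Y" "zero_object T Z"
  shows "x = Zero T (Dom T x) X"
proof -
  obtain W k where k: "Z = Susp T W" "tri W X Y k f g" using tri_rot_back[OF assms(1)] by metis
  obtain y where y: "Dom T y = Dom T x" "Cod T y = W" "k \<cdot> y = x"
    by (rule tri_factor[OF k(2) assms(2,3)])
  have "y = Zero T (Dom T y) (Cod T y)" by (rule zero_object_Cod) (use assms(4) k(1) y(2) in simp)
  then have "y = Zero T (Dom T x) W" using y by simp
  then have "k \<cdot> Zero T (Dom T x) W = x" using y(3) by simp
  then show ?thesis using triD(2,3)[OF k(2)] by simp
qed

lemma tri_zero_iff_iso: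
  assumes "tri X Y Z f g h"
  shows "zero_object T Z \<longleftrightarrow> is_iso T f"
proof
  note [simp] = triD(2-)[OF assms(1)]
  assume Z: "zero_object T Z"
  have "g = Zero T Y Z" using zero_object_Cod[of g] Z by simp
  \<comment> \<open>With \<open>g\<close> zero the identity of Y lifts to a section
    \<open>s\<close>; then s f - 1 is killed by the monomorphism \<open>f\<close>.\<close>
  then obtain s where s [simp]: "Dom T s = Y" "Cod T s = X" "f \<cdot> s = Ident T Y"
    using tri_factor[OF assms, of "Ident T Y"] by auto
  have "f \<cdot> (s \<cdot> f \<boxplus> Neg T (Ident T X)) = Zero T X Y"
    by (simp add: distrib_right Compose_Neg flip: assoc)
  then have "s \<cdot> f \<boxplus> Neg T (Ident T X) = Zero T X X"
    using tri_rot_back_factor[OF assms, of "s \<cdot> f \<boxplus> Neg T (Ident T X)"] Z by simp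
  then have "s \<cdot> f = Ident T X" by (rule diff_eq_Zero) simp_all
  then show "is_iso T f" by (intro isoI[of s]) simp_all
next
  note [simp] = triD(2-)[OF assms(1)]
  assume f: "is_iso T f"
  have "g \<cdot> f = Zero T Y Z \<cdot> f" using tri_comp[OF assms] by simp
  then have g: "g = Zero T Y Z" by (rule iffD1[OF iso_cancel_right[OF f], rotated -1]) simp_all
  have "SuspA T f \<cdot> h = SuspA T f \<cdot> Zero T Z (Susp T X)" using tri_comp'[OF assms] by simp
  then have h: "h = Zero T Z (Susp T X)" by (rule iffD1[OF iso_cancel_left[OF iso_SuspA[OF f]], rotated -1]) simp_all
  \<comment> \<open>Since \<open>h\<close> vanishes, the identity of Z factors through
    \<open>g\<close>, which is zero as well.\<close>
  obtain y where "Dom T y = Z" "Cod T y = Y" "g \<cdot> y = Ident T Z"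
    using tri_factor[OF tri_rot[OF assms], of "Ident T Z"] h by auto
  then show "zero_object T Z" by (simp add: zero_object_iff g)
qed

lemma tri_zero_iff_iso2:
  assumes "tri X Y Z f g h"
  shows "zero_object T X \<longleftrightarrow> is_iso T g"
  using tri_zero_iff_iso[OF tri_rot[OF assms]] by simp

lemma tri_zero:
  assumes "tri X Y Z f g h"
  shows "zero_object T X \<Longrightarrow> zero_object T Y \<Longrightarrow> zero_object T Z"
    "zero_object T X \<Longrightarrow> zero_object T Z \<Longrightarrow> zero_object T Y"
    "zero_object T Y \<Longrightarrow> zero_object T Z \<Longrightarrow> zero_object T X"
proof -
  note [simp] = triD(2-)[OF assms(1)]
  show "zero_object T X \<Longrightarrow> zero_object T Y \<Longrightarrow> zero_object T Z"
    using tri_zero_iff_iso2[OF assms] isomorphicI[of g] zero_object_isomorphic by auto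
  show "zero_object T X \<Longrightarrow> zero_object T Z \<Longrightarrow> zero_object T Y"
    using tri_zero_iff_iso[OF assms] isomorphicI[of f] zero_object_isomorphic by auto
  show "zero_object T Y \<Longrightarrow> zero_object T Z \<Longrightarrow> zero_object T X"
    using tri_zero_iff_iso[OF assms] isomorphicI[of f] zero_object_isomorphic isomorphic_sym by auto
qed

section \<open>Closure properties of localizing subcategories\<close>

lemma localizing_zero: "localizing U T S \<Longrightarrow> zero_object T X \<Longrightarrow> X \<in> S"
  and localizing_Susp: "localizing U T S \<Longrightarrow> Susp T X \<in> S \<longleftrightarrow> X \<in> S"
  by (auto simp: localizing_def)

text \<open>The definition provides the third vertex; rotation and invariance under suspension in
  both directions give the other two cases.\<close>

lemma localizing_tri:
  assumes "localizing U T S" "tri X Y Z f g h"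
  shows "X \<in> S \<Longrightarrow> Y \<in> S \<Longrightarrow> Z \<in> S" "X \<in> S \<Longrightarrow> Z \<in> S \<Longrightarrow> Y \<in> S" "Y \<in> S \<Longrightarrow> Z \<in> S \<Longrightarrow> X \<in> S"
proof -
  have *: "Z \<in> S" if "X \<in> S" "Y \<in> S" "tri X Y Z f g h" for X Y Z f g h
    using assms(1) that unfolding localizing_def tri_def by blast
  show "X \<in> S \<Longrightarrow> Y \<in> S \<Longrightarrow> Z \<in> S" using * assms(2) by blast
  show "Y \<in> S \<Longrightarrow> Z \<in> S \<Longrightarrow> X \<in> S"
    using *[OF _ _ tri_rot[OF assms(2)]] localizing_Susp[OF assms(1)] by blast
  show "X \<in> S \<Longrightarrow> Z \<in> S \<Longrightarrow> Y \<in> S"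
    using *[OF _ _ tri_rot[OF tri_rot[OF assms(2)]]] localizing_Susp[OF assms(1)] by blast
qed

text \<open>The cone of an isomorphism is a zero object, so closure under isomorphism follows from
  closure under triangles.\<close>

lemma localizing_iso:
  assumes "localizing U T S" "isomorphic T X Y" "X \<in> S"
  shows "Y \<in> S"
proof -
  obtain f where f: "Dom T f = X" "Cod T f = Y" "is_iso T f" using assms(2) by (auto simp: isomorphic_iff)
  obtain Z g h where t: "tri X Y Z f g h" using tri_ex[of f] f by metis
  then have "Z \<in> S" using tri_zero_iff_iso f localizing_zero[OF assms(1)] by blast
  then show ?thesis using localizing_tri(2)[OF assms(1) t] assms(3) by blast
qed

text \<open>The Milnor telescope: H is the cone of 1 - s, where \<open>s\<close> shifts the
  coproduct by one stage. All data are parameters rather than choices, so that the image of a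
  telescope under tensoring is again recognized as a telescope.\<close>

definition is_hocolim :: "(nat \<Rightarrow> 'o) \<Rightarrow> (nat \<Rightarrow> 'm) \<Rightarrow> 'o \<Rightarrow> (nat \<Rightarrow> 'm) \<Rightarrow> 'm \<Rightarrow> 'o \<Rightarrow> 'm \<Rightarrow> 'm \<Rightarrow> bool" where
  "is_hocolim Y t P \<iota> s H g h \<longleftrightarrow> is_coproduct T UNIV Y P \<iota> \<and> Dom T s = P \<and> Cod T s = P \<and>
     (\<forall>n. Dom T (t n) = Y n \<and> Cod T (t n) = Y (Suc n) \<and> s \<cdot> \<iota> n = \<iota> (Suc n) \<cdot> t n) \<and>
     tri P P H (Ident T P \<boxplus> Neg T s) g h"

lemma is_hocolimD:
  assumes "is_hocolim Y t P \<iota> s H g h"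
  shows "is_coproduct T UNIV Y P \<iota>" "Dom T s = P" "Cod T s = P" "Dom T (t n) = Y n" "Cod T (t n) = Y (Suc n)"
    "s \<cdot> \<iota> n = \<iota> (Suc n) \<cdot> t n" "tri P P H (Ident T P \<boxplus> Neg T s) g h"
    "Dom T (\<iota> n) = Y n" "Cod T (\<iota> n) = P" "Dom T g = P" "Cod T g = H"
proof -
  show "is_coproduct T UNIV Y P \<iota>" "Dom T s = P" "Cod T s = P" "Dom T (t n) = Y n" "Cod T (t n) = Y (Suc n)"
    "s \<cdot> \<iota> n = \<iota> (Suc n) \<cdot> t n" "tri P P H (Ident T P \<boxplus> Neg T s) g h" "Dom T g = P" "Cod T g = H"
    using assms by (auto simp: is_hocolim_def tri_def)
  then show "Dom T (\<iota> n) = Y n" "Cod T (\<iota> n) = P" by (blast intro: coproduct_inj)+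
qed

text \<open>The shift is zero for a sequence of zero maps, so 1 - s is the identity and its cone
  vanishes.\<close>

lemma hocolim_zero:
  assumes "is_hocolim Y t P \<iota> s H g h" "\<And>n. t n = Zero T (Y n) (Y (Suc n))"
  shows "zero_object T H"
proof -
  note [simp] = is_hocolimD(2-6,8-)[OF assms(1)]
  have "s = Zero T P P"
    by (rule coproduct_unique[OF is_hocolimD(1)[OF assms(1)]]) (simp_all add: assms(2))
  then show ?thesis
    using tri_zero_iff_iso[OF is_hocolimD(7)[OF assms(1)]] by simp
qed

lemma hocolim_compat:
  assumes "is_hocolim Y t P \<iota> s H g h"
  shows "g \<cdot> \<iota> (Suc n) \<cdot> t n = g \<cdot> \<iota> n"
proof -
  note [simp] = is_hocolimD(2-6,8-)[OF assms(1)]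
  have "g \<cdot> (Ident T P \<boxplus> Neg T s) \<cdot> \<iota> n = Zero T (Y n) H"
    using tri_comp[OF is_hocolimD(7)[OF assms(1)]] by (simp flip: assoc)
  then have "g \<cdot> \<iota> n \<boxplus> Neg T (g \<cdot> \<iota> (Suc n) \<cdot> t n) = Zero T (Y n) H"
    by (simp add: distrib_left distrib_right Neg_Compose Compose_Neg)
  then show ?thesis by (rule diff_eq_Zero[symmetric]) simp_all
qed

text \<open>For isomorphisms \<open>t\<close>, the map \<open>1 - s\<close> is split mono, with left inverse \<open>\<iota> n \<mapsto> - \<Sum>k<n. \<iota> k\<close>
  in terms of the identifications \<open>Y k \<cong> Y n\<close>.\<close>

lemma hocolim_isos:
  assumes "is_hocolim Y t P \<iota> s H g h" "\<And>n. is_iso T (t n)"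
  shows "is_iso T (g \<cdot> \<iota> 0)"
proof -
  note [simp] = is_hocolimD(2-6,8-)[OF assms(1)] assms(2)
  note cop = is_hocolimD(1)[OF assms(1)]
  note tr = is_hocolimD(7)[OF assms(1)]
  note [simp] = triD(2-)[OF tr]
  define r where "r = rec_nat (Zero T (Y 0) P) (\<lambda>n q. (q \<boxplus> Neg T (\<iota> n)) \<cdot> inverse_arrow T (t n))"
  have r0: "r 0 = Zero T (Y 0) P" and rS: "r (Suc n) = (r n \<boxplus> Neg T (\<iota> n)) \<cdot> inverse_arrow T (t n)" for n
    by (simp_all add: r_def)
  have r [simp]: "Dom T (r n) = Y n" "Cod T (r n) = P" for n
    by (induction n) (simp_all add: r0 rS)
  obtain \<rho> where \<rho> [simp]: "Dom T \<rho> = P" "Cod T \<rho> = P" "\<And>n. \<rho> \<cdot> \<iota> n = r n"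
    using coproduct_ex[OF cop, of r P] by auto
  have "\<rho> \<cdot> (Ident T P \<boxplus> Neg T s) = Ident T P"
  proof (rule coproduct_unique[OF cop])
    fix n
    have "\<rho> \<cdot> (s \<cdot> \<iota> n) = (\<rho> \<cdot> \<iota> (Suc n)) \<cdot> t n" by (subst assoc) simp_all
    also have "\<dots> = r n \<boxplus> Neg T (\<iota> n)" by (simp add: rS assoc)
    finally have eq: "\<rho> \<cdot> (s \<cdot> \<iota> n) = r n \<boxplus> Neg T (\<iota> n)" .
    have "(\<rho> \<cdot> (Ident T P \<boxplus> Neg T s)) \<cdot> \<iota> n = r n \<boxplus> Neg T (\<rho> \<cdot> (s \<cdot> \<iota> n))"
      by (simp add: assoc distrib_left distrib_right Neg_Compose Compose_Neg del: is_hocolimD(6)[OF assms(1)])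
    also have "\<dots> = \<iota> n"
    proof -
      have "Neg T (r n \<boxplus> Neg T (\<iota> n)) = Neg T (r n) \<boxplus> \<iota> n"
      proof (rule Neg_unique[symmetric])
        have "(r n \<boxplus> Neg T (\<iota> n)) \<boxplus> (Neg T (r n) \<boxplus> \<iota> n) = (r n \<boxplus> Neg T (\<iota> n)) \<boxplus> (\<iota> n \<boxplus> Neg T (r n))"
          by (subst (2) Plus_comm) simp_all
        also have "\<dots> = r n \<boxplus> ((Neg T (\<iota> n) \<boxplus> \<iota> n) \<boxplus> Neg T (r n))"
          by (simp add: Plus_assoc del: Plus_Neg_left Plus_Neg_right)
        finally show "(r n \<boxplus> Neg T (\<iota> n)) \<boxplus> (Neg T (r n) \<boxplus> \<iota> n) =
            Zero T (Dom T (r n \<boxplus> Neg T (\<iota> n))) (Cod T (r n \<boxplus> Neg T (\<iota> n)))" by simp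
      qed simp_all
      then show ?thesis unfolding eq by (simp flip: Plus_assoc)
    qed
    finally show "(\<rho> \<cdot> (Ident T P \<boxplus> Neg T s)) \<cdot> \<iota> n = Ident T P \<cdot> \<iota> n" by simp
  qed simp_all
  \<comment> \<open>A split monomorphism stays one after suspension, and \<Sigma>(1 - s) composed
    with \<open>h\<close> is zero; thus \<open>h\<close> vanishes and \<open>g\<close> has a
    section.\<close>
  then have "SuspA T \<rho> \<cdot> SuspA T (Ident T P \<boxplus> Neg T s) = Ident T (Susp T P)"
    by (simp flip: SuspA_Comp)
  then have "h = SuspA T \<rho> \<cdot> SuspA T (Ident T P \<boxplus> Neg T s) \<cdot> h"
    by (subst assoc[symmetric]) simp_all
  also have "\<dots> = Zero T H (Susp T P)" using tri_comp'(2)[OF tr] by simp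
  finally have h: "h = Zero T H (Susp T P)" .
  obtain y where y [simp]: "Dom T y = H" "Cod T y = P" "g \<cdot> y = Ident T H"
    using tri_factor[OF tri_rot[OF tr], of "Ident T H"] h by auto
  \<comment> \<open>\<open>\<theta> n\<close> inverts the composite from stage 0 to stage n. The
    induced map \<open>d\<close> out of the coproduct annihilates 1 - s, hence descends to the
    candidate inverse \<open>v\<close> of \<open>g \<cdot> \<iota> 0\<close>.\<close>
  define \<theta> where "\<theta> = rec_nat (Ident T (Y 0)) (\<lambda>n q. q \<cdot> inverse_arrow T (t n))"
  have \<theta>0: "\<theta> 0 = Ident T (Y 0)" and \<theta>S: "\<theta> (Suc n) = \<theta> n \<cdot> inverse_arrow T (t n)" for n
    by (simp_all add: \<theta>_def)
  have \<theta> [simp]: "Dom T (\<theta> n) = Y n" "Cod T (\<theta> n) = Y 0" for n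
    by (induction n) (simp_all add: \<theta>0 \<theta>S)
  obtain d where d [simp]: "Dom T d = P" "Cod T d = Y 0" "\<And>n. d \<cdot> \<iota> n = \<theta> n"
    using coproduct_ex[OF cop, of \<theta> "Y 0"] by auto
  have "d \<cdot> (Ident T P \<boxplus> Neg T s) = Zero T P (Y 0)"
  proof (rule coproduct_unique[OF cop])
    fix n
    have "d \<cdot> (s \<cdot> \<iota> n) = (d \<cdot> \<iota> (Suc n)) \<cdot> t n" by (subst assoc) simp_all
    also have "\<dots> = \<theta> n" by (simp add: \<theta>S assoc)
    finally have "d \<cdot> (s \<cdot> \<iota> n) = \<theta> n" .
    then show "(d \<cdot> (Ident T P \<boxplus> Neg T s)) \<cdot> \<iota> n = Zero T P (Y 0) \<cdot> \<iota> n"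
      by (simp add: assoc distrib_left distrib_right Neg_Compose Compose_Neg del: is_hocolimD(6)[OF assms(1)])
  qed simp_all
  then obtain v where v [simp]: "Dom T v = H" "Cod T v = Y 0" "v \<cdot> g = d"
    using tri_cofactor[OF tr, of d] by auto
  have 1: "v \<cdot> (g \<cdot> \<iota> 0) = Ident T (Y 0)"
    by (subst assoc[symmetric]) (simp_all add: \<theta>0)
  have gn: "(g \<cdot> \<iota> 0) \<cdot> \<theta> n = g \<cdot> \<iota> n" for n
  proof (induction n)
    case (Suc n)
    have "(g \<cdot> \<iota> 0) \<cdot> \<theta> (Suc n) = ((g \<cdot> \<iota> 0) \<cdot> \<theta> n) \<cdot> inverse_arrow T (t n)"
      by (simp add: \<theta>S assoc)
    also have "\<dots> = (g \<cdot> \<iota> (Suc n) \<cdot> t n) \<cdot> inverse_arrow T (t n)"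
      using Suc hocolim_compat[OF assms(1)] by simp
    also have "\<dots> = g \<cdot> \<iota> (Suc n)" by (simp add: assoc)
    finally show ?case .
  qed (simp add: \<theta>0)
  have "(g \<cdot> \<iota> 0) \<cdot> d = g"
  proof (rule coproduct_unique[OF cop])
    show "((g \<cdot> \<iota> 0) \<cdot> d) \<cdot> \<iota> n = g \<cdot> \<iota> n" for n
      using gn[of n] by (simp add: assoc)
  qed simp_all
  then have "((g \<cdot> \<iota> 0) \<cdot> (v \<cdot> g)) \<cdot> y = Ident T H" by simp
  moreover have "((g \<cdot> \<iota> 0) \<cdot> (v \<cdot> g)) \<cdot> y = ((g \<cdot> \<iota> 0) \<cdot> v) \<cdot> (g \<cdot> y)"
    by (simp add: assoc del: v(3) y(3))
  ultimately have "(g \<cdot> \<iota> 0) \<cdot> v = Ident T H" by simp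
  then show ?thesis using 1 by (intro isoI[of v]) simp_all
qed

lemma hocolim_localizing:
  assumes "is_hocolim Y t P \<iota> s H g h" "localizing U T S" "P \<in> S"
  shows "H \<in> S"
  using localizing_tri(1)[OF assms(2) is_hocolimD(7)[OF assms(1)]] assms(3) by blast

lemma is_hocolimI:
  assumes "is_coproduct T UNIV Y P \<iota>" "\<And>n. Dom T (t n) = Y n \<and> Cod T (t n) = Y (Suc n)"
  obtains s H g h where "is_hocolim Y t P \<iota> s H g h"
proof -
  note [simp] = assms(2) coproduct_inj[OF assms(1) UNIV_I]
  obtain s where s [simp]: "Dom T s = P" "Cod T s = P" "\<And>n. s \<cdot> \<iota> n = \<iota> (Suc n) \<cdot> t n"
    using coproduct_ex[OF assms(1), of "\<lambda>n. \<iota> (Suc n) \<cdot> t n" P] by auto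
  obtain H g h where "tri P P H (Ident T P \<boxplus> Neg T s) g h"
    using tri_ex[of "Ident T P \<boxplus> Neg T s"] by auto
  then have "is_hocolim Y t P \<iota> s H g h"
    unfolding is_hocolim_def by (intro conjI allI assms(1)) simp_all
  then show thesis by (rule that)
qed

primrec seq_comp :: "(nat \<Rightarrow> 'o) \<Rightarrow> (nat \<Rightarrow> 'm) \<Rightarrow> nat \<Rightarrow> 'm" where
  "seq_comp Y t 0 = Ident T (Y 0)"
| "seq_comp Y t (Suc n) = t n \<cdot> seq_comp Y t n"

lemma seq_comp_Dom_Cod:
  assumes "\<And>n. Dom T (t n) = Y n" "\<And>n. Cod T (t n) = Y (Suc n)"
  shows "Dom T (seq_comp Y t n) = Y 0 \<and> Cod T (seq_comp Y t n) = Y n"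
  by (induction n) (simp_all add: assms)

end

section \<open>Coproducts and compact generation\<close>

lemma small_encode:
  assumes "small (U :: 'u itself) J"
  obtains h :: "'j \<Rightarrow> 'u" where "inj_on h J" "small U (h ` J)"
proof -
  have "J \<lesssim> (UNIV :: 'u set)" using assms by (simp add: small_def lesspoll_def)
  then obtain h :: "'j \<Rightarrow> 'u" where h: "inj_on h J" by (auto simp: lepoll_def)
  then have "h ` J \<approx> J" by (simp add: inj_on_image_eqpoll_self eqpoll_sym)
  then show thesis using that[of h] h assms eq_lesspoll_trans by (metis small_def)
qed

lemma small_subset: "small U B \<Longrightarrow> A \<subseteq> B \<Longrightarrow> small U A"
  unfolding small_def by (meson lesspoll_trans1 subset_imp_lepoll)

text \<open>Hom groups are written multiplicatively, so the finite sums supplied by compactness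
  appear as \<open>finprod\<close>; this reduces a property of the sum to its terms.\<close>

lemma (in comm_monoid) finprod_closure_induct:
  assumes "finite F" "\<And>i. i \<in> F \<Longrightarrow> a i \<in> carrier G" "Q \<one>" "\<And>i. i \<in> F \<Longrightarrow> Q (a i)"
    "\<And>u v. u \<in> carrier G \<Longrightarrow> v \<in> carrier G \<Longrightarrow> Q u \<Longrightarrow> Q v \<Longrightarrow> Q (u \<otimes> v)"
  shows "Q (finprod G a F)"
  using assms(1,2,4)
proof (induction F rule: finite_induct)
  case (insert i F)
  have [simp]: "a \<in> F \<rightarrow> carrier G" using insert.prems by auto
  show ?case using insert assms(5) by (simp add: finprod_closed)
qed (simp add: assms(3))

context triangulated_category begin

text \<open>Suspension is an automorphism of the category, so cocones are shifted back by
  \<open>- i\<close> and their mediating maps forward again.\<close>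

lemma is_coproduct_Susp_pow:
  assumes "is_coproduct T I X P \<iota>"
  shows "is_coproduct T I (\<lambda>j. Susp_pow T i (X j)) (Susp_pow T i P) (\<lambda>j. SuspA_pow T i (\<iota> j))"
proof (rule coproductI)
  note inj = coproduct_inj[OF assms]
  show "Dom T (SuspA_pow T i (\<iota> j)) = Susp_pow T i (X j) \<and> Cod T (SuspA_pow T i (\<iota> j)) = Susp_pow T i P"
    if "j \<in> I" for j using inj[OF that] by simp
  show "\<exists>u. Dom T u = Susp_pow T i P \<and> Cod T u = Y \<and> (\<forall>j\<in>I. u \<cdot> SuspA_pow T i (\<iota> j) = f j)"
    if f: "\<And>j. j \<in> I \<Longrightarrow> Dom T (f j) = Susp_pow T i (X j) \<and> Cod T (f j) = Y" for Y f
  proof -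
    obtain u where u: "Dom T u = P" "Cod T u = Susp_pow T (- i) Y" "\<And>j. j \<in> I \<Longrightarrow> u \<cdot> \<iota> j = SuspA_pow T (- i) (f j)"
      using coproduct_ex[OF assms, of "\<lambda>j. SuspA_pow T (- i) (f j)" "Susp_pow T (- i) Y"] f by auto
    have "SuspA_pow T i u \<cdot> SuspA_pow T i (\<iota> j) = f j" if "j \<in> I" for j
      using SuspA_pow_Comp[of "\<iota> j" u i] u(1) u(3)[OF that] inj[OF that] by simp
    then show ?thesis using u(1,2) by (intro exI[of _ "SuspA_pow T i u"]) simp
  qed
  show "u = v" if uv: "Dom T u = Susp_pow T i P" "Dom T v = Susp_pow T i P" "Cod T u = Cod T v"
    "\<And>j. j \<in> I \<Longrightarrow> u \<cdot> SuspA_pow T i (\<iota> j) = v \<cdot> SuspA_pow T i (\<iota> j)" for u v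
  proof -
    have *: "SuspA_pow T (- i) w \<cdot> \<iota> j = SuspA_pow T (- i) (w \<cdot> SuspA_pow T i (\<iota> j))" 
      if "j \<in> I" "Dom T w = Susp_pow T i P" for j w
      using that inj by (simp add: SuspA_pow_Comp)
    have "SuspA_pow T (- i) u = SuspA_pow T (- i) v"
    proof (rule coproduct_unique[OF assms])
      show "SuspA_pow T (- i) u \<cdot> \<iota> j = SuspA_pow T (- i) v \<cdot> \<iota> j" if "j \<in> I" for j
        using *[OF that, of u] *[OF that, of v] uv(1,2) uv(4)[OF that] by simp
    qed (simp_all add: uv(1-3))
    then show ?thesis by simp
  qed
qed

end

context compactly_generated_category begin

lemma coproduct_exists:
  fixes J :: "'j set"
  assumes "small U J"
  obtains P \<iota> where "is_coproduct T J X P \<iota>"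
proof -
  obtain h :: "'j \<Rightarrow> 'u" where h: "inj_on h J" "small U (h ` J)" by (rule small_encode[OF assms])
  obtain P \<iota> where "is_coproduct T (h ` J) (\<lambda>i. X (inv_into J h i)) P \<iota>"
    using ex_coproduct[OF h(2)] by blast
  then have "is_coproduct T (h ` J) (\<lambda>i. X (inv_into J h i)) P (\<lambda>i. (\<iota> \<circ> h) (inv_into J h i))"
    by (rule iffD1[OF is_coproduct_cong, rotated -1]) (simp_all add: f_inv_into_f)
  then show thesis using is_coproduct_reindex[OF h(1)] that by blast
qed

lemma localizing_coproduct:
  fixes J :: "'j set"
  assumes "localizing U T S" "small U J" "is_coproduct T J X P \<iota>" "\<And>j. j \<in> J \<Longrightarrow> X j \<in> S"
  shows "P \<in> S"
proof -
  obtain h :: "'j \<Rightarrow> 'u" where h: "inj_on h J" "small U (h ` J)" by (rule small_encode[OF assms(2)])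
  have "\<forall>i\<in>h ` J. X (inv_into J h i) \<in> S" using assms(4) h(1) by simp
  then show ?thesis
    using assms(1) h(2) is_coproduct_reindex'[OF h(1) assms(3)] unfolding localizing_def by blast
qed

lemma localizingI:
  assumes "\<And>X. zero_object T X \<Longrightarrow> X \<in> S" "\<And>X. Susp T X \<in> S \<longleftrightarrow> X \<in> S"
    "\<And>X Y Z f g h. tri X Y Z f g h \<Longrightarrow> X \<in> S \<Longrightarrow> Y \<in> S \<Longrightarrow> Z \<in> S"
    "\<And>(J :: 'u set) X P \<iota>. small U J \<Longrightarrow> is_coproduct T J X P \<iota> \<Longrightarrow> (\<And>j. j \<in> J \<Longrightarrow> X j \<in> S) \<Longrightarrow> P \<in> S"
  shows "localizing U T S"
  unfolding localizing_def using assms triI by blast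

lemma small_nat: "small U (UNIV :: nat set)"
  using universe by (simp add: regular_universe_def)

lemma small_int: "small U (UNIV :: int set)"
proof -
  have "(UNIV :: int set) \<approx> (UNIV :: nat set)"
    using bij_int_decode eqpoll_def by (metis eqpoll_sym)
  then show ?thesis using small_nat eq_lesspoll_trans unfolding small_def by blast
qed

lemma hocolim_exists:
  assumes "\<And>n. Dom T (t n) = Y n \<and> Cod T (t n) = Y (Suc n)"
  obtains P \<iota> s H g h where "is_hocolim Y t P \<iota> s H g h"
proof -
  obtain P \<iota> where "is_coproduct T UNIV Y P \<iota>" using coproduct_exists[OF small_nat] .
  then show thesis using assms that by (rule is_hocolimI)
qed

text \<open>Closing the compact objects under suspension by definition saves the proof that they are closed.\<close>

definition shifted_compact :: "'o \<Rightarrow> bool" where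
  "shifted_compact D \<longleftrightarrow> (\<exists>C i. compact_object U T C \<and> D = Susp_pow T i C)"

lemma shifted_compact_Susp_pow: "shifted_compact D \<Longrightarrow> shifted_compact (Susp_pow T i D)"
  unfolding shifted_compact_def by (metis Susp_pow_pow)

lemma compact_shifted_compact: "compact_object U T C \<Longrightarrow> shifted_compact C"
  unfolding shifted_compact_def by (metis int_pow_0)

text \<open>Surjectivity in the definition of compactness, as an induction rule: a map from a
  compact object to a coproduct is a finite sum of maps through single summands. The map is shifted
  by \<open>- i\<close> to reach the compact object and shifted back term by term.\<close>

lemma shifted_compact_induct:
  fixes J :: "'j set"
  assumes "shifted_compact D" "small U J" "is_coproduct T J X P \<iota>" "Dom T y = D" "Cod T y = P"
    "Q (Zero T D P)" "\<And>j f. j \<in> J \<Longrightarrow> Dom T f = D \<Longrightarrow> Cod T f = X j \<Longrightarrow> Q (\<iota> j \<cdot> f)"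
    "\<And>u v. \<lbrakk>Dom T u = D; Cod T u = P; Dom T v = D; Cod T v = P; Q u; Q v\<rbrakk> \<Longrightarrow> Q (u \<boxplus> v)"
  shows "Q y"
proof -
  obtain C i where C: "compact_object U T C" and D: "D = Susp_pow T i C"
    using assms(1) unfolding shifted_compact_def by blast
  obtain h :: "'j \<Rightarrow> 'u" where h: "inj_on h J" "small U (h ` J)" by (rule small_encode[OF assms(2)])
  let ?X = "\<lambda>k. Susp_pow T (- i) (X (inv_into J h k))"
  let ?\<iota> = "\<lambda>k. SuspA_pow T (- i) (\<iota> (inv_into J h k))"
  let ?P = "Susp_pow T (- i) P"
  have cop: "is_coproduct T (h ` J) ?X ?P ?\<iota>"
    using is_coproduct_Susp_pow[OF is_coproduct_reindex'[OF h(1) assms(3)]] .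
  note inj = coproduct_inj[OF cop]
  interpret G: comm_group "Hom_group T C ?P" by (rule Hom_comm_group)
  have "bij_betw (\<lambda>f. finprod (Hom_group T C ?P) (\<lambda>k. ?\<iota> k \<cdot> f k) {k \<in> h ` J. f k \<noteq> Zero T C (?X k)})
          {f \<in> (\<Pi>\<^sub>E k\<in>h ` J. Hom T C (?X k)). finite {k \<in> h ` J. f k \<noteq> Zero T C (?X k)}} (Hom T C ?P)"
    using C h(2) cop unfolding compact_object_def by blast
  moreover have "SuspA_pow T (- i) y \<in> Hom T C ?P"
    using assms(4,5) D by (simp add: Hom_iff)
  ultimately obtain f where f: "f \<in> (\<Pi>\<^sub>E k\<in>h ` J. Hom T C (?X k))" "finite {k \<in> h ` J. f k \<noteq> Zero T C (?X k)}"
    and y: "SuspA_pow T (- i) y = finprod (Hom_group T C ?P) (\<lambda>k. ?\<iota> k \<cdot> f k) {k \<in> h ` J. f k \<noteq> Zero T C (?X k)}"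
    unfolding bij_betw_def by blast
  have fk: "Dom T (f k) = C" "Cod T (f k) = ?X k" if "k \<in> h ` J" for k
    using f(1) that by (auto simp: PiE_iff Hom_iff)
  have "Q (SuspA_pow T i (finprod (Hom_group T C ?P) (\<lambda>k. ?\<iota> k \<cdot> f k) {k \<in> h ` J. f k \<noteq> Zero T C (?X k)}))"
  proof (rule G.finprod_closure_induct[OF f(2)])
    fix k assume "k \<in> {k \<in> h ` J. f k \<noteq> Zero T C (?X k)}"
    then have k: "k \<in> h ` J" by simp
    show "?\<iota> k \<cdot> f k \<in> carrier (Hom_group T C ?P)"
      using inj[OF k] fk[OF k] by (simp add: Hom_group_def Hom_iff)
    have "\<iota> (inv_into J h k) \<cdot> SuspA_pow T i (f k) = SuspA_pow T i (?\<iota> k \<cdot> f k)"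
      using inj[OF k] fk[OF k] by (subst SuspA_pow_Comp) simp_all
    moreover have "Q (\<iota> (inv_into J h k) \<cdot> SuspA_pow T i (f k))"
      using assms(7) fk[OF k] k D by (simp add: inv_into_into)
    ultimately show "Q (SuspA_pow T i (?\<iota> k \<cdot> f k))" by simp
  next
    show "Q (SuspA_pow T i \<one>\<^bsub>Hom_group T C ?P\<^esub>)"
      using assms(6) D by (simp add: Hom_group_def)
    show "Q (SuspA_pow T i (u \<otimes>\<^bsub>Hom_group T C ?P\<^esub> v))"
      if "u \<in> carrier (Hom_group T C ?P)" "v \<in> carrier (Hom_group T C ?P)"
        "Q (SuspA_pow T i u)" "Q (SuspA_pow T i v)" for u v
      using that assms(8)[of "SuspA_pow T i u" "SuspA_pow T i v"] D
      by (simp add: Hom_group_def Hom_iff SuspA_pow_Plus)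
  qed
  then show ?thesis by (simp flip: y)
qed

text \<open>The objects W with no nonzero map to any suspension of X form a localizing class. It
  contains the generators, hence X itself, so the identity of X is zero. Quantifying over all
  suspensions is what makes the class closed under cones.\<close>

lemma zero_objectI_compact:
  assumes "\<And>D f. shifted_compact D \<Longrightarrow> Dom T f = D \<Longrightarrow> Cod T f = X \<Longrightarrow> f = Zero T D X"
  shows "zero_object T X"
proof -
  let ?S = "{W. \<forall>i f. Dom T f = W \<longrightarrow> Cod T f = Susp_pow T i X \<longrightarrow> f = Zero T W (Susp_pow T i X)}"
  have "localizing U T ?S"
  proof (rule localizingI)
    fix W assume "zero_object T W"
    then have "f = Zero T W (Susp_pow T i X)" if "Dom T f = W" "Cod T f = Susp_pow T i X" for i f
      using zero_object_Dom[of f] unfolding that by simp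
    then show "W \<in> ?S" by blast
  next
    fix W
    show "Susp T W \<in> ?S \<longleftrightarrow> W \<in> ?S"
    proof (intro iffI CollectI allI impI)
      fix i f assume f: "Dom T f = W" "Cod T f = Susp_pow T i X" and "Susp T W \<in> ?S"
      then have "g = Zero T (Susp T W) (Susp_pow T (i + 1) X)"
        if "Dom T g = Susp T W" "Cod T g = Susp_pow T (i + 1) X" for g using that by blast
      from this[of "SuspA T f"] f show "f = Zero T W (Susp_pow T i X)" by (simp add: Susp_pow_Suc)
    next
      fix i f assume f: "Dom T f = Susp T W" "Cod T f = Susp_pow T i X" and W: "W \<in> ?S"
      obtain g where g: "f = SuspA T g" using SuspA_surj by blast
      have X: "Susp_pow T i X = Susp T (Susp_pow T (i - 1) X)"
        using Susp_pow_Suc[of "i - 1" X] by simp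
      have "g = Zero T W (Susp_pow T (i - 1) X)" using W f g X by auto
      then show "f = Zero T (Susp T W) (Susp_pow T i X)" using g X by simp
    qed
  next
    fix W Y Z f g h assume t: "tri W Y Z f g h" and W: "W \<in> ?S" and Y: "Y \<in> ?S"
    note [simp] = triD(2-)[OF t]
    show "Z \<in> ?S"
    proof (intro CollectI allI impI)
      fix i x assume x [simp]: "Dom T x = Z" "Cod T x = Susp_pow T i X"
      have "x \<cdot> g = Zero T Y (Susp_pow T i X)" using Y by simp
      then obtain y where y: "Dom T y = Susp T W" "Cod T y = Susp_pow T i X" "y \<cdot> h = x"
        using tri_cofactor[OF tri_rot[OF t], of x] by auto
      obtain z where z: "y = SuspA T z" using SuspA_surj by blast
      have X: "Susp_pow T i X = Susp T (Susp_pow T (i - 1) X)"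
        using Susp_pow_Suc[of "i - 1" X] by simp
      have "z = Zero T W (Susp_pow T (i - 1) X)" using W y(1,2) z X by auto
      then have "y = Zero T (Susp T W) (Susp_pow T i X)" using z X by simp
      then show "x = Zero T Z (Susp_pow T i X)" using y(3) by simp
    qed
  next
    fix J :: "'u set" and Y P \<iota> assume c: "is_coproduct T J Y P \<iota>" and Y: "\<And>j. j \<in> J \<Longrightarrow> Y j \<in> ?S"
    show "P \<in> ?S"
    proof (intro CollectI allI impI)
      fix i x assume x [simp]: "Dom T x = P" "Cod T x = Susp_pow T i X"
      show "x = Zero T P (Susp_pow T i X)"
      proof (rule coproduct_unique[OF c])
        fix j assume j: "j \<in> J"
        have "x \<cdot> \<iota> j = Zero T (Y j) (Susp_pow T i X)" using Y[OF j] coproduct_inj[OF c j] by simp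
        then show "x \<cdot> \<iota> j = Zero T P (Susp_pow T i X) \<cdot> \<iota> j" using coproduct_inj[OF c j] by simp
      qed simp_all
    qed
  qed
  moreover have "C \<in> ?S" if C: "compact_object U T C" for C
  proof (intro CollectI allI impI)
    fix i f assume f: "Dom T f = C" "Cod T f = Susp_pow T i X"
    have "SuspA_pow T (- i) f = Zero T (Susp_pow T (- i) C) X"
      using assms[of "Susp_pow T (- i) C" "SuspA_pow T (- i) f"] f
        shifted_compact_Susp_pow[OF compact_shifted_compact[OF C]] by simp
    then have "SuspA_pow T i (SuspA_pow T (- i) f) = Zero T C (Susp_pow T i X)" by simp
    then show "f = Zero T C (Susp_pow T i X)" by simp
  qed
  moreover obtain G where G: "\<forall>C\<in>G. compact_object U T C" "\<Inter> {S. localizing U T S \<and> G \<subseteq> S} = UNIV"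
    using compactly_generated by blast
  ultimately have "X \<in> ?S" by blast
  then have "f = Zero T X (Susp_pow T 0 X)" if "Dom T f = X" "Cod T f = Susp_pow T 0 X" for f
    using that by blast
  from this[of "Ident T X"] show ?thesis by (simp add: zero_object_iff)
qed

text \<open>Lift \<open>\<iota> 0 \<cdot> x\<close> through 1 - s. The n-th component of the lift is
  forced to be the image of \<open>x\<close> in \<open>Y n\<close>, and compactness makes almost all
  of these components vanish.\<close>

lemma hocolim_shifted_compact:
  assumes "is_hocolim Y t P \<iota> s H g h" "shifted_compact D" "Dom T x = D" "Cod T x = Y 0"
    "g \<cdot> \<iota> 0 \<cdot> x = Zero T D H"
  obtains n where "seq_comp Y t n \<cdot> x = Zero T D (Y n)"
proof -
  note [simp] = is_hocolimD(2-6,8-)[OF assms(1)] assms(3,4)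
  note cop = is_hocolimD(1)[OF assms(1)] and tr = is_hocolimD(7)[OF assms(1)]
  obtain y where y [simp]: "Dom T y = D" "Cod T y = P" and eq: "(Ident T P \<boxplus> Neg T s) \<cdot> y = \<iota> 0 \<cdot> x"
    using tri_factor[OF tr, of "\<iota> 0 \<cdot> x"] assms(5) by auto
  \<comment> \<open>Projections off the coproduct, which exist because there are zero maps between
    distinct summands.\<close>
  define Pr where "Pr n \<pi> \<longleftrightarrow> Dom T \<pi> = P \<and> Cod T \<pi> = Y n \<and>
    (\<forall>m. \<pi> \<cdot> \<iota> m = (if m = n then Ident T (Y n) else Zero T (Y m) (Y n)))" for n \<pi>
  have "\<exists>\<pi>. Pr n \<pi>" for n
    unfolding Pr_def
    by (rule coproduct_ex[OF cop, of "\<lambda>m. if m = n then Ident T (Y n) else Zero T (Y m) (Y n)" "Y n"])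
      (simp, blast)
  then obtain \<pi> where \<pi>: "\<And>n. Pr n (\<pi> n)" by metis
  have \<pi> [simp]: "Dom T (\<pi> n) = P" "Cod T (\<pi> n) = Y n" 
    "\<pi> n \<cdot> \<iota> m = (if m = n then Ident T (Y n) else Zero T (Y m) (Y n))" for n m
    using \<pi>[of n] by (auto simp: Pr_def)
  have \<pi>s: "\<pi> n \<cdot> (s \<cdot> \<iota> m) = (if Suc m = n then t m else Zero T (Y m) (Y n))" for n m
    by (simp flip: assoc)
  have \<pi>0: "\<pi> 0 \<cdot> s = Zero T P (Y 0)"
  proof (rule coproduct_unique[OF cop])
    show "(\<pi> 0 \<cdot> s) \<cdot> \<iota> m = Zero T P (Y 0) \<cdot> \<iota> m" for m
      using \<pi>s[of 0 m] by (simp add: assoc)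
  qed simp_all
  have \<pi>S: "\<pi> (Suc n) \<cdot> s = t n \<cdot> \<pi> n" for n
  proof (rule coproduct_unique[OF cop])
    show "(\<pi> (Suc n) \<cdot> s) \<cdot> \<iota> m = (t n \<cdot> \<pi> n) \<cdot> \<iota> m" for m
      using \<pi>s[of "Suc n" m] by (auto simp add: assoc)
  qed simp_all
  have sc [simp]: "Dom T (seq_comp Y t n) = Y 0" "Cod T (seq_comp Y t n) = Y n" for n
    using seq_comp_Dom_Cod[of t Y n] by auto
  have \<pi>eq: "\<pi> n \<cdot> y \<boxplus> Neg T ((\<pi> n \<cdot> s) \<cdot> y) = (\<pi> n \<cdot> \<iota> 0) \<cdot> x" for n
  proof -
    have "\<pi> n \<cdot> ((Ident T P \<boxplus> Neg T s) \<cdot> y) = \<pi> n \<cdot> (\<iota> 0 \<cdot> x)" by (simp add: eq)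
    then show ?thesis by (simp add: assoc distrib_left distrib_right Neg_Compose Compose_Neg del: \<pi>(3))
  qed
  have "\<pi> n \<cdot> y = seq_comp Y t n \<cdot> x" for n
  proof (induction n)
    case 0
    then show ?case using \<pi>eq[of 0] by (simp add: \<pi>0)
  next
    case (Suc n)
    have "\<pi> (Suc n) \<cdot> y \<boxplus> Neg T (t n \<cdot> (\<pi> n \<cdot> y)) = Zero T D (Y (Suc n))"
      using \<pi>eq[of "Suc n"] by (simp add: \<pi>S assoc)
    then have "\<pi> (Suc n) \<cdot> y = t n \<cdot> (\<pi> n \<cdot> y)" by (rule diff_eq_Zero) simp_all
    then show ?case using Suc by (simp add: assoc)
  qed
  \<comment> \<open>A tail condition rather than a single vanishing component, so that it survives
    addition; a map through summand \<open>j\<close> has no component from \<open>Suc j\<close>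
    on.\<close>
  moreover have "\<exists>N. \<forall>n\<ge>N. \<pi> n \<cdot> y = Zero T D (Y n)"
  proof (rule shifted_compact_induct[OF assms(2) small_nat cop y])
    show "\<exists>N. \<forall>n\<ge>N. \<pi> n \<cdot> Zero T D P = Zero T D (Y n)" by simp
    show "\<exists>N. \<forall>n\<ge>N. \<pi> n \<cdot> (\<iota> j \<cdot> f) = Zero T D (Y n)" if "Dom T f = D" "Cod T f = Y j" for j f
      using that by (intro exI[of _ "Suc j"]) (simp flip: assoc)
    fix u v assume uv: "Dom T u = D" "Cod T u = P" "Dom T v = D" "Cod T v = P"
      "\<exists>N. \<forall>n\<ge>N. \<pi> n \<cdot> u = Zero T D (Y n)" "\<exists>N. \<forall>n\<ge>N. \<pi> n \<cdot> v = Zero T D (Y n)"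
    then obtain M N where "\<forall>n\<ge>M. \<pi> n \<cdot> u = Zero T D (Y n)" "\<forall>n\<ge>N. \<pi> n \<cdot> v = Zero T D (Y n)" by blast
    then show "\<exists>N. \<forall>n\<ge>N. \<pi> n \<cdot> (u \<boxplus> v) = Zero T D (Y n)"
      using uv(1-4) by (intro exI[of _ "max M N"]) (simp add: distrib_right)
  qed
  ultimately show thesis using that by (metis order_refl)
qed

end

section \<open>The tensor product\<close>

text \<open>Rewrites a commuting square inside a right-nested composite, where its sides do not
  occur as subterms.\<close>

lemma (in category) comp_eq_assoc:
  "\<lbrakk>a \<cdot> b = c \<cdot> d; Cod T b = Dom T a; Cod T d = Dom T c; Cod T x = Dom T b; Cod T x = Dom T d\<rbrakk> \<Longrightarrow>
    a \<cdot> (b \<cdot> x) = c \<cdot> (d \<cdot> x)"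
  by (metis assoc)

context symmetric_monoidal_category begin

lemma Dom_TensorA [simp]: "Dom T (f \<star> g) = Dom T f \<boxtimes> Dom T g"
  and Cod_TensorA [simp]: "Cod T (f \<star> g) = Cod T f \<boxtimes> Cod T g"
  using TensorA_in_Hom[of f "Dom T f" "Cod T f" g "Dom T g" "Cod T g"] by (auto simp: Hom_iff)

lemma TensorA_Comp:
  "Cod T f = Dom T g \<Longrightarrow> Cod T f' = Dom T g' \<Longrightarrow> (g \<cdot> f) \<star> (g' \<cdot> f') = (g \<star> g') \<cdot> (f \<star> f')"
  using TensorA_Compose[of f "Dom T f" "Cod T f" g "Cod T g" f' "Dom T f'" "Cod T f'" g' "Cod T g'"]
  by (auto simp: Hom_iff)

lemma TensorA_Comp_left: "Cod T f = Dom T g \<Longrightarrow> (g \<cdot> f) \<star> Ident T W = (g \<star> Ident T W) \<cdot> (f \<star> Ident T W)"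
  using TensorA_Comp[of f g "Ident T W" "Ident T W"] by simp

lemma TensorA_Comp_right: "Cod T f = Dom T g \<Longrightarrow> Ident T W \<star> (g \<cdot> f) = (Ident T W \<star> g) \<cdot> (Ident T W \<star> f)"
  using TensorA_Comp[of "Ident T W" "Ident T W" f g] by simp

lemma Dom_Assoc [simp]: "Dom T (Assoc T X Y Z) = (X \<boxtimes> Y) \<boxtimes> Z"
  and Cod_Assoc [simp]: "Cod T (Assoc T X Y Z) = X \<boxtimes> (Y \<boxtimes> Z)"
  and Dom_LUnit [simp]: "Dom T (LUnit T X) = Unit T \<boxtimes> X"
  and Cod_LUnit [simp]: "Cod T (LUnit T X) = X"
  and Dom_RUnit [simp]: "Dom T (RUnit T X) = X \<boxtimes> Unit T"
  and Cod_RUnit [simp]: "Cod T (RUnit T X) = X"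
  and Dom_Braid [simp]: "Dom T (Braid T X Y) = X \<boxtimes> Y"
  and Cod_Braid [simp]: "Cod T (Braid T X Y) = Y \<boxtimes> X"
  using Assoc_in_Hom[of X Y Z] LUnit_in_Hom[of X] RUnit_in_Hom[of X] Braid_in_Hom[of X Y]
  by (auto simp: Hom_iff)

declare TensorA_Ident [simp] Assoc_iso [simp] LUnit_iso [simp] RUnit_iso [simp] Braid_symmetric [simp]

lemma Braid_iso [simp]: "is_iso T (Braid T X Y)"
  by (rule isoI[of "Braid T Y X"]) simp_all

lemma iso_TensorA [simp]:
  assumes "is_iso T f" "is_iso T g" shows "is_iso T (f \<star> g)"
  using assms
  by (intro isoI[of "inverse_arrow T f \<star> inverse_arrow T g"]) (simp_all flip: TensorA_Comp)

lemma Assoc_nat: "Assoc T (Cod T f) (Cod T g) (Cod T h) \<cdot> ((f \<star> g) \<star> h) =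
    (f \<star> (g \<star> h)) \<cdot> Assoc T (Dom T f) (Dom T g) (Dom T h)"
  by (rule Assoc_natural) (simp_all add: Hom_iff)

lemma Braid_nat: "Braid T (Cod T f) (Cod T g) \<cdot> (f \<star> g) = (g \<star> f) \<cdot> Braid T (Dom T f) (Dom T g)"
  by (rule Braid_natural) (simp_all add: Hom_iff)

lemma LUnit_nat: "LUnit T (Cod T f) \<cdot> (Ident T (Unit T) \<star> f) = f \<cdot> LUnit T (Dom T f)"
  by (rule LUnit_natural) (simp_all add: Hom_iff)

lemma RUnit_nat: "RUnit T (Cod T f) \<cdot> (f \<star> Ident T (Unit T)) = f \<cdot> RUnit T (Dom T f)"
  by (rule RUnit_natural) (simp_all add: Hom_iff)

lemma arrow_iso_Tensor_right: "arrow_iso f g \<Longrightarrow> arrow_iso (f \<star> Ident T W) (g \<star> Ident T W)"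
  unfolding arrow_iso_def
proof (elim exE conjE)
  fix a b assume "is_iso T a" "is_iso T b" "Dom T a = Dom T f" "Cod T a = Dom T g"
     "Dom T b = Cod T f" "Cod T b = Cod T g" "b \<cdot> f = g \<cdot> a"
  then show "\<exists>a b. is_iso T a \<and> is_iso T b \<and> Dom T a = Dom T (f \<star> Ident T W) \<and>
      Cod T a = Dom T (g \<star> Ident T W) \<and> Dom T b = Cod T (f \<star> Ident T W) \<and>
      Cod T b = Cod T (g \<star> Ident T W) \<and> b \<cdot> (f \<star> Ident T W) = (g \<star> Ident T W) \<cdot> a"
    by (intro exI[of _ "a \<star> Ident T W"] exI[of _ "b \<star> Ident T W"]) (simp flip: TensorA_Comp_left)
qed

lemma arrow_iso_Tensor_comm: "arrow_iso (f \<star> g) (g \<star> f)"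
  by (rule arrow_isoI[of "Braid T (Dom T f) (Dom T g)" "Braid T (Cod T f) (Cod T g)"]) (simp_all add: Braid_nat)

lemma arrow_iso_Tensor_assoc: "arrow_iso ((f \<star> g) \<star> h) (f \<star> (g \<star> h))"
  by (rule arrow_isoI[of "Assoc T (Dom T f) (Dom T g) (Dom T h)" "Assoc T (Cod T f) (Cod T g) (Cod T h)"])
    (simp_all add: Assoc_nat)

lemma arrow_iso_Unit_left: "arrow_iso (Ident T (Unit T) \<star> f) f"
  by (rule arrow_isoI[of "LUnit T (Dom T f)" "LUnit T (Cod T f)"]) (simp_all add: LUnit_nat)

lemma isomorphic_Tensor: 
  assumes "isomorphic T X X'" "isomorphic T Y Y'"
  shows "isomorphic T (X \<boxtimes> Y) (X' \<boxtimes> Y')"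
proof -
  obtain f g where "Dom T f = X" "Cod T f = X'" "is_iso T f" "Dom T g = Y" "Cod T g = Y'" "is_iso T g"
    using assms by (auto simp: isomorphic_iff)
  then show ?thesis using isomorphicI[OF iso_TensorA, of f g] by simp
qed

lemma isomorphic_Tensor_comm: "isomorphic T (X \<boxtimes> Y) (Y \<boxtimes> X)"
  using isomorphicI[OF Braid_iso[of X Y]] by simp

lemma isomorphic_Tensor_assoc: "isomorphic T ((X \<boxtimes> Y) \<boxtimes> Z) (X \<boxtimes> (Y \<boxtimes> Z))"
  using isomorphicI[OF Assoc_iso[of X Y Z]] by simp

lemma isomorphic_Unit_left: "isomorphic T (Unit T \<boxtimes> X) X"
  using isomorphicI[OF LUnit_iso[of X]] by simp

lemma isomorphic_Unit_right: "isomorphic T (X \<boxtimes> Unit T) X"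
  using isomorphicI[OF RUnit_iso[of X]] by simp

lemma isomorphic_Tensor_left_comm: "isomorphic T (X \<boxtimes> (Y \<boxtimes> Z)) (Y \<boxtimes> (X \<boxtimes> Z))"
  by (meson isomorphic_Tensor isomorphic_Tensor_assoc isomorphic_Tensor_comm isomorphic_refl
      isomorphic_sym isomorphic_trans)

end

context tensor_triangulated_category begin

lemma Plus_TensorA: "Dom T f = Dom T g \<Longrightarrow> Cod T f = Cod T g \<Longrightarrow> (f \<boxplus> g) \<star> h = f \<star> h \<boxplus> g \<star> h"
  by (rule TensorA_Plus_left) (simp_all add: Hom_iff)

lemma TensorA_Plus: "Dom T f = Dom T g \<Longrightarrow> Cod T f = Cod T g \<Longrightarrow> h \<star> (f \<boxplus> g) = h \<star> f \<boxplus> h \<star> g"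
  by (rule TensorA_Plus_right) (simp_all add: Hom_iff)

lemma Zero_TensorA [simp]: "Zero T X Y \<star> f = Zero T (X \<boxtimes> Dom T f) (Y \<boxtimes> Cod T f)"
  using Plus_cancel_self[of "Zero T X Y \<star> f"] Plus_TensorA[of "Zero T X Y" "Zero T X Y" f] by simp

lemma TensorA_Zero [simp]: "f \<star> Zero T X Y = Zero T (Dom T f \<boxtimes> X) (Cod T f \<boxtimes> Y)"
  using Plus_cancel_self[of "f \<star> Zero T X Y"] TensorA_Plus[of "Zero T X Y" "Zero T X Y" f] by simp

lemma Neg_TensorA: "Neg T f \<star> g = Neg T (f \<star> g)"
  by (rule Neg_unique) (simp_all flip: Plus_TensorA)

lemma zero_object_Tensor_left: "zero_object T X \<Longrightarrow> zero_object T (X \<boxtimes> Y)"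
  using TensorA_Ident[of X Y] by (simp add: zero_object_iff)

lemma zero_object_Tensor_comm: "zero_object T (X \<boxtimes> Y) \<longleftrightarrow> zero_object T (Y \<boxtimes> X)"
  using isomorphic_Tensor_comm zero_object_isomorphic by blast

lemma zero_object_Tensor_right: "zero_object T Y \<Longrightarrow> zero_object T (X \<boxtimes> Y)"
  using zero_object_Tensor_left zero_object_Tensor_comm by blast

lemma zero_object_Tensor_assoc: "zero_object T ((X \<boxtimes> Y) \<boxtimes> Z) \<longleftrightarrow> zero_object T (X \<boxtimes> (Y \<boxtimes> Z))"
  using isomorphic_Tensor_assoc isomorphic_sym zero_object_isomorphic by blast

lemma zero_object_Tensor_left_comm: "zero_object T (X \<boxtimes> (Y \<boxtimes> Z)) \<longleftrightarrow> zero_object T (Y \<boxtimes> (X \<boxtimes> Z))"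
  using isomorphic_Tensor_left_comm zero_object_isomorphic by blast

lemma Dom_SuspTensor [simp]: "Dom T (SuspTensor T X Y) = Susp T X \<boxtimes> Y"
  and Cod_SuspTensor [simp]: "Cod T (SuspTensor T X Y) = Susp T (X \<boxtimes> Y)"
  using SuspTensor_in_Hom[of X Y] by (auto simp: Hom_iff)

declare SuspTensor_iso [simp] iso_SuspA [simp]

lemma SuspTensor_nat: "SuspTensor T (Cod T f) (Cod T g) \<cdot> (SuspA T f \<star> g) =
    SuspA T (f \<star> g) \<cdot> SuspTensor T (Dom T f) (Dom T g)"
  by (rule SuspTensor_natural) (simp_all add: Hom_iff)

lemma isomorphic_Susp_Tensor: "isomorphic T (Susp T X \<boxtimes> Y) (Susp T (X \<boxtimes> Y))"
  using isomorphicI[OF SuspTensor_iso[of X Y]] by simp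

lemma Dom_SuspTensorR [simp]: "Dom T (SuspTensorR T X Y) = X \<boxtimes> Susp T Y"
  and Cod_SuspTensorR [simp]: "Cod T (SuspTensorR T X Y) = Susp T (X \<boxtimes> Y)"
  and SuspTensorR_iso [simp]: "is_iso T (SuspTensorR T X Y)"
  by (simp_all add: SuspTensorR_def)

lemma SuspTensorR_nat: "SuspTensorR T (Cod T f) (Cod T g) \<cdot> (f \<star> SuspA T g) =
    SuspA T (f \<star> g) \<cdot> SuspTensorR T (Dom T f) (Dom T g)"
proof -
  let ?X = "Dom T f" and ?Y = "Dom T g" and ?X' = "Cod T f" and ?Y' = "Cod T g"
  have 1: "Braid T ?X' (Susp T ?Y') \<cdot> (f \<star> SuspA T g) = (SuspA T g \<star> f) \<cdot> Braid T ?X (Susp T ?Y)"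
    using Braid_nat[of f "SuspA T g"] by simp
  have 2: "SuspTensor T ?Y' ?X' \<cdot> (SuspA T g \<star> f) \<cdot> Braid T ?X (Susp T ?Y) =
      SuspA T (g \<star> f) \<cdot> SuspTensor T ?Y ?X \<cdot> Braid T ?X (Susp T ?Y)"
    by (rule comp_eq_assoc[OF SuspTensor_nat]) simp_all
  have "SuspA T (Braid T ?Y' ?X') \<cdot> SuspA T (g \<star> f) = SuspA T (f \<star> g) \<cdot> SuspA T (Braid T ?Y ?X)"
    using Braid_nat[of g f] by (simp flip: SuspA_Comp)
  then have 3: "SuspA T (Braid T ?Y' ?X') \<cdot> SuspA T (g \<star> f) \<cdot> SuspTensor T ?Y ?X \<cdot> Braid T ?X (Susp T ?Y) =
      SuspA T (f \<star> g) \<cdot> SuspA T (Braid T ?Y ?X) \<cdot> SuspTensor T ?Y ?X \<cdot> Braid T ?X (Susp T ?Y)"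
    by (rule comp_eq_assoc) simp_all
  show ?thesis unfolding SuspTensorR_def by (simp add: assoc 1 2 3)
qed

lemma tri_Tensor_right:
  assumes "tri X Y Z f g h"
  obtains h' where "tri (X \<boxtimes> W) (Y \<boxtimes> W) (Z \<boxtimes> W) (f \<star> Ident T W) (g \<star> Ident T W) h'"
proof (rule that)
  show "tri (X \<boxtimes> W) (Y \<boxtimes> W) (Z \<boxtimes> W) (f \<star> Ident T W) (g \<star> Ident T W) (SuspTensor T X W \<cdot> (h \<star> Ident T W))"
    using Tensor_exact_left[of f g h W] triD[OF assms] by (simp add: tri_def)
qed

lemma tri_Tensor_left:
  assumes "tri X Y Z f g h"
  obtains h' where "tri (W \<boxtimes> X) (W \<boxtimes> Y) (W \<boxtimes> Z) (Ident T W \<star> f) (Ident T W \<star> g) h'"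
proof (rule that)
  show "tri (W \<boxtimes> X) (W \<boxtimes> Y) (W \<boxtimes> Z) (Ident T W \<star> f) (Ident T W \<star> g) (SuspTensorR T W X \<cdot> (Ident T W \<star> h))"
    using Tensor_exact_right[of f g h W] triD[OF assms] by (simp add: tri_def)
qed

lemma is_coproduct_Tensor_right:
  fixes J :: "'j set"
  assumes "small U J" "is_coproduct T J F P \<iota>"
  shows "is_coproduct T J (\<lambda>i. F i \<boxtimes> W) (P \<boxtimes> W) (\<lambda>i. \<iota> i \<star> Ident T W)"
proof -
  obtain h :: "'j \<Rightarrow> 'u" where h: "inj_on h J" "small U (h ` J)" by (rule small_encode[OF assms(1)])
  show ?thesis
    using Tensor_coproduct_left[OF h(2) is_coproduct_reindex'[OF h(1) assms(2)], of W]
    by (rule is_coproduct_reindex[OF h(1)])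
qed

lemma is_coproduct_Tensor_left:
  fixes J :: "'j set"
  assumes "small U J" "is_coproduct T J F P \<iota>"
  shows "is_coproduct T J (\<lambda>i. W \<boxtimes> F i) (W \<boxtimes> P) (\<lambda>i. Ident T W \<star> \<iota> i)"
proof -
  obtain h :: "'j \<Rightarrow> 'u" where h: "inj_on h J" "small U (h ` J)" by (rule small_encode[OF assms(1)])
  show ?thesis
    using Tensor_coproduct_right[OF h(2) is_coproduct_reindex'[OF h(1) assms(2)], of W]
    by (rule is_coproduct_reindex[OF h(1)])
qed

lemma Neg_Ident_Tensor: "Neg T f \<star> Ident T W = Neg T (f \<star> Ident T W)"
  "Ident T W \<star> Neg T f = Neg T (Ident T W \<star> f)"
  by (rule Neg_TensorA) (rule Neg_unique, simp_all flip: TensorA_Plus)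

text \<open>Tensoring is additive, exact and preserves countable coproducts, so it carries 1 - s and
  its cone to the corresponding data of the tensored sequence.\<close>

lemma is_hocolim_Tensor_right:
  assumes "is_hocolim Y t P \<iota> s H g h"
  obtains h' where "is_hocolim (\<lambda>n. Y n \<boxtimes> W) (\<lambda>n. t n \<star> Ident T W) (P \<boxtimes> W) (\<lambda>n. \<iota> n \<star> Ident T W)
    (s \<star> Ident T W) (H \<boxtimes> W) (g \<star> Ident T W) h'"
proof -
  note [simp] = is_hocolimD(2-6,8-)[OF assms(1)]
  obtain h' where "tri (P \<boxtimes> W) (P \<boxtimes> W) (H \<boxtimes> W) ((Ident T P \<boxplus> Neg T s) \<star> Ident T W) (g \<star> Ident T W) h'"
    using tri_Tensor_right[OF is_hocolimD(7)[OF assms(1)]] .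
  then have "tri (P \<boxtimes> W) (P \<boxtimes> W) (H \<boxtimes> W) (Ident T (P \<boxtimes> W) \<boxplus> Neg T (s \<star> Ident T W)) (g \<star> Ident T W) h'"
    by (simp add: Plus_TensorA Neg_Ident_Tensor)
  then show thesis
    using is_coproduct_Tensor_right[OF small_nat is_hocolimD(1)[OF assms(1)], of W]
    by (intro that[unfolded is_hocolim_def]) (simp flip: TensorA_Comp_left)
qed

lemma is_hocolim_Tensor_left:
  assumes "is_hocolim Y t P \<iota> s H g h"
  obtains h' where "is_hocolim (\<lambda>n. W \<boxtimes> Y n) (\<lambda>n. Ident T W \<star> t n) (W \<boxtimes> P) (\<lambda>n. Ident T W \<star> \<iota> n)
    (Ident T W \<star> s) (W \<boxtimes> H) (Ident T W \<star> g) h'"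
proof -
  note [simp] = is_hocolimD(2-6,8-)[OF assms(1)]
  obtain h' where "tri (W \<boxtimes> P) (W \<boxtimes> P) (W \<boxtimes> H) (Ident T W \<star> (Ident T P \<boxplus> Neg T s)) (Ident T W \<star> g) h'"
    using tri_Tensor_left[OF is_hocolimD(7)[OF assms(1)]] .
  then have "tri (W \<boxtimes> P) (W \<boxtimes> P) (W \<boxtimes> H) (Ident T (W \<boxtimes> P) \<boxplus> Neg T (Ident T W \<star> s)) (Ident T W \<star> g) h'"
    by (simp add: TensorA_Plus Neg_Ident_Tensor)
  then show thesis
    using is_coproduct_Tensor_left[OF small_nat is_hocolimD(1)[OF assms(1)], of W]
    by (intro that[unfolded is_hocolim_def]) (simp flip: TensorA_Comp_right)
qed

lemma localizing_Tensor:
  assumes "localizing U T S"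
  shows "localizing U T {W. W \<boxtimes> Z \<in> S}"
proof (rule localizingI)
  show "X \<in> {W. W \<boxtimes> Z \<in> S}" if "zero_object T X" for X
    using localizing_zero[OF assms zero_object_Tensor_left[OF that]] by simp
  show "Susp T X \<in> {W. W \<boxtimes> Z \<in> S} \<longleftrightarrow> X \<in> {W. W \<boxtimes> Z \<in> S}" for X
    using localizing_iso[OF assms isomorphic_Susp_Tensor[of X Z]]
      localizing_iso[OF assms isomorphic_sym[OF isomorphic_Susp_Tensor[of X Z]]]
      localizing_Susp[OF assms, of "X \<boxtimes> Z"] by auto
  show "C \<in> {W. W \<boxtimes> Z \<in> S}" if "tri A B C f g h" "A \<in> {W. W \<boxtimes> Z \<in> S}" "B \<in> {W. W \<boxtimes> Z \<in> S}" for A B C f g h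
    using tri_Tensor_right[OF that(1), of Z] localizing_tri(1)[OF assms] that(2,3) by (metis mem_Collect_eq)
  show "P \<in> {W. W \<boxtimes> Z \<in> S}" if "small U J" "is_coproduct T J X P \<iota>" "\<And>j. j \<in> J \<Longrightarrow> X j \<in> {W. W \<boxtimes> Z \<in> S}"
    for J :: "'u set" and X P \<iota>
    using localizing_coproduct[OF assms that(1) is_coproduct_Tensor_right[OF that(1,2)]] that(3) by simp
qed

lemma localizing_Inter: "(\<And>S. S \<in> \<S> \<Longrightarrow> localizing U T S) \<Longrightarrow> localizing U T (\<Inter>\<S>)"
proof -
  assume *: "\<And>S. S \<in> \<S> \<Longrightarrow> localizing U T S"
  show ?thesis
  proof (rule localizingI)
    show "P \<in> \<Inter>\<S>" if "small U J" "is_coproduct T J X P \<iota>" "\<And>j. j \<in> J \<Longrightarrow> X j \<in> \<Inter>\<S>"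
      for J :: "'u set" and X P \<iota>
      using localizing_coproduct[OF * that(1,2)] that(3) by blast
  qed (use localizing_zero[OF *] localizing_Susp[OF *] localizing_tri(1)[OF *] in blast)+
qed

lemma localizing_zero_objects: "localizing U T {X. zero_object T X}"
proof (rule localizingI)
  show "P \<in> {X. zero_object T X}" if "is_coproduct T J X P \<iota>" "\<And>j. j \<in> J \<Longrightarrow> X j \<in> {X. zero_object T X}"
    for J :: "'u set" and X P \<iota>
  proof -
    have "Ident T P = Zero T P P"
    proof (rule coproduct_unique[OF that(1)])
      fix j assume j: "j \<in> J"
      note [simp] = coproduct_inj[OF that(1) j]
      have "\<iota> j = Zero T (X j) P" using zero_object_Dom[of "\<iota> j"] that(2)[OF j] by simp
      then show "Ident T P \<cdot> \<iota> j = Zero T P P \<cdot> \<iota> j" by simp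
    qed simp_all
    then show ?thesis by (simp add: zero_object_iff)
  qed
qed (use tri_zero(1) in auto)

text \<open>\<open>Gamma_image\<close> will turn out to be an intersection of such classes, which is
  how the class fed to the stratification hypothesis is seen to be localizing.\<close>

lemma localizing_Tensor_zero: "localizing U T {W. zero_object T (W \<boxtimes> Z)}"
  using localizing_Tensor[OF localizing_zero_objects, of Z] by simp

section \<open>Tensoring and iterated suspensions\<close>

lemma Susp_pow_Suc' [simp]: "Susp_pow T (1 + i) X = Susp T (Susp_pow T i X)"
  and SuspA_pow_Suc' [simp]: "SuspA_pow T (1 + i) f = SuspA T (SuspA_pow T i f)"
  using Susp_pow_Suc[of i X] SuspA_pow_Suc[of i f] by (simp_all add: add.commute)

lemma Susp_funpow: "(Susp T ^^ n) X = Susp_pow T (int n) X"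
  by (simp add: int_pow_def)

lemma SuspTensorR_nat_Dom_Cod [simp]:
  "Dom T (SuspTensorR_nat T X Y n) = X \<boxtimes> Susp_pow T (int n) Y"
  "Cod T (SuspTensorR_nat T X Y n) = Susp_pow T (int n) (X \<boxtimes> Y)"
  "is_iso T (SuspTensorR_nat T X Y n)"
  by (induction n) (simp_all add: Susp_funpow)

lemma SuspTensorR_nat_natural:
  "SuspTensorR_nat T (Cod T f) (Cod T g) n \<cdot> (f \<star> SuspA_pow T (int n) g) =
   SuspA_pow T (int n) (f \<star> g) \<cdot> SuspTensorR_nat T (Dom T f) (Dom T g) n"
proof (induction n)
  case (Suc n)
  let ?X = "Dom T f" and ?Y = "Dom T g" and ?X' = "Cod T f" and ?Y' = "Cod T g" and ?n = "int n"
  have 1: "SuspTensorR T ?X' (Susp_pow T ?n ?Y') \<cdot> (f \<star> SuspA T (SuspA_pow T ?n g)) =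
      SuspA T (f \<star> SuspA_pow T ?n g) \<cdot> SuspTensorR T ?X (Susp_pow T ?n ?Y)"
    using SuspTensorR_nat[of f "SuspA_pow T ?n g"] by simp
  have "SuspA T (SuspTensorR_nat T ?X' ?Y' n) \<cdot> SuspA T (f \<star> SuspA_pow T ?n g) =
      SuspA T (SuspA_pow T ?n (f \<star> g)) \<cdot> SuspA T (SuspTensorR_nat T ?X ?Y n)"
    using Suc by (simp flip: SuspA_Comp)
  then have 2: "SuspA T (SuspTensorR_nat T ?X' ?Y' n) \<cdot> SuspA T (f \<star> SuspA_pow T ?n g) \<cdot> SuspTensorR T ?X (Susp_pow T ?n ?Y) =
      SuspA T (SuspA_pow T ?n (f \<star> g)) \<cdot> SuspA T (SuspTensorR_nat T ?X ?Y n) \<cdot> SuspTensorR T ?X (Susp_pow T ?n ?Y)"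
    by (rule comp_eq_assoc) simp_all
  show ?case by (simp add: Susp_funpow assoc 1 2)
qed simp

lemma SuspTensorR_int_nat: "SuspTensorR_int T X Y (int n) = SuspTensorR_nat T X Y n"
  by (simp add: SuspTensorR_int_def)

lemma SuspTensorR_int_neg: "SuspTensorR_int T X Y (- int n) =
   SuspA_pow T (- int n) (inverse_arrow T (SuspTensorR_nat T X (Susp_pow T (- int n) Y) n))"
\<comment> \<open>At zero the definition takes the nonnegative branch; the two agree because the
  identity is its own inverse. The overlap lets \<open>int_cases2\<close> be used without sign
  conditions.\<close>
proof (cases "n = 0")
  case True
  have "inverse_arrow T (Ident T Z) = Ident T Z" for Z by (rule inverse_arrowI) simp_all
  then show ?thesis using True by (simp add: SuspTensorR_int_def)
qed (simp add: SuspTensorR_int_def)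

lemma SuspTensorR_int_Dom_Cod [simp]:
  "Dom T (SuspTensorR_int T X Y i) = X \<boxtimes> Susp_pow T i Y"
  "Cod T (SuspTensorR_int T X Y i) = Susp_pow T i (X \<boxtimes> Y)"
  "is_iso T (SuspTensorR_int T X Y i)"
  by (cases i rule: int_cases2; simp add: SuspTensorR_int_nat SuspTensorR_int_neg)+

lemma SuspTensorR_int_natural:
  "SuspTensorR_int T (Cod T f) (Cod T g) i \<cdot> (f \<star> SuspA_pow T i g) =
   SuspA_pow T i (f \<star> g) \<cdot> SuspTensorR_int T (Dom T f) (Dom T g) i"
proof (cases i rule: int_cases2)
  case (nonneg n)
  then show ?thesis using SuspTensorR_nat_natural by (simp add: SuspTensorR_int_nat)
next
  case (nonpos n)
  \<comment> \<open>The nonnegative square is used at the shifted map \<open>?g\<close>; inverting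
    its two structure isomorphisms and applying the power \<open>i\<close> gives the negative
    case.\<close>
  let ?g = "SuspA_pow T i g"
  let ?S = "SuspTensorR_nat T (Dom T f) (Dom T ?g) n" and ?S' = "SuspTensorR_nat T (Cod T f) (Cod T ?g) n"
  have eq: "?S' \<cdot> (f \<star> SuspA_pow T (int n) ?g) = SuspA_pow T (int n) (f \<star> ?g) \<cdot> ?S"
    by (rule SuspTensorR_nat_natural)
  have [simp]: "SuspA_pow T (int n) ?g = g" using nonpos by simp
  have "(f \<star> g) \<cdot> inverse_arrow T ?S = inverse_arrow T ?S' \<cdot> SuspA_pow T (int n) (f \<star> ?g)"
  proof -
    have "?S' \<cdot> ((f \<star> g) \<cdot> inverse_arrow T ?S) = (?S' \<cdot> (f \<star> g)) \<cdot> inverse_arrow T ?S"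
      using nonpos by (simp add: assoc)
    also have "\<dots> = (SuspA_pow T (int n) (f \<star> ?g) \<cdot> ?S) \<cdot> inverse_arrow T ?S"
      using eq nonpos by simp
    also have "\<dots> = SuspA_pow T (int n) (f \<star> ?g)" by (simp add: assoc)
    also have "\<dots> = ?S' \<cdot> (inverse_arrow T ?S' \<cdot> SuspA_pow T (int n) (f \<star> ?g))" by simp
    finally show ?thesis using nonpos by (subst (asm) iso_cancel_left) simp_all
  qed
  then have "SuspA_pow T i ((f \<star> g) \<cdot> inverse_arrow T ?S) = SuspA_pow T i (inverse_arrow T ?S' \<cdot> SuspA_pow T (int n) (f \<star> ?g))"
    by simp
  then have "SuspA_pow T i (f \<star> g) \<cdot> SuspA_pow T i (inverse_arrow T ?S) = SuspA_pow T i (inverse_arrow T ?S') \<cdot> (f \<star> ?g)"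
    using nonpos by (simp add: SuspA_pow_Comp)
  then show ?thesis using nonpos by (simp add: SuspTensorR_int_neg)
qed

text \<open>Each further suspension is passed once by \<open>SuspTensor_anticommutes\<close> and
  contributes one sign, so the true sign is given by the parity of n.\<close>

lemma SuspTensorR_nat_anticommutes:
  "eq_upto_sign (SuspA_pow T (int n) (SuspTensor T X Y) \<cdot> SuspTensorR_nat T (Susp T X) Y n)
     (SuspA T (SuspTensorR_nat T X Y n) \<cdot> SuspTensor T X (Susp_pow T (int n) Y))"
proof (induction n)
  case (Suc n)
  let ?Y = "Susp_pow T (int n) Y" and ?S = "SuspTensorR_nat T X Y n"
  have 1: "eq_upto_sign (SuspA T (SuspA_pow T (int n) (SuspTensor T X Y) \<cdot> SuspTensorR_nat T (Susp T X) Y n) \<cdot> SuspTensorR T (Susp T X) ?Y)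
     (SuspA T (SuspA T ?S \<cdot> SuspTensor T X ?Y) \<cdot> SuspTensorR T (Susp T X) ?Y)"
    using Suc by (intro eq_upto_sign_Compose_right eq_upto_sign_SuspA) simp_all
  have 2: "eq_upto_sign (SuspA T (SuspA T ?S) \<cdot> (SuspA T (SuspTensor T X ?Y) \<cdot> SuspTensorR T (Susp T X) ?Y))
     (SuspA T (SuspA T ?S) \<cdot> (SuspA T (SuspTensorR T X ?Y) \<cdot> SuspTensor T X (Susp T ?Y)))"
    using SuspTensor_anticommutes[of X ?Y]
    by (intro eq_upto_sign_Compose_left) (auto simp: eq_upto_sign_def)
  have "SuspA T (SuspA T ?S \<cdot> SuspTensor T X ?Y) \<cdot> SuspTensorR T (Susp T X) ?Y =
      SuspA T (SuspA T ?S) \<cdot> (SuspA T (SuspTensor T X ?Y) \<cdot> SuspTensorR T (Susp T X) ?Y)"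
    by (simp add: SuspA_Comp assoc)
  from eq_upto_sign_trans[OF 1[unfolded this] 2] show ?case
    by (simp add: SuspA_Comp assoc Susp_funpow)
qed simp

lemma eq_upto_sign_cancel_iso:
  assumes "eq_upto_sign (g \<cdot> f) (g \<cdot> f')" "is_iso T g" "Cod T f = Dom T g" "Cod T f' = Dom T g"
  shows "eq_upto_sign f f'"
  using assms iso_cancel_left[of g f f'] iso_cancel_left[of g f "Neg T f'"]
  by (auto simp: eq_upto_sign_def Compose_Neg)

lemma SuspTensorR_int_anticommutes:
  "eq_upto_sign (SuspA_pow T i (SuspTensor T X Y) \<cdot> SuspTensorR_int T (Susp T X) Y i)
     (SuspA T (SuspTensorR_int T X Y i) \<cdot> SuspTensor T X (Susp_pow T i Y))"
proof (cases i rule: int_cases2)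
  case (nonneg n)
  then show ?thesis using SuspTensorR_nat_anticommutes by (simp add: SuspTensorR_int_nat)
next
  case (nonpos n)
  let ?Y = "Susp_pow T i Y"
  let ?S = "SuspTensorR_nat T (Susp T X) ?Y n" and ?S' = "SuspTensorR_nat T X ?Y n"
  let ?\<sigma> = "SuspTensor T X ?Y" and ?\<sigma>' = "SuspTensor T X Y"
  have [simp]: "int n + i = 0" using nonpos by simp
  \<comment> \<open>As for naturality, the positive case at the shifted object \<open>?Y\<close> is
    inverted on both sides.\<close>
  have 1: "eq_upto_sign ((SuspA T ?S' \<cdot> ?\<sigma>') \<cdot> inverse_arrow T ?S) ((SuspA_pow T (int n) ?\<sigma> \<cdot> ?S) \<cdot> inverse_arrow T ?S)"
    using eq_upto_sign_sym[OF SuspTensorR_nat_anticommutes[of n X ?Y]]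
    by (intro eq_upto_sign_Compose_right) simp_all
  have 2: "(SuspA T ?S' \<cdot> ?\<sigma>') \<cdot> inverse_arrow T ?S = SuspA T ?S' \<cdot> (?\<sigma>' \<cdot> inverse_arrow T ?S)"
    by (simp add: assoc)
  have 3: "(SuspA_pow T (int n) ?\<sigma> \<cdot> ?S) \<cdot> inverse_arrow T ?S =
      SuspA T ?S' \<cdot> (inverse_arrow T (SuspA T ?S') \<cdot> SuspA_pow T (int n) ?\<sigma>)"
    by (simp add: assoc)
  have "eq_upto_sign (?\<sigma>' \<cdot> inverse_arrow T ?S) (inverse_arrow T (SuspA T ?S') \<cdot> SuspA_pow T (int n) ?\<sigma>)"
    using 1 unfolding 2 3
    by (rule eq_upto_sign_cancel_iso) simp_all
  then have "eq_upto_sign (SuspA_pow T i (?\<sigma>' \<cdot> inverse_arrow T ?S))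
      (SuspA_pow T i (SuspA T (inverse_arrow T ?S') \<cdot> SuspA_pow T (int n) ?\<sigma>))"
    by (intro eq_upto_sign_SuspA_pow) (simp add: inverse_arrow_SuspA)
  then have "eq_upto_sign (SuspA_pow T i ?\<sigma>' \<cdot> SuspA_pow T i (inverse_arrow T ?S))
      (SuspA T (SuspA_pow T i (inverse_arrow T ?S')) \<cdot> ?\<sigma>)"
    using nonpos by (simp add: SuspA_pow_Comp)
  then show ?thesis using nonpos by (simp add: SuspTensorR_int_neg)
qed

end

section \<open>The action of graded endomorphisms of the unit\<close>

context tensor_triangulated_category begin

text \<open>One homogeneous component of \<open>tensor_action\<close>, with a single map \<psi> of
  degree d as argument, so that the arguments about annihilation avoid graded families.\<close>

definition act :: "'o \<Rightarrow> int \<Rightarrow> 'm \<Rightarrow> 'm" where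
  "act X d \<psi> = SuspA_pow T d (RUnit T X) \<cdot> SuspTensorR_int T X (Unit T) d \<cdot> (Ident T X \<star> \<psi>) \<cdot>
     inverse_arrow T (RUnit T X)"

lemma tensor_action_act: "tensor_action T X \<psi> d = act X d (\<psi> d)"
  by (simp add: tensor_action_def act_def)

definition unit_map :: "int \<Rightarrow> 'm \<Rightarrow> bool" where
  "unit_map d \<psi> \<longleftrightarrow> Dom T \<psi> = Unit T \<and> Cod T \<psi> = Susp_pow T d (Unit T)"

lemma act_Dom_Cod [simp]:
  assumes "unit_map d \<psi>"
  shows "Dom T (act X d \<psi>) = X" "Cod T (act X d \<psi>) = Susp_pow T d X"
  using assms by (simp_all add: act_def unit_map_def)

lemma act_eq:
  assumes "unit_map d \<psi>"
  obtains \<alpha> where "is_iso T \<alpha>" "Dom T \<alpha> = X \<boxtimes> Susp_pow T d (Unit T)" "Cod T \<alpha> = Susp_pow T d X"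
    "act X d \<psi> = \<alpha> \<cdot> (Ident T X \<star> \<psi>) \<cdot> inverse_arrow T (RUnit T X)"
  using assms
  by (intro that[of "SuspA_pow T d (RUnit T X) \<cdot> SuspTensorR_int T X (Unit T) d"])
    (simp_all add: act_def unit_map_def assoc)

text \<open>Up to unit and suspension isomorphisms the action is tensoring with \<psi>, so its
  vanishing, invertibility and cone can be computed on the tensored map.\<close>

lemma act_arrow_iso_left:
  assumes "unit_map d \<psi>"
  shows "arrow_iso (Ident T X \<star> \<psi>) (act X d \<psi>)"
proof -
  obtain \<alpha> where \<alpha> [simp]: "is_iso T \<alpha>" "Dom T \<alpha> = X \<boxtimes> Susp_pow T d (Unit T)" "Cod T \<alpha> = Susp_pow T d X"
    and a: "act X d \<psi> = \<alpha> \<cdot> (Ident T X \<star> \<psi>) \<cdot> inverse_arrow T (RUnit T X)" using act_eq[OF assms, of X] .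
  have [simp]: "Dom T \<psi> = Unit T" "Cod T \<psi> = Susp_pow T d (Unit T)" using assms by (auto simp: unit_map_def)
  show ?thesis
    by (rule arrow_isoI[of "RUnit T X" \<alpha>]) (simp_all add: a assoc)
qed

lemma act_arrow_iso_right:
  assumes "unit_map d \<psi>"
  shows "arrow_iso (\<psi> \<star> Ident T X) (act X d \<psi>)"
  using arrow_iso_trans[OF arrow_iso_Tensor_comm act_arrow_iso_left[OF assms]] .

lemma RUnit_inverse_nat:
  "(f \<star> Ident T (Unit T)) \<cdot> inverse_arrow T (RUnit T (Dom T f)) = inverse_arrow T (RUnit T (Cod T f)) \<cdot> f"
proof -
  have "RUnit T (Cod T f) \<cdot> ((f \<star> Ident T (Unit T)) \<cdot> inverse_arrow T (RUnit T (Dom T f))) =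
      (f \<cdot> RUnit T (Dom T f)) \<cdot> inverse_arrow T (RUnit T (Dom T f))"
    using RUnit_nat[of f] by (simp flip: assoc)
  also have "\<dots> = RUnit T (Cod T f) \<cdot> (inverse_arrow T (RUnit T (Cod T f)) \<cdot> f)"
    by (simp add: assoc)
  finally show ?thesis by (subst (asm) iso_cancel_left) simp_all
qed

text \<open>The interchange law moves \<open>f\<close> past \<psi>, and the structure maps are
  natural. In consequence, annihilation of a map by \<psi> passes to every further
  composite.\<close>

lemma act_natural:
  assumes "unit_map d \<psi>"
  shows "act (Cod T f) d \<psi> \<cdot> f = SuspA_pow T d f \<cdot> act (Dom T f) d \<psi>"
proof -
  let ?X = "Dom T f" and ?Y = "Cod T f" and ?L = "Susp_pow T d (Unit T)"
  let ?r = "inverse_arrow T (RUnit T ?X)"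
  have [simp]: "Dom T \<psi> = Unit T" "Cod T \<psi> = ?L" using assms by (auto simp: unit_map_def)
  have 1: "(Ident T ?Y \<star> \<psi>) \<cdot> (f \<star> Ident T (Unit T)) = (f \<star> Ident T ?L) \<cdot> (Ident T ?X \<star> \<psi>)"
    by (simp flip: TensorA_Comp)
  have 2: "SuspTensorR_int T ?Y (Unit T) d \<cdot> (f \<star> Ident T ?L) =
      SuspA_pow T d (f \<star> Ident T (Unit T)) \<cdot> SuspTensorR_int T ?X (Unit T) d"
    using SuspTensorR_int_natural[of f "Ident T (Unit T)" d] by simp
  have 3: "SuspA_pow T d (RUnit T ?Y) \<cdot> SuspA_pow T d (f \<star> Ident T (Unit T)) =
      SuspA_pow T d f \<cdot> SuspA_pow T d (RUnit T ?X)"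
    using RUnit_nat[of f] by (simp flip: SuspA_pow_Comp)
  have "act ?Y d \<psi> \<cdot> f = SuspA_pow T d (RUnit T ?Y) \<cdot> SuspTensorR_int T ?Y (Unit T) d \<cdot>
      (Ident T ?Y \<star> \<psi>) \<cdot> (f \<star> Ident T (Unit T)) \<cdot> ?r"
    by (simp add: act_def assoc RUnit_inverse_nat)
  also have "\<dots> = SuspA_pow T d (RUnit T ?Y) \<cdot> SuspTensorR_int T ?Y (Unit T) d \<cdot>
      (f \<star> Ident T ?L) \<cdot> (Ident T ?X \<star> \<psi>) \<cdot> ?r"
    using comp_eq_assoc[OF 1, of ?r] by simp
  also have "\<dots> = SuspA_pow T d (RUnit T ?Y) \<cdot> SuspA_pow T d (f \<star> Ident T (Unit T)) \<cdot>
      SuspTensorR_int T ?X (Unit T) d \<cdot> (Ident T ?X \<star> \<psi>) \<cdot> ?r"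
    using comp_eq_assoc[OF 2, of "(Ident T ?X \<star> \<psi>) \<cdot> ?r"] by simp
  also have "\<dots> = SuspA_pow T d f \<cdot> SuspA_pow T d (RUnit T ?X) \<cdot>
      SuspTensorR_int T ?X (Unit T) d \<cdot> (Ident T ?X \<star> \<psi>) \<cdot> ?r"
    using comp_eq_assoc[OF 3, of "SuspTensorR_int T ?X (Unit T) d \<cdot> (Ident T ?X \<star> \<psi>) \<cdot> ?r"] by simp
  also have "\<dots> = SuspA_pow T d f \<cdot> act ?X d \<psi>" by (simp add: act_def)
  finally show ?thesis .
qed

text \<open>\<open>SuspTensor_RUnit\<close> expresses the unit isomorphism of \<Sigma>X through that
  of X; what remains is exchanging one suspension with d others, which is where the sign
  arises.\<close>

lemma act_Susp:
  assumes "unit_map d \<psi>"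
  shows "eq_upto_sign (act (Susp T X) d \<psi>) (SuspA T (act X d \<psi>))"
proof -
  let ?L = "Susp_pow T d (Unit T)" and ?\<sigma> = "SuspTensor T X (Unit T)" and ?\<sigma>' = "SuspTensor T X (Susp_pow T d (Unit T))"
  let ?r = "inverse_arrow T (RUnit T (Susp T X))" and ?q = "inverse_arrow T (RUnit T X)"
  let ?S = "SuspTensorR_int T X (Unit T) d" and ?S' = "SuspTensorR_int T (Susp T X) (Unit T) d"
  let ?x = "(Ident T (Susp T X) \<star> \<psi>) \<cdot> ?r"
  have [simp]: "Dom T \<psi> = Unit T" "Cod T \<psi> = ?L" using assms by (auto simp: unit_map_def)
  have R: "RUnit T (Susp T X) = SuspA T (RUnit T X) \<cdot> ?\<sigma>" by (simp add: SuspTensor_RUnit)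
  have \<sigma>r: "?\<sigma> \<cdot> ?r = SuspA T ?q"
  proof -
    have "SuspA T (RUnit T X) \<cdot> (?\<sigma> \<cdot> ?r) = RUnit T (Susp T X) \<cdot> ?r"
      by (simp add: R flip: assoc)
    also have "\<dots> = SuspA T (RUnit T X) \<cdot> SuspA T ?q"
      by (simp flip: SuspA_Comp)
    finally show ?thesis by (subst (asm) iso_cancel_left) simp_all
  qed
  have 1: "?\<sigma>' \<cdot> ?x = SuspA T (Ident T X \<star> \<psi>) \<cdot> SuspA T ?q"
  proof -
    have "?\<sigma>' \<cdot> (Ident T (Susp T X) \<star> \<psi>) = SuspA T (Ident T X \<star> \<psi>) \<cdot> ?\<sigma>"
      using SuspTensor_nat[of "Ident T X" \<psi>] by simp
    from comp_eq_assoc[OF this, of ?r] show ?thesis by (simp add: \<sigma>r)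
  qed
  have "eq_upto_sign (SuspA_pow T d (SuspA T (RUnit T X)) \<cdot> ((SuspA_pow T d ?\<sigma> \<cdot> ?S') \<cdot> ?x))
      (SuspA_pow T d (SuspA T (RUnit T X)) \<cdot> ((SuspA T ?S \<cdot> ?\<sigma>') \<cdot> ?x))"
    by (intro eq_upto_sign_Compose_left eq_upto_sign_Compose_right SuspTensorR_int_anticommutes) simp_all
  moreover have "SuspA_pow T d (SuspA T (RUnit T X)) \<cdot> ((SuspA_pow T d ?\<sigma> \<cdot> ?S') \<cdot> ?x) = act (Susp T X) d \<psi>"
  proof -
    have "SuspA_pow T d (RUnit T (Susp T X)) = SuspA_pow T d (SuspA T (RUnit T X)) \<cdot> SuspA_pow T d ?\<sigma>"
      unfolding R by (subst SuspA_pow_Comp) simp_all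
    then show ?thesis by (simp add: act_def assoc del: SuspA_pow_SuspA)
  qed
  moreover have "SuspA_pow T d (SuspA T (RUnit T X)) \<cdot> ((SuspA T ?S \<cdot> ?\<sigma>') \<cdot> ?x) = SuspA T (act X d \<psi>)"
    by (simp add: act_def assoc 1 SuspA_Comp)
  ultimately show ?thesis by simp
qed

lemma act_Susp_pow:
  assumes "unit_map d \<psi>"
  shows "eq_upto_sign (act (Susp_pow T i X) d \<psi>) (SuspA_pow T i (act X d \<psi>))"
proof (induction i rule: int_shift_induct)
  case (2 i)
  have "eq_upto_sign (act (Susp_pow T (i + 1) X) d \<psi>) (SuspA_pow T (i + 1) (act X d \<psi>)) \<longleftrightarrow>
    eq_upto_sign (SuspA T (act (Susp_pow T i X) d \<psi>)) (SuspA T (SuspA_pow T i (act X d \<psi>)))"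
    using act_Susp[OF assms, of "Susp_pow T i X"] 
    by (auto simp: Susp_pow_Suc SuspA_pow_Suc elim: eq_upto_sign_trans intro: eq_upto_sign_trans[OF eq_upto_sign_sym])
  also have "\<dots> \<longleftrightarrow> eq_upto_sign (act (Susp_pow T i X) d \<psi>) (SuspA_pow T i (act X d \<psi>))"
    by (simp add: eq_upto_sign_def flip: SuspA_Neg)
  finally show ?case .
qed simp

text \<open>The structure map for e + d is not identified with the one assembled from e and d; their
  quotient is kept as the automorphism \<theta>. This weak multiplicativity is enough for statements
  about vanishing.\<close>

lemma act_comp:
  assumes "unit_map d \<psi>" "unit_map e \<chi>"
  obtains \<theta> where "is_iso T \<theta>" "Dom T \<theta> = Susp_pow T (e + d) X" "Cod T \<theta> = Susp_pow T (e + d) X"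
    "act X (e + d) (SuspA_pow T e \<psi> \<cdot> \<chi>) = \<theta> \<cdot> (SuspA_pow T e (act X d \<psi>) \<cdot> act X e \<chi>)"
proof -
  let ?I = "Unit T"
  let ?r = "inverse_arrow T (RUnit T X)"
  let ?A = "SuspA_pow T e (SuspA_pow T d (RUnit T X)) \<cdot> SuspA_pow T e (SuspTensorR_int T X ?I d) \<cdot> SuspTensorR_int T X (Susp_pow T d ?I) e"
  let ?B = "SuspA_pow T (e + d) (RUnit T X) \<cdot> SuspTensorR_int T X ?I (e + d)"
  have [simp]: "Dom T \<psi> = ?I" "Cod T \<psi> = Susp_pow T d ?I" "Dom T \<chi> = ?I" "Cod T \<chi> = Susp_pow T e ?I"
    using assms by (auto simp: unit_map_def)
  have isoA [simp]: "is_iso T ?A" by simp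
  have 1: "SuspTensorR_int T X (Susp_pow T d ?I) e \<cdot> (Ident T X \<star> SuspA_pow T e \<psi>) =
      SuspA_pow T e (Ident T X \<star> \<psi>) \<cdot> SuspTensorR_int T X ?I e"
    using SuspTensorR_int_natural[of "Ident T X" \<psi> e] by simp
  have 0: "SuspA_pow T e ?r \<cdot> SuspA_pow T e (RUnit T X) \<cdot> x = x" if "Cod T x = Susp_pow T e (X \<boxtimes> ?I)" for x
  proof -
    have "SuspA_pow T e ?r \<cdot> SuspA_pow T e (RUnit T X) = Ident T (Susp_pow T e (X \<boxtimes> ?I))"
      by (simp flip: SuspA_pow_Comp)
    then show ?thesis using that by (simp flip: assoc)
  qed
  have "SuspA_pow T e (act X d \<psi>) \<cdot> act X e \<chi> =
      SuspA_pow T e (SuspA_pow T d (RUnit T X)) \<cdot> SuspA_pow T e (SuspTensorR_int T X ?I d) \<cdot>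
      SuspA_pow T e (Ident T X \<star> \<psi>) \<cdot> SuspTensorR_int T X ?I e \<cdot> (Ident T X \<star> \<chi>) \<cdot> ?r"
    by (simp add: act_def SuspA_pow_Comp assoc 0 del: SuspA_pow_pow)
  also have "\<dots> = ?A \<cdot> (Ident T X \<star> SuspA_pow T e \<psi>) \<cdot> (Ident T X \<star> \<chi>) \<cdot> ?r"
    using comp_eq_assoc[OF 1, of "(Ident T X \<star> \<chi>) \<cdot> ?r"] by (simp add: assoc)
  finally have 2: "SuspA_pow T e (act X d \<psi>) \<cdot> act X e \<chi> = ?A \<cdot> (Ident T X \<star> (SuspA_pow T e \<psi> \<cdot> \<chi>)) \<cdot> ?r"
    by (simp add: TensorA_Comp_right assoc)
  define A where "A = ?A"
  have A [simp]: "is_iso T A" "Dom T A = X \<boxtimes> Susp_pow T (e + d) ?I" "Cod T A = Susp_pow T (e + d) X"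
    unfolding A_def by simp_all
  have "act X (e + d) (SuspA_pow T e \<psi> \<cdot> \<chi>) = ?B \<cdot> (Ident T X \<star> (SuspA_pow T e \<psi> \<cdot> \<chi>)) \<cdot> ?r"
    by (simp add: act_def assoc)
  also have "\<dots> = (?B \<cdot> inverse_arrow T A) \<cdot> (SuspA_pow T e (act X d \<psi>) \<cdot> act X e \<chi>)"
    unfolding 2 A_def[symmetric] by (simp add: assoc)
  finally show thesis
    by (rule that[rotated -1]) (simp_all del: SuspA_pow_pow)
qed

lemma act_Plus:
  assumes "unit_map d \<psi>" "unit_map d \<chi>"
  shows "act X d (\<psi> \<boxplus> \<chi>) = act X d \<psi> \<boxplus> act X d \<chi>"
  using assms by (simp add: act_def unit_map_def TensorA_Plus distrib_left distrib_right)

lemma act_Zero [simp]: "act X d (Zero T (Unit T) (Susp_pow T d (Unit T))) = Zero T X (Susp_pow T d X)"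
  by (simp add: act_def)

lemma act_Neg:
  assumes "unit_map d \<psi>"
  shows "act X d (Neg T \<psi>) = Neg T (act X d \<psi>)"
proof (rule Neg_unique)
  have "unit_map d (Neg T \<psi>)" using assms by (simp add: unit_map_def)
  note act_Plus[OF assms this, of X]
  then show "act X d \<psi> \<boxplus> act X d (Neg T \<psi>) = Zero T (Dom T (act X d \<psi>)) (Cod T (act X d \<psi>))"
    using assms by simp (simp add: unit_map_def)
qed (use assms in \<open>simp_all add: unit_map_def\<close>)

section \<open>Maps annihilated by a homogeneous endomorphism of the unit\<close>

definition kill :: "int \<Rightarrow> 'm \<Rightarrow> 'm \<Rightarrow> bool" where
  "kill d \<psi> f \<longleftrightarrow> act (Cod T f) d \<psi> \<cdot> f = Zero T (Dom T f) (Susp_pow T d (Cod T f))"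

lemma kill_Zero [simp]: "unit_map d \<psi> \<Longrightarrow> kill d \<psi> (Zero T X Y)"
  by (simp add: kill_def)

lemma kill_Compose_left: 
  assumes "unit_map d \<psi>" "kill d \<psi> f" "Cod T f = Dom T g"
  shows "kill d \<psi> (g \<cdot> f)"
  using act_natural[OF assms(1), of g] assms
  by (simp add: kill_def) (simp add: assoc flip: assoc[of f g])

lemma kill_Plus:
  assumes "unit_map d \<psi>" "kill d \<psi> f" "kill d \<psi> g" "Dom T f = Dom T g" "Cod T f = Cod T g"
  shows "kill d \<psi> (f \<boxplus> g)"
  using assms by (simp add: kill_def distrib_right)

lemma kill_Neg_iff:
  assumes "unit_map d \<psi>"
  shows "kill d (Neg T \<psi>) f \<longleftrightarrow> kill d \<psi> f"
  using assms by (simp add: kill_def act_Neg Neg_Compose Neg_eq_Zero_iff)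

lemma kill_sign:
  assumes "unit_map d \<psi>" "eq_upto_sign \<psi> \<chi>"
  shows "kill d \<psi> f \<longleftrightarrow> kill d \<chi> f"
  using assms kill_Neg_iff[of d \<chi> f] by (auto simp: eq_upto_sign_def unit_map_def)

lemma kill_add:
  assumes "unit_map d \<psi>" "unit_map d \<chi>" "kill d \<psi> f" "kill d \<chi> f"
  shows "kill d (\<psi> \<boxplus> \<chi>) f"
  using assms by (simp add: kill_def act_Plus distrib_left)

lemma kill_iso:
  assumes "unit_map d \<psi>" "kill d \<psi> f" "is_iso T (act (Cod T f) d \<psi>)"
  shows "f = Zero T (Dom T f) (Cod T f)"
proof -
  have "act (Cod T f) d \<psi> \<cdot> f = act (Cod T f) d \<psi> \<cdot> Zero T (Dom T f) (Cod T f)"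
    using assms by (simp add: kill_def)
  then show ?thesis by (rule iffD1[OF iso_cancel_left[OF assms(3)], rotated -1]) (simp_all add: assms(1))
qed

text \<open>The actions on an object and on its suspensions agree up to sign. This allows a product
  \<psi> f, which lands in a suspension, to be replaced by a map with the original target.\<close>

lemma kill_SuspA_pow_iff:
  assumes "unit_map d \<psi>"
  shows "kill d \<psi> (SuspA_pow T i f) \<longleftrightarrow> kill d \<psi> f"
proof -
  have "eq_upto_sign (act (Susp_pow T i (Cod T f)) d \<psi> \<cdot> SuspA_pow T i f) (SuspA_pow T i (act (Cod T f) d \<psi>) \<cdot> SuspA_pow T i f)"
    using assms by (intro eq_upto_sign_Compose_right act_Susp_pow) simp_all
  also have "SuspA_pow T i (act (Cod T f) d \<psi>) \<cdot> SuspA_pow T i f = SuspA_pow T i (act (Cod T f) d \<psi> \<cdot> f)"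
    using assms by (subst SuspA_pow_Comp) simp_all
  finally have *: "eq_upto_sign (act (Susp_pow T i (Cod T f)) d \<psi> \<cdot> SuspA_pow T i f) (SuspA_pow T i (act (Cod T f) d \<psi> \<cdot> f))" .
  have 1: "kill d \<psi> f \<longleftrightarrow> SuspA_pow T i (act (Cod T f) d \<psi> \<cdot> f) = Zero T (Susp_pow T i (Dom T f)) (Susp_pow T (d + i) (Cod T f))"
    unfolding kill_def by (subst SuspA_pow_eq_Zero_iff[symmetric, where i = i]) (simp add: add.commute)
  have 2: "kill d \<psi> (SuspA_pow T i f) \<longleftrightarrow>
      act (Susp_pow T i (Cod T f)) d \<psi> \<cdot> SuspA_pow T i f = Zero T (Susp_pow T i (Dom T f)) (Susp_pow T (d + i) (Cod T f))"
    by (simp add: kill_def)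
  show ?thesis
    unfolding 1 2 using eq_upto_sign_Zero[OF *] eq_upto_sign_Zero[OF eq_upto_sign_sym[OF *]] by blast
qed

lemma kill_SuspA_iff:
  assumes "unit_map d \<psi>"
  shows "kill d \<psi> (SuspA T f) \<longleftrightarrow> kill d \<psi> f"
  using kill_SuspA_pow_iff[OF assms, of 1] by simp

lemma unit_map_comp:
  "unit_map d \<psi> \<Longrightarrow> unit_map e \<chi> \<Longrightarrow> unit_map (e + d) (SuspA_pow T e \<psi> \<cdot> \<chi>)"
  by (simp add: unit_map_def)

text \<open>Both the automorphism from \<open>act_comp\<close> and the sign from
  \<open>act_Susp_pow\<close> are invisible to vanishing.\<close>

lemma kill_comp_iff:
  assumes "unit_map d \<psi>" "unit_map e \<chi>"
  shows "kill (e + d) (SuspA_pow T e \<psi> \<cdot> \<chi>) f \<longleftrightarrow> kill d \<psi> (act (Cod T f) e \<chi> \<cdot> f)"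
proof -
  let ?X = "Cod T f"
  obtain \<theta> where \<theta> [simp]: "is_iso T \<theta>" "Dom T \<theta> = Susp_pow T (e + d) ?X" "Cod T \<theta> = Susp_pow T (e + d) ?X"
    and a: "act ?X (e + d) (SuspA_pow T e \<psi> \<cdot> \<chi>) = \<theta> \<cdot> (SuspA_pow T e (act ?X d \<psi>) \<cdot> act ?X e \<chi>)"
    using act_comp[OF assms] .
  note [simp] = assms
  let ?y = "SuspA_pow T e (act ?X d \<psi>) \<cdot> act ?X e \<chi> \<cdot> f"
  have "kill (e + d) (SuspA_pow T e \<psi> \<cdot> \<chi>) f \<longleftrightarrow> \<theta> \<cdot> ?y = \<theta> \<cdot> Zero T (Dom T f) (Susp_pow T (e + d) ?X)"
    by (simp add: kill_def a assoc)
  also have "\<dots> \<longleftrightarrow> ?y = Zero T (Dom T f) (Susp_pow T (e + d) ?X)"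
    by (rule iso_cancel_left) simp_all
  finally have 1: "kill (e + d) (SuspA_pow T e \<psi> \<cdot> \<chi>) f \<longleftrightarrow> ?y = Zero T (Dom T f) (Susp_pow T (e + d) ?X)" .
  have *: "eq_upto_sign (act (Susp_pow T e ?X) d \<psi> \<cdot> (act ?X e \<chi> \<cdot> f)) ?y"
    by (intro eq_upto_sign_Compose_right act_Susp_pow) simp_all
  have 2: "kill d \<psi> (act ?X e \<chi> \<cdot> f) \<longleftrightarrow>
      act (Susp_pow T e ?X) d \<psi> \<cdot> (act ?X e \<chi> \<cdot> f) = Zero T (Dom T f) (Susp_pow T (e + d) ?X)"
    by (simp add: kill_def add.commute)
  show ?thesis
    unfolding 1 2 using eq_upto_sign_Zero[OF *] eq_upto_sign_Zero[OF eq_upto_sign_sym[OF *]] by blast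
qed

lemma kill_comp:
  assumes "unit_map d \<psi>" "unit_map e \<chi>" "kill e \<chi> f"
  shows "kill (e + d) (SuspA_pow T e \<psi> \<cdot> \<chi>) f"
  unfolding kill_comp_iff[OF assms(1,2)] using assms(3) by (simp add: kill_def[of e] assms(1))

lemma kill_Ident_iff: "unit_map d \<psi> \<Longrightarrow> kill d \<psi> (Ident T X) \<longleftrightarrow> act X d \<psi> = Zero T X (Susp_pow T d X)"
  by (simp add: kill_def)

end

section \<open>Torsion objects\<close>

text \<open>Pairs are used because the degree of \<psi> is not determined by the map: different
  powers of the suspension may agree on the unit. Composition stands for multiplication, and
  \<open>commute\<close> for graded commutativity.\<close>

locale multiplicative_set = tensor_triangulated_category U T
  for U :: "'u itself" and T :: "('o, 'm, 'c) tensor_category_scheme" (structure) +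
  fixes \<Psi> :: "(int \<times> 'm) set"
  assumes unit_map: "(d, \<psi>) \<in> \<Psi> \<Longrightarrow> unit_map d \<psi>"
    and nonempty: "\<Psi> \<noteq> {}"
    and comp_closed: "(d, \<psi>) \<in> \<Psi> \<Longrightarrow> (e, \<chi>) \<in> \<Psi> \<Longrightarrow> (e + d, SuspA_pow T e \<psi> \<cdot> \<chi>) \<in> \<Psi>"
    and commute: "(d, \<psi>) \<in> \<Psi> \<Longrightarrow> (e, \<chi>) \<in> \<Psi> \<Longrightarrow>
      eq_upto_sign (SuspA_pow T e \<psi> \<cdot> \<chi>) (SuspA_pow T d \<chi> \<cdot> \<psi>)"
begin

definition killed :: "'m \<Rightarrow> bool" where
  "killed f \<longleftrightarrow> (\<exists>(d, \<psi>)\<in>\<Psi>. kill d \<psi> f)"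

text \<open>For the multiplicative sets considered later this is \<open>supported_on\<close> with
  the localized modules eliminated. The condition is on single maps, since the annihilating element
  depends on the map.\<close>

definition tors :: "'o set" where
  "tors = {X. \<forall>D f. shifted_compact D \<longrightarrow> Dom T f = D \<longrightarrow> Cod T f = X \<longrightarrow> killed f}"

lemma torsD: "X \<in> tors \<Longrightarrow> shifted_compact (Dom T f) \<Longrightarrow> Cod T f = X \<Longrightarrow> killed f"
  by (simp add: tors_def)

lemma torsI: "(\<And>f. shifted_compact (Dom T f) \<Longrightarrow> Cod T f = X \<Longrightarrow> killed f) \<Longrightarrow> X \<in> tors"
  by (simp add: tors_def)

text \<open>In the composite \<chi> acts first, so when \<psi> is the annihilating factor the order
  has to be exchanged by \<open>commute\<close>.\<close>

lemma kill_comp':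
  assumes "(d, \<psi>) \<in> \<Psi>" "(e, \<chi>) \<in> \<Psi>" "kill d \<psi> f"
  shows "kill (e + d) (SuspA_pow T e \<psi> \<cdot> \<chi>) f"
proof -
  have "kill (d + e) (SuspA_pow T d \<chi> \<cdot> \<psi>) f"
    using assms unit_map by (intro kill_comp) auto
  then show ?thesis
    using kill_sign[OF unit_map_comp commute] assms unit_map by (simp add: add.commute)
qed

lemma killed_Zero: "killed (Zero T X Y)"
  using nonempty unit_map kill_Zero unfolding killed_def by fast

lemma killed_Compose_left: "killed f \<Longrightarrow> Cod T f = Dom T g \<Longrightarrow> killed (g \<cdot> f)"
  using kill_Compose_left unit_map unfolding killed_def by fast

text \<open>The product of the two annihilators annihilates both summands.\<close>

lemma killed_Plus:
  assumes "killed f" "killed g" "Dom T f = Dom T g" "Cod T f = Cod T g"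
  shows "killed (f \<boxplus> g)"
proof -
  obtain d \<psi> e \<chi> where 1: "(d, \<psi>) \<in> \<Psi>" "kill d \<psi> f" "(e, \<chi>) \<in> \<Psi>" "kill e \<chi> g"
    using assms(1,2) unfolding killed_def by blast
  have "kill (e + d) (SuspA_pow T e \<psi> \<cdot> \<chi>) (f \<boxplus> g)"
    using 1 assms(3,4) unit_map by (intro kill_Plus kill_comp' kill_comp[of d \<psi> e \<chi> g] unit_map_comp) auto
  then show ?thesis using comp_closed 1 unfolding killed_def by fast
qed

lemma killed_SuspA_pow_iff: "killed (SuspA_pow T i f) \<longleftrightarrow> killed f"
  using kill_SuspA_pow_iff unit_map unfolding killed_def by fast

lemma killed_act:
  assumes "(d, \<psi>) \<in> \<Psi>" "killed (act (Cod T f) d \<psi> \<cdot> f)"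
  shows "killed f"
proof -
  obtain e \<chi> where 1: "(e, \<chi>) \<in> \<Psi>" "kill e \<chi> (act (Cod T f) d \<psi> \<cdot> f)"
    using assms(2) unfolding killed_def by blast
  then have "kill (d + e) (SuspA_pow T d \<chi> \<cdot> \<psi>) f"
    using kill_comp_iff unit_map assms(1) by blast
  then show ?thesis using comp_closed 1 assms(1) unfolding killed_def by fast
qed

lemma tors_Susp: "Susp T X \<in> tors \<longleftrightarrow> X \<in> tors"
proof
  assume X: "Susp T X \<in> tors"
  show "X \<in> tors"
  proof (rule torsI)
    fix f assume f: "shifted_compact (Dom T f)" "Cod T f = X"
    have "killed (SuspA_pow T 1 f)"
      using f shifted_compact_Susp_pow[OF f(1), of 1] by (intro torsD[OF X]) simp_all
    then show "killed f" by (simp only: killed_SuspA_pow_iff)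
  qed
next
  assume X: "X \<in> tors"
  show "Susp T X \<in> tors"
  proof (rule torsI)
    fix f assume f: "shifted_compact (Dom T f)" "Cod T f = Susp T X"
    have "Susp_pow T (- 1) (Susp T X) = Susp_pow T (- 1 + 1) X"
      by (subst Susp_pow_add) simp
    then have "killed (SuspA_pow T (- 1) f)"
      using f shifted_compact_Susp_pow[OF f(1), of "- 1"] by (intro torsD[OF X]) simp_all
    then show "killed f" by (simp only: killed_SuspA_pow_iff)
  qed
qed

text \<open>If \<open>\<psi>\<close> kills the image of \<open>f\<close> in \<open>\<Sigma>A\<close>, then \<open>\<psi> f\<close> lifts to \<open>B\<close>.\<close>

lemma tors_tri:
  assumes t: "tri A B C u v w" and A: "A \<in> tors" and B: "B \<in> tors"
  shows "C \<in> tors"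
proof (rule torsI)
  note [simp] = triD(2-)[OF t]
  fix f assume f [simp]: "shifted_compact (Dom T f)" "Cod T f = C"
  have "killed (w \<cdot> f)" using A by (intro torsD[of "Susp T A"]) (simp_all add: tors_Susp)
  then obtain d \<psi> where \<psi>: "(d, \<psi>) \<in> \<Psi>" "kill d \<psi> (w \<cdot> f)" unfolding killed_def by blast
  note [simp] = unit_map[OF \<psi>(1)]
  let ?x = "act C d \<psi> \<cdot> f"
  \<comment> \<open>\<open>?x\<close> lands in a suspension of C; desuspending it gives a map into C
    itself, to which the triangle can be applied.\<close>
  define x where "x = SuspA_pow T (- d) ?x"
  have x [simp]: "Dom T x = Susp_pow T (- d) (Dom T f)" "Cod T x = C" and xx: "SuspA_pow T d x = ?x"
    by (simp_all add: x_def)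
  have "SuspA_pow T d (w \<cdot> x) = SuspA_pow T d w \<cdot> ?x" by (simp add: SuspA_pow_Comp xx)
  also have "\<dots> = (act (Susp T A) d \<psi> \<cdot> w) \<cdot> f"
    using act_natural[of d \<psi> w] by (simp add: assoc)
  also have "\<dots> = Zero T (Dom T f) (Susp_pow T d (Susp T A))"
    using \<psi>(2) by (simp add: kill_def assoc)
  finally have "SuspA_pow T d (w \<cdot> x) = Zero T (Susp_pow T d (Dom T x)) (Susp_pow T d (Susp T A))" by simp
  then have "w \<cdot> x = Zero T (Dom T x) (Susp T A)" by (simp only: SuspA_pow_eq_Zero_iff)
  then obtain y where y [simp]: "Dom T y = Dom T x" "Cod T y = B" "v \<cdot> y = x"
    by (rule tri_factor[OF tri_rot[OF t] x(2)])
  have "killed y" by (rule torsD[OF B]) (simp_all add: shifted_compact_Susp_pow)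
  then have "killed x" using killed_Compose_left[of y v] by simp
  then have "killed ?x" using killed_SuspA_pow_iff[of d x] xx by simp
  then show "killed f" using killed_act[OF \<psi>(1), of f] by simp
qed

lemma tors_coproduct:
  fixes J :: "'j set"
  assumes "small U J" "is_coproduct T J X P \<iota>" "\<And>j. j \<in> J \<Longrightarrow> X j \<in> tors"
  shows "P \<in> tors"
proof (rule torsI)
  fix f assume f: "shifted_compact (Dom T f)" "Cod T f = P"
  show "killed f"
  proof (rule shifted_compact_induct[OF f(1) assms(1,2) refl f(2), where Q = killed])
    show "killed (\<iota> j \<cdot> g)" if "j \<in> J" "Dom T g = Dom T f" "Cod T g = X j" for j g
      using that f(1) coproduct_inj[OF assms(2) that(1)] torsD[OF assms(3)[OF that(1)], of g]
      by (intro killed_Compose_left) simp_all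
  qed (auto intro: killed_Zero killed_Plus)
qed

lemma localizing_tors: "localizing U T tors"
proof (rule localizingI)
  show "X \<in> tors" if X: "zero_object T X" for X
  proof (rule torsI)
    fix f assume "Cod T f = X"
    then have "f = Zero T (Dom T f) X" using zero_object_Cod[of f] X by simp
    then show "killed f" using killed_Zero by metis
  qed
qed (use tors_Susp tors_tri tors_coproduct in blast)+

lemma tors_act_Zero:
  assumes "(d, \<psi>) \<in> \<Psi>" "act X d \<psi> = Zero T X (Susp_pow T d X)"
  shows "X \<in> tors"
proof (rule torsI)
  fix f assume "Cod T f = X"
  then have "kill d \<psi> f" using assms unit_map[OF assms(1)] by (simp add: kill_def)
  then show "killed f" using assms(1) unfolding killed_def by blast
qed

end

section \<open>Smashing localization\<close>

context tensor_triangulated_category begin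

lemma Zero_eqI: "f = Zero T (Dom T f) (Cod T f) \<Longrightarrow> Dom T f = X \<Longrightarrow> Cod T f = Y \<Longrightarrow> f = Zero T X Y"
  by simp

lemma iso_Zero:
  assumes "is_iso T (Zero T X Y)"
  shows "zero_object T Y"
proof -
  have "Ident T Y = Zero T X Y \<cdot> inverse_arrow T (Zero T X Y)"
    using inverse_arrow_right[OF assms] by (simp only: Cod_Zero)
  also have "\<dots> = Zero T Y Y" by (subst Zero_Compose) (simp_all add: assms)
  finally show ?thesis by (simp add: zero_object_iff)
qed

lemma arrow_iso_Tensor_swap: "arrow_iso ((f \<star> Ident T Y) \<star> Ident T Z) ((f \<star> Ident T Z) \<star> Ident T Y)"
proof -
  have "arrow_iso ((f \<star> Ident T Y) \<star> Ident T Z) (Ident T Z \<star> (f \<star> Ident T Y))"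
    by (rule arrow_iso_Tensor_comm)
  also have "arrow_iso (Ident T Z \<star> (f \<star> Ident T Y)) ((Ident T Z \<star> f) \<star> Ident T Y)"
    by (rule arrow_iso_sym[OF arrow_iso_Tensor_assoc])
  also have "arrow_iso ((Ident T Z \<star> f) \<star> Ident T Y) ((f \<star> Ident T Z) \<star> Ident T Y)"
    by (rule arrow_iso_Tensor_right[OF arrow_iso_Tensor_comm])
  finally show ?thesis .
qed

text \<open>The action of \<open>\<psi>\<close> itself on its cone need not vanish.\<close>

lemma act_cone_square:
  assumes "unit_map d \<psi>" "tri A B Z f g h" "arrow_iso f (act X d \<psi>)"
  shows "act Z (d + d) (SuspA_pow T d \<psi> \<cdot> \<psi>) = Zero T Z (Susp_pow T (d + d) Z)"
proof -
  note [simp] = assms(1)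
  obtain g h where t: "tri X (Susp_pow T d X) Z (act X d \<psi>) g h"
    using tri_arrow_iso[OF assms(2,3)] by auto
  note [simp] = triD(4-)[OF t]
  \<comment> \<open>Naturality moves \<psi> to the other side of \<open>g\<close>, where it meets
    the first map of the triangle. So the action of \<psi> on the cone vanishes after
    \<open>g\<close> and factors as \<open>u \<cdot> h\<close>.\<close>
  have "eq_upto_sign (SuspA_pow T d g \<cdot> act (Susp_pow T d X) d \<psi>) (SuspA_pow T d g \<cdot> SuspA_pow T d (act X d \<psi>))"
    by (intro eq_upto_sign_Compose_left act_Susp_pow) simp_all
  moreover have "SuspA_pow T d g \<cdot> SuspA_pow T d (act X d \<psi>) = SuspA_pow T d (g \<cdot> act X d \<psi>)"
    by (subst SuspA_pow_Comp) simp_all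
  ultimately have "act Z d \<psi> \<cdot> g = Zero T (Susp_pow T d X) (Susp_pow T d Z)"
    using act_natural[OF assms(1), of g] tri_comp[OF t] eq_upto_sign_Zero by simp
  then obtain u where u [simp]: "Dom T u = Susp T X" "Cod T u = Susp_pow T d Z" "u \<cdot> h = act Z d \<psi>"
    using tri_cofactor[OF tri_rot[OF t], of "act Z d \<psi>"] by auto
  \<comment> \<open>Likewise \<psi> annihilates \<open>h\<close>, hence also
    \<open>u \<cdot> h\<close>, which is the action of \<psi> itself; this is the vanishing of the
    square.\<close>
  have "eq_upto_sign (act (Susp T X) d \<psi> \<cdot> h) (SuspA T (act X d \<psi>) \<cdot> h)"
    by (intro eq_upto_sign_Compose_right act_Susp) simp_all
  then have "kill d \<psi> h"
    using tri_comp'(2)[OF t] eq_upto_sign_Zero by (simp add: kill_def)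
  then have "kill d \<psi> (u \<cdot> h)" by (intro kill_Compose_left) simp_all
  then have "kill (d + d) (SuspA_pow T d \<psi> \<cdot> \<psi>) (Ident T Z)"
    by (subst kill_comp_iff) simp_all
  then show ?thesis using kill_Ident_iff[OF unit_map_comp[OF assms(1,1)]] by simp
qed

text \<open>Chosen so as to be checkable by tensoring alone. For localizing S the orthogonality of S
  to all H \<otimes> X, which characterizes a localization, is derived from it.\<close>

definition smashing :: "'o set \<Rightarrow> 'o \<Rightarrow> 'o \<Rightarrow> bool" where
  "smashing S E H \<longleftrightarrow> (\<exists>\<epsilon> \<phi> \<delta>. tri E (Unit T) H \<epsilon> \<phi> \<delta>) \<and>
     (\<forall>W\<in>S. zero_object T (H \<boxtimes> W)) \<and> (\<forall>X. E \<boxtimes> X \<in> S)"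

end

context multiplicative_set begin

text \<open>Collects what the telescope needs of the fibres. The coproduct P is accessed through the
  localizing subcategories containing every \<open>F x\<close>, so that one fact applies both to
  torsion objects and to objects annihilated by H.\<close>

lemma smashing_step:
  obtains F P Q v u w where
    "tri P (Unit T) Q v u w"
    "\<And>S. localizing U T S \<Longrightarrow> (\<And>x. x \<in> \<Psi> \<Longrightarrow> F x \<in> S) \<Longrightarrow> P \<in> S"
    "\<And>x X. x \<in> \<Psi> \<Longrightarrow> F x \<boxtimes> X \<in> tors"
    "\<And>x. x \<in> \<Psi> \<Longrightarrow> u \<star> Ident T (F x) = Zero T (Unit T \<boxtimes> F x) (Q \<boxtimes> F x)"
    "\<And>d \<psi> X. (d, \<psi>) \<in> \<Psi> \<Longrightarrow> zero_object T (F (d, \<psi>) \<boxtimes> X) \<Longrightarrow> is_iso T (act X d \<psi>)"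
proof -
  \<comment> \<open>The fibre is obtained by rotating the cone of \<psi> back; outside \<Psi> the
    choice is arbitrary.\<close>
  have "\<exists>F j k. (d, \<psi>) \<in> \<Psi> \<longrightarrow> tri F (Unit T) (Susp_pow T d (Unit T)) j \<psi> k" for d \<psi>
  proof (cases "(d, \<psi>) \<in> \<Psi>")
    case True
    obtain Z g h where t: "tri (Dom T \<psi>) (Cod T \<psi>) Z \<psi> g h" using tri_ex .
    obtain W k where "tri W (Dom T \<psi>) (Cod T \<psi>) k \<psi> g" using tri_rot_back[OF t] .
    then show ?thesis using unit_map[OF True] by (auto simp: unit_map_def)
  qed auto
  then obtain F' j' k' where tF': "\<And>d \<psi>. (d, \<psi>) \<in> \<Psi> \<Longrightarrow> tri (F' d \<psi>) (Unit T) (Susp_pow T d (Unit T)) (j' d \<psi>) \<psi> (k' d \<psi>)"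
    by metis
  define F where "F x = F' (fst x) (snd x)" for x
  have tF: "tri (F (d, \<psi>)) (Unit T) (Susp_pow T d (Unit T)) (j' d \<psi>) \<psi> (k' d \<psi>)" if "(d, \<psi>) \<in> \<Psi>" for d \<psi>
    using tF'[OF that] by (simp add: F_def)
  have j [simp]: "Dom T (j' d \<psi>) = F (d, \<psi>)" "Cod T (j' d \<psi>) = Unit T" if "(d, \<psi>) \<in> \<Psi>" for d \<psi>
    using triD[OF tF[OF that]] by auto
  \<comment> \<open>Two versions of the square argument are kept: this one, after tensoring with X,
    shows that fibres are torsion; the next, on the fibre itself, makes \<open>u\<close> vanish
    there.\<close>
  have sq: "act (Susp T (F (d, \<psi>)) \<boxtimes> X) (d + d) (SuspA_pow T d \<psi> \<cdot> \<psi>) =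
      Zero T (Susp T (F (d, \<psi>)) \<boxtimes> X) (Susp_pow T (d + d) (Susp T (F (d, \<psi>)) \<boxtimes> X))"
    if \<psi>: "(d, \<psi>) \<in> \<Psi>" for d \<psi> X
  proof -
    obtain h' where "tri (Unit T \<boxtimes> X) (Susp_pow T d (Unit T) \<boxtimes> X) (Susp T (F (d, \<psi>)) \<boxtimes> X)
        (\<psi> \<star> Ident T X) (k' d \<psi> \<star> Ident T X) h'"
      using tri_Tensor_right[OF tri_rot[OF tF[OF \<psi>]]] .
    then show ?thesis by (rule act_cone_square[OF unit_map[OF \<psi>] _ act_arrow_iso_right[OF unit_map[OF \<psi>]]])
  qed
  have sqF: "act (F (d, \<psi>)) (d + d) (SuspA_pow T d \<psi> \<cdot> \<psi>) = Zero T (F (d, \<psi>)) (Susp_pow T (d + d) (F (d, \<psi>)))"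
    if \<psi>: "(d, \<psi>) \<in> \<Psi>" for d \<psi>
  proof -
    note um = unit_map[OF \<psi>] and um2 = unit_map_comp[OF unit_map[OF \<psi>] unit_map[OF \<psi>]]
    have "arrow_iso \<psi> (act (Unit T) d \<psi>)"
      using arrow_iso_trans[OF arrow_iso_sym[OF arrow_iso_Unit_left] act_arrow_iso_left[OF um]] .
    from act_cone_square[OF um tri_rot[OF tF[OF \<psi>]] this]
    have "kill (d + d) (SuspA_pow T d \<psi> \<cdot> \<psi>) (SuspA T (Ident T (F (d, \<psi>))))"
      using kill_Ident_iff[OF um2] by simp
    then show ?thesis by (simp only: kill_SuspA_iff[OF um2] kill_Ident_iff[OF um2])
  qed
  have Ft: "F x \<boxtimes> X \<in> tors" if x: "x \<in> \<Psi>" for x X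
  proof -
    obtain d \<psi> where x': "x = (d, \<psi>)" by (cases x)
    have "Susp T (F x) \<boxtimes> X \<in> tors"
      using tors_act_Zero[OF comp_closed] sq x x' by blast
    then show ?thesis using localizing_Susp[OF localizing_Tensor[OF localizing_tors, of X], of "F x"] by simp
  qed
  \<comment> \<open>The coproduct is formed in two stages, over the maps of one degree and then over
    the degrees, because smallness is known for each Hom set and for the integers.\<close>
  have "\<exists>P \<iota>. is_coproduct T {\<psi>. (d, \<psi>) \<in> \<Psi>} (\<lambda>\<psi>. F (d, \<psi>)) P \<iota>" for d
  proof -
    have "{\<psi>. (d, \<psi>) \<in> \<Psi>} \<subseteq> Hom T (Unit T) (Susp_pow T d (Unit T))"
      using unit_map by (auto simp: unit_map_def Hom_iff)
    then show ?thesis using coproduct_exists small_subset[OF small_Hom] by metis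
  qed
  then obtain Pd \<iota> where Pd: "\<And>d. is_coproduct T {\<psi>. (d, \<psi>) \<in> \<Psi>} (\<lambda>\<psi>. F (d, \<psi>)) (Pd d) (\<iota> d)" by metis
  obtain P \<kappa> where P: "is_coproduct T (UNIV :: int set) Pd P \<kappa>" using coproduct_exists[OF small_int] .
  note [simp] = coproduct_inj[OF P UNIV_I]
  have \<iota> [simp]: "Dom T (\<iota> d \<psi>) = F (d, \<psi>)" "Cod T (\<iota> d \<psi>) = Pd d" if "(d, \<psi>) \<in> \<Psi>" for d \<psi>
    using coproduct_inj[OF Pd[of d], of \<psi>] that by auto
  have "\<exists>v. Dom T v = Pd d \<and> Cod T v = Unit T \<and> (\<forall>\<psi>. (d, \<psi>) \<in> \<Psi> \<longrightarrow> v \<cdot> \<iota> d \<psi> = j' d \<psi>)" for d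
    by (rule coproduct_ex[OF Pd[of d], of "j' d" "Unit T"]) auto
  then obtain vd where vd [simp]: "\<And>d. Dom T (vd d) = Pd d" "\<And>d. Cod T (vd d) = Unit T"
    "\<And>d \<psi>. (d, \<psi>) \<in> \<Psi> \<Longrightarrow> vd d \<cdot> \<iota> d \<psi> = j' d \<psi>" by metis
  obtain v where v [simp]: "Dom T v = P" "Cod T v = Unit T" "\<And>d. v \<cdot> \<kappa> d = vd d"
    using coproduct_ex[OF P, of vd "Unit T"] by auto
  obtain Q u w where t: "tri P (Unit T) Q v u w" using tri_ex[of v] by auto
  note [simp] = triD(4,5)[OF t]
  \<comment> \<open>\<open>j' d \<psi>\<close> factors through \<open>v\<close>, which
    \<open>u\<close> annihilates; exactness of the fibre triangle will then factor \<open>u\<close>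
    through \<psi>.\<close>
  have uj: "u \<cdot> j' d \<psi> = Zero T (F (d, \<psi>)) Q" if \<psi>: "(d, \<psi>) \<in> \<Psi>" for d \<psi>
  proof -
    have "j' d \<psi> = (v \<cdot> \<kappa> d) \<cdot> \<iota> d \<psi>" using \<psi> by simp
    also have "\<dots> = v \<cdot> (\<kappa> d \<cdot> \<iota> d \<psi>)" using \<psi> by (intro assoc) simp_all
    finally have "u \<cdot> j' d \<psi> = (u \<cdot> v) \<cdot> (\<kappa> d \<cdot> \<iota> d \<psi>)" using \<psi> by (simp add: assoc)
    then show ?thesis using \<psi> tri_comp[OF t] by simp
  qed
  show thesis
  proof (rule that[OF t _ Ft])
    fix S assume S: "localizing U T S" "\<And>x. x \<in> \<Psi> \<Longrightarrow> F x \<in> S"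
    have "Pd d \<in> S" for d
    proof (rule localizing_coproduct[OF S(1) _ Pd])
      show "small U {\<psi>. (d, \<psi>) \<in> \<Psi>}"
        using small_Hom[of "Unit T" "Susp_pow T d (Unit T)"] unit_map
        by (elim small_subset) (auto simp: unit_map_def Hom_iff)
    qed (use S in auto)
    then show "P \<in> S" by (intro localizing_coproduct[OF S(1) small_int P])
  next
    fix x assume x: "x \<in> \<Psi>"
    obtain e \<chi> where x': "x = (e, \<chi>)" by (cases x)
    let ?d = "e + e" and ?\<psi> = "SuspA_pow T e \<chi> \<cdot> \<chi>"
    have \<psi>: "(?d, ?\<psi>) \<in> \<Psi>" using x x' comp_closed by blast
    have [simp]: "Dom T ?\<psi> = Unit T" "Cod T ?\<psi> = Susp_pow T ?d (Unit T)" using unit_map[OF \<psi>] by (auto simp only: unit_map_def)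
    obtain y where y: "Dom T y = Susp_pow T ?d (Unit T)" "Cod T y = Q" "y \<cdot> ?\<psi> = u"
      using tri_cofactor[OF tF[OF \<psi>], of u] uj[OF \<psi>] by auto
    have "?\<psi> \<star> Ident T (F x) = Zero T (Unit T \<boxtimes> F x) (Susp_pow T ?d (Unit T) \<boxtimes> F x)"
    proof (rule Zero_eqI)
      show "?\<psi> \<star> Ident T (F x) = Zero T (Dom T (?\<psi> \<star> Ident T (F x))) (Cod T (?\<psi> \<star> Ident T (F x)))"
      proof (rule arrow_iso_Zero[OF arrow_iso_sym[OF act_arrow_iso_right[OF unit_map[OF \<psi>], of "F x"]]])
        show "act (F x) ?d ?\<psi> = Zero T (Dom T (act (F x) ?d ?\<psi>)) (Cod T (act (F x) ?d ?\<psi>))"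
          unfolding act_Dom_Cod[OF unit_map[OF \<psi>]] using sqF[of e \<chi>] x unfolding x' .
      qed
    qed simp_all
    then have "(y \<cdot> ?\<psi>) \<star> Ident T (F x) = Zero T (Unit T \<boxtimes> F x) (Q \<boxtimes> F x)"
      using y(1,2) by (subst TensorA_Comp_left) simp_all
    then show "u \<star> Ident T (F x) = Zero T (Unit T \<boxtimes> F x) (Q \<boxtimes> F x)" by (simp only: y(3))
  next
    fix d \<psi> X assume \<psi>: "(d, \<psi>) \<in> \<Psi>" and z: "zero_object T (F (d, \<psi>) \<boxtimes> X)"
    obtain h' where "tri (F (d, \<psi>) \<boxtimes> X) (Unit T \<boxtimes> X) (Susp_pow T d (Unit T) \<boxtimes> X)
        (j' d \<psi> \<star> Ident T X) (\<psi> \<star> Ident T X) h'"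
      using tri_Tensor_right[OF tF[OF \<psi>]] .
    then have "is_iso T (\<psi> \<star> Ident T X)" using tri_zero_iff_iso2 z by blast
    then show "is_iso T (act X d \<psi>)" using arrow_iso_is_iso[OF act_arrow_iso_right[OF unit_map[OF \<psi>]]] by blast
  qed
qed

text \<open>If the last transition map kills the image of \<open>x\<close>, that image is torsion,
  so some multiple of \<open>x\<close> already dies one stage earlier. Desuspending the multiple
  restores the target \<open>Y 0\<close> but shifts the source, which is why sources range over all
  shifts of compact objects.\<close>

lemma killed_seq_comp:
  assumes "\<And>n. Dom T (t n) = Y n \<and> Cod T (t n) = Y (Suc n)"
    and "\<And>n z. shifted_compact (Dom T z) \<Longrightarrow> Cod T z = Y n \<Longrightarrow>
      t n \<cdot> z = Zero T (Dom T z) (Y (Suc n)) \<Longrightarrow> killed z"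
    and "shifted_compact (Dom T x)" "Cod T x = Y 0" "seq_comp Y t n \<cdot> x = Zero T (Dom T x) (Y n)"
  shows "killed x"
  using assms(3-)
proof (induction n arbitrary: x)
  case 0
  then have "x = Zero T (Dom T x) (Y 0)" by simp
  then show ?case using killed_Zero by metis
next
  case (Suc n)
  note [simp] = assms(1) Suc.prems(2)
  have sc [simp]: "Dom T (seq_comp Y t n) = Y 0" "Cod T (seq_comp Y t n) = Y n"
    using seq_comp_Dom_Cod[of t Y n] by auto
  let ?s = "seq_comp Y t n"
  have "killed (?s \<cdot> x)"
    using Suc.prems by (intro assms(2)[where n = n]) (simp_all add: assoc)
  then obtain d \<psi> where \<psi>: "(d, \<psi>) \<in> \<Psi>" "kill d \<psi> (?s \<cdot> x)" unfolding killed_def by blast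
  note [simp] = unit_map[OF \<psi>(1)]
  define x' where "x' = SuspA_pow T (- d) (act (Y 0) d \<psi> \<cdot> x)"
  have x' [simp]: "Dom T x' = Susp_pow T (- d) (Dom T x)" "Cod T x' = Y 0" and
    xx: "SuspA_pow T d x' = act (Y 0) d \<psi> \<cdot> x"
    by (simp_all add: x'_def)
  have "SuspA_pow T d (?s \<cdot> x') = (SuspA_pow T d ?s \<cdot> act (Y 0) d \<psi>) \<cdot> x"
    by (simp add: SuspA_pow_Comp xx assoc)
  also have "\<dots> = act (Y n) d \<psi> \<cdot> (?s \<cdot> x)" using act_natural[of d \<psi> ?s] by (simp flip: assoc)
  also have "\<dots> = Zero T (Dom T x) (Susp_pow T d (Y n))" using \<psi>(2) by (simp add: kill_def)
  finally have "SuspA_pow T d (?s \<cdot> x') = Zero T (Susp_pow T d (Dom T x')) (Susp_pow T d (Y n))" by simp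
  then have "?s \<cdot> x' = Zero T (Dom T x') (Y n)" by (simp only: SuspA_pow_eq_Zero_iff)
  then have "killed x'" by (intro Suc.IH) (simp_all add: shifted_compact_Susp_pow Suc.prems(1))
  then have "killed (act (Y 0) d \<psi> \<cdot> x)" using killed_SuspA_pow_iff[of d x'] xx by simp
  then show ?case using killed_act[OF \<psi>(1), of x] by simp
qed

theorem smashing_tors: obtains E H where "smashing tors E H"
proof -
  obtain F P Q v u w where t: "tri P (Unit T) Q v u w"
    and P: "\<And>S. localizing U T S \<Longrightarrow> (\<And>x. x \<in> \<Psi> \<Longrightarrow> F x \<in> S) \<Longrightarrow> P \<in> S"
    and F: "\<And>x X. x \<in> \<Psi> \<Longrightarrow> F x \<boxtimes> X \<in> tors"
    and uF: "\<And>x. x \<in> \<Psi> \<Longrightarrow> u \<star> Ident T (F x) = Zero T (Unit T \<boxtimes> F x) (Q \<boxtimes> F x)"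
    and iso: "\<And>d \<psi> X. (d, \<psi>) \<in> \<Psi> \<Longrightarrow> zero_object T (F (d, \<psi>) \<boxtimes> X) \<Longrightarrow> is_iso T (act X d \<psi>)"
    using smashing_step by metis
  note [simp] = triD(2-)[OF t]
  have Pt: "P \<boxtimes> X \<in> tors" for X
    using P[OF localizing_Tensor[OF localizing_tors, of X]] F by simp
  define Y where "Y = rec_nat (Unit T) (\<lambda>n y. Q \<boxtimes> y)"
  have Y [simp]: "Y 0 = Unit T" "Y (Suc n) = Q \<boxtimes> Y n" for n by (simp_all add: Y_def)
  define s where "s n = (u \<star> Ident T (Y n)) \<cdot> inverse_arrow T (LUnit T (Y n))" for n
  have s [simp]: "Dom T (s n) = Y n" "Cod T (s n) = Q \<boxtimes> Y n" for n by (simp_all add: s_def)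
  have s_iso: "arrow_iso (u \<star> Ident T (Y n)) (s n)" for n
    unfolding s_def by (rule arrow_iso_sym[OF arrow_iso_pre]) simp_all
  have sW: "arrow_iso (s n \<star> Ident T W) ((u \<star> Ident T W) \<star> Ident T (Y n))" for n W
    using arrow_iso_trans[OF arrow_iso_Tensor_right[OF arrow_iso_sym[OF s_iso]] arrow_iso_Tensor_swap] .
  obtain B \<iota> \<sigma> H g h where h: "is_hocolim Y s B \<iota> \<sigma> H g h"
    by (rule hocolim_exists[of s Y]) (simp, blast)
  note [simp] = is_hocolimD(8-)[OF h]
  define \<phi> where "\<phi> = g \<cdot> \<iota> 0"
  have [simp]: "Dom T \<phi> = Unit T" "Cod T \<phi> = H" by (simp_all add: \<phi>_def)
  obtain Z a b where "tri (Unit T) H Z \<phi> a b" using tri_ex[of \<phi>] by auto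
  then obtain E \<epsilon> where tE: "tri E (Unit T) H \<epsilon> \<phi> a" using tri_rot_back by metis
  \<comment> \<open>After tensoring with \<open>F x\<close> every transition map contains the zero
    map \<open>u \<star> Ident T (F x)\<close> as a factor, so the telescope collapses.\<close>
  have HF: "zero_object T (H \<boxtimes> F x)" if x: "x \<in> \<Psi>" for x
  proof -
    obtain h' where "is_hocolim (\<lambda>n. Y n \<boxtimes> F x) (\<lambda>n. s n \<star> Ident T (F x)) (B \<boxtimes> F x) (\<lambda>n. \<iota> n \<star> Ident T (F x))
      (\<sigma> \<star> Ident T (F x)) (H \<boxtimes> F x) (g \<star> Ident T (F x)) h'" using is_hocolim_Tensor_right[OF h] .
    then show ?thesis
    proof (rule hocolim_zero)
      fix n
      have "(u \<star> Ident T (F x)) \<star> Ident T (Y n) = Zero T ((Unit T \<boxtimes> F x) \<boxtimes> Y n) ((Q \<boxtimes> F x) \<boxtimes> Y n)"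
        using uF[OF x] by simp
      then show "s n \<star> Ident T (F x) = Zero T (Y n \<boxtimes> F x) (Y (Suc n) \<boxtimes> F x)"
        by (intro Zero_eqI[OF arrow_iso_Zero[OF arrow_iso_sym[OF sW]]]) simp_all
    qed
  qed
  \<comment> \<open>The objects annihilated by H form a localizing class containing every
    \<open>F x\<close>, hence P; so \<open>u\<close>, whose fibre is P, becomes invertible on
    H.\<close>
  have "zero_object T (P \<boxtimes> H)"
    using P[OF localizing_Tensor_zero[of H]] HF zero_object_Tensor_comm by simp
  then have uH: "is_iso T (u \<star> Ident T H)"
    using tri_zero_iff_iso2 tri_Tensor_right[OF t, of H] by metis
  have HE: "zero_object T (H \<boxtimes> E)"
  proof -
    obtain h' where h': "is_hocolim (\<lambda>n. H \<boxtimes> Y n) (\<lambda>n. Ident T H \<star> s n) (H \<boxtimes> B) (\<lambda>n. Ident T H \<star> \<iota> n)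
      (Ident T H \<star> \<sigma>) (H \<boxtimes> H) (Ident T H \<star> g) h'" using is_hocolim_Tensor_left[OF h] .
    \<comment> \<open>All transition maps of the telescope tensored with H are invertible, hence so
      is H \<otimes> 1 \<rightarrow> H \<otimes> H: the localization is idempotent.\<close>
    have "is_iso T (Ident T H \<star> s n)" for n
      using arrow_iso_is_iso[OF arrow_iso_trans[OF arrow_iso_sym[OF sW] arrow_iso_Tensor_comm], of H n] uH by simp
    then have "is_iso T ((Ident T H \<star> g) \<cdot> (Ident T H \<star> \<iota> 0))" by (rule hocolim_isos[OF h'])
    then have "is_iso T (Ident T H \<star> \<phi>)" by (simp add: \<phi>_def TensorA_Comp_right)
    moreover obtain h'' where "tri (H \<boxtimes> E) (H \<boxtimes> Unit T) (H \<boxtimes> H) (Ident T H \<star> \<epsilon>) (Ident T H \<star> \<phi>) h''"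
      using tri_Tensor_left[OF tE] .
    ultimately show ?thesis using tri_zero_iff_iso2 by blast
  qed
  have HW: "zero_object T (H \<boxtimes> W)" if W: "W \<in> tors" for W
  proof -
    have Yt: "Y n \<boxtimes> W \<in> tors" for n
    proof (induction n)
      case 0
      then show ?case
        using localizing_iso[OF localizing_tors isomorphic_sym[OF isomorphic_Unit_left] W] by simp
    next
      case (Suc n)
      let ?V = "Y n \<boxtimes> W"
      obtain h' where "tri (P \<boxtimes> ?V) (Unit T \<boxtimes> ?V) (Q \<boxtimes> ?V) (v \<star> Ident T ?V) (u \<star> Ident T ?V) h'"
        using tri_Tensor_right[OF t] .
      then have "Q \<boxtimes> ?V \<in> tors"
        using localizing_tri(1)[OF localizing_tors] Pt
          localizing_iso[OF localizing_tors isomorphic_sym[OF isomorphic_Unit_left] Suc] by blast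
      then show ?case
        using localizing_iso[OF localizing_tors isomorphic_sym[OF isomorphic_Tensor_assoc]] by simp
    qed
    obtain h' where h': "is_hocolim (\<lambda>n. Y n \<boxtimes> W) (\<lambda>n. s n \<star> Ident T W) (B \<boxtimes> W) (\<lambda>n. \<iota> n \<star> Ident T W)
      (\<sigma> \<star> Ident T W) (H \<boxtimes> W) (g \<star> Ident T W) h'" using is_hocolim_Tensor_right[OF h] .
    have "B \<boxtimes> W \<in> tors"
      by (rule tors_coproduct[OF small_nat is_hocolimD(1)[OF h']]) (rule Yt)
    then have HWt: "H \<boxtimes> W \<in> tors" by (rule hocolim_localizing[OF h' localizing_tors])
    \<comment> \<open>H \<otimes> W is torsion, yet each element of \<Psi> acts invertibly on it
      because H annihilates the fibre of that element; so a map killed by such an element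
      vanishes.\<close>
    show ?thesis
    proof (rule zero_objectI_compact)
      fix D f assume f: "shifted_compact D" "Dom T f = D" "Cod T f = H \<boxtimes> W"
      then obtain d \<psi> where \<psi>: "(d, \<psi>) \<in> \<Psi>" "kill d \<psi> f"
        using torsD[OF HWt, of f] unfolding killed_def by blast
      have "zero_object T (F (d, \<psi>) \<boxtimes> (H \<boxtimes> W))"
        using HF[OF \<psi>(1)] zero_object_Tensor_left zero_object_Tensor_comm zero_object_Tensor_assoc by blast
      then show "f = Zero T D (H \<boxtimes> W)"
        using kill_iso[OF unit_map[OF \<psi>(1)] \<psi>(2)] iso[OF \<psi>(1)] f by simp
    qed
  qed
  \<comment> \<open>Conversely, a map into W dies in the telescope, hence at a finite stage by
    compactness, and each transition map has a torsion fibre of the form P \<otimes> V.\<close>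
  have tH: "W \<in> tors" if W: "zero_object T (H \<boxtimes> W)" for W
  proof (rule torsI)
    fix f assume f [simp]: "shifted_compact (Dom T f)" "Cod T f = W"
    define x where "x = inverse_arrow T (LUnit T W) \<cdot> f"
    have x [simp]: "Dom T x = Dom T f" "Cod T x = Unit T \<boxtimes> W" and fx: "f = LUnit T W \<cdot> x"
      by (simp_all add: x_def)
    obtain h' where h': "is_hocolim (\<lambda>n. Y n \<boxtimes> W) (\<lambda>n. s n \<star> Ident T W) (B \<boxtimes> W) (\<lambda>n. \<iota> n \<star> Ident T W)
      (\<sigma> \<star> Ident T W) (H \<boxtimes> W) (g \<star> Ident T W) h'" using is_hocolim_Tensor_right[OF h] .
    let ?y = "(g \<star> Ident T W) \<cdot> (\<iota> 0 \<star> Ident T W) \<cdot> x"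
    have "?y = Zero T (Dom T f) (H \<boxtimes> W)"
      by (rule Zero_eqI[OF zero_object_Cod]) (simp_all add: W)
    then obtain n where n: "seq_comp (\<lambda>n. Y n \<boxtimes> W) (\<lambda>n. s n \<star> Ident T W) n \<cdot> x = Zero T (Dom T x) (Y n \<boxtimes> W)"
      using hocolim_shifted_compact[OF h', of "Dom T f" x] by auto
    have "killed x"
    proof (rule killed_seq_comp[OF _ _ _ _ n])
      fix m z assume z: "shifted_compact (Dom T z)" "Cod T z = Y m \<boxtimes> W"
        "(s m \<star> Ident T W) \<cdot> z = Zero T (Dom T z) (Y (Suc m) \<boxtimes> W)"
      let ?V = "Y m \<boxtimes> W"
      obtain h' where "tri (P \<boxtimes> ?V) (Unit T \<boxtimes> ?V) (Q \<boxtimes> ?V) (v \<star> Ident T ?V) (u \<star> Ident T ?V) h'"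
        using tri_Tensor_right[OF t] .
      note t1 = tri_rot[OF this]
      have "arrow_iso (u \<star> Ident T ?V) ((u \<star> Ident T (Y m)) \<star> Ident T W)"
        using arrow_iso_sym[OF arrow_iso_Tensor_assoc[of u "Ident T (Y m)" "Ident T W"]] by simp
      then have *: "arrow_iso (u \<star> Ident T ?V) (s m \<star> Ident T W)"
        using arrow_iso_trans arrow_iso_Tensor_right[OF s_iso] by blast
      obtain b c where "tri (Dom T (s m \<star> Ident T W)) (Cod T (s m \<star> Ident T W)) (Susp T (P \<boxtimes> ?V)) (s m \<star> Ident T W) b c"
        using tri_arrow_iso[OF t1 *] .
      then have "tri ?V (Y (Suc m) \<boxtimes> W) (Susp T (P \<boxtimes> ?V)) (s m \<star> Ident T W) b c" by simp
      then obtain k where k: "tri (P \<boxtimes> ?V) ?V (Y (Suc m) \<boxtimes> W) k (s m \<star> Ident T W) b"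
        using tri_rot_back by (metis Susp_eq_iff)
      obtain y where y: "Dom T y = Dom T z" "Cod T y = P \<boxtimes> ?V" "k \<cdot> y = z"
        using tri_factor[OF k z(2,3)] .
      have "killed y" using torsD[OF Pt] y z(1) by simp
      then show "killed z" using killed_Compose_left[of y k] y triD(2)[OF k] by simp
    qed simp_all
    then show "killed f" unfolding fx by (intro killed_Compose_left) simp_all
  qed
  have "E \<boxtimes> X \<in> tors" for X
    using tH HE zero_object_Tensor_left zero_object_Tensor_assoc by blast
  then have "smashing tors E H" unfolding smashing_def using tE HW by blast
  then show thesis by (rule that)
qed

end

context tensor_triangulated_category begin

section \<open>Formal consequences of a smashing triangle\<close>

lemma smashing_UNIV: "zero_object T Z \<Longrightarrow> smashing UNIV (Unit T) Z"
  unfolding smashing_def using tri_Ident zero_object_Tensor_left by blast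

text \<open>On an object of both classes each of the two maps to the unit becomes invertible after
  tensoring, and so does their product; thus the cone of the product annihilates the
  intersection.\<close>

lemma smashing_Int:
  assumes S1: "smashing S1 E1 H1" "localizing U T S1" and S2: "smashing S2 E2 H2" "localizing U T S2"
  obtains H where "smashing (S1 \<inter> S2) (E1 \<boxtimes> E2) H"
proof -
  obtain \<epsilon>1 \<phi>1 \<delta>1 \<epsilon>2 \<phi>2 \<delta>2 where t1: "tri E1 (Unit T) H1 \<epsilon>1 \<phi>1 \<delta>1" and t2: "tri E2 (Unit T) H2 \<epsilon>2 \<phi>2 \<delta>2"
    using S1 S2 unfolding smashing_def by blast
  note [simp] = triD(2,3)[OF t1] triD(2,3)[OF t2]
  define \<epsilon> where "\<epsilon> = LUnit T (Unit T) \<cdot> (Ident T (Unit T) \<star> \<epsilon>2) \<cdot> (\<epsilon>1 \<star> Ident T E2)"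
  obtain H \<phi> \<delta> where t: "tri (E1 \<boxtimes> E2) (Unit T) H \<epsilon> \<phi> \<delta>"
    using tri_ex[of \<epsilon>] by (auto simp: \<epsilon>_def)
  have iso: "is_iso T (\<epsilon>' \<star> Ident T W)" if "tri E' (Unit T) H' \<epsilon>' \<phi>' \<delta>'" "zero_object T (H' \<boxtimes> W)"
    for E' H' \<epsilon>' \<phi>' \<delta>' W
    using tri_Tensor_right[OF that(1), of W] tri_zero_iff_iso that(2) by metis
  have "zero_object T (H \<boxtimes> W)" if W: "W \<in> S1 \<inter> S2" for W
  proof -
    have 1: "is_iso T (\<epsilon>1 \<star> Ident T W)" and 2: "is_iso T (\<epsilon>2 \<star> Ident T W)"
      using iso[OF t1] iso[OF t2] W S1(1) S2(1) unfolding smashing_def by blast+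
    have "is_iso T ((\<epsilon>1 \<star> Ident T W) \<star> Ident T E2)" using 1 by simp
    then have 3: "is_iso T ((\<epsilon>1 \<star> Ident T E2) \<star> Ident T W)"
      using arrow_iso_is_iso[OF arrow_iso_Tensor_swap] by blast
    have "is_iso T (Ident T (Unit T) \<star> (\<epsilon>2 \<star> Ident T W))" using 2 by simp
    then have 4: "is_iso T ((Ident T (Unit T) \<star> \<epsilon>2) \<star> Ident T W)"
      using arrow_iso_is_iso[OF arrow_iso_sym[OF arrow_iso_Tensor_assoc]] by blast
    have "\<epsilon> \<star> Ident T W = (LUnit T (Unit T) \<star> Ident T W) \<cdot>
        (((Ident T (Unit T) \<star> \<epsilon>2) \<star> Ident T W) \<cdot> ((\<epsilon>1 \<star> Ident T E2) \<star> Ident T W))"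
      unfolding \<epsilon>_def by (subst TensorA_Comp_left, simp)+ simp
    then have "is_iso T (\<epsilon> \<star> Ident T W)" using 3 4 by simp
    then show ?thesis using tri_Tensor_right[OF t, of W] tri_zero_iff_iso by metis
  qed
  moreover have "(E1 \<boxtimes> E2) \<boxtimes> X \<in> S1 \<inter> S2" for X
  proof
    have "E1 \<boxtimes> (E2 \<boxtimes> X) \<in> S1" "E2 \<boxtimes> (E1 \<boxtimes> X) \<in> S2" using S1(1) S2(1) unfolding smashing_def by blast+
    then show "(E1 \<boxtimes> E2) \<boxtimes> X \<in> S1" "(E1 \<boxtimes> E2) \<boxtimes> X \<in> S2"
      using localizing_iso[OF S1(2) isomorphic_sym[OF isomorphic_Tensor_assoc]]
        localizing_iso[OF S2(2) isomorphic_trans[OF isomorphic_Tensor_left_comm isomorphic_sym[OF isomorphic_Tensor_assoc]]]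
      by blast+
  qed
  ultimately have "smashing (S1 \<inter> S2) (E1 \<boxtimes> E2) H" unfolding smashing_def using t by blast
  then show thesis by (rule that)
qed

lemma smashing_zero_left:
  assumes "smashing S E H" "zero_object T (H \<boxtimes> W)"
  shows "isomorphic T (E \<boxtimes> W) W"
proof -
  obtain \<epsilon> \<phi> \<delta> where t: "tri E (Unit T) H \<epsilon> \<phi> \<delta>" using assms(1) unfolding smashing_def by blast
  obtain h where h: "tri (E \<boxtimes> W) (Unit T \<boxtimes> W) (H \<boxtimes> W) (\<epsilon> \<star> Ident T W) (\<phi> \<star> Ident T W) h"
    using tri_Tensor_right[OF t] .
  then have "isomorphic T (E \<boxtimes> W) (Unit T \<boxtimes> W)"
    using tri_zero_iff_iso[OF h] assms(2) isomorphicI triD(2,3)[OF h] by metis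
  then show ?thesis using isomorphic_trans isomorphic_Unit_left by blast
qed

lemma smashing_zero_right:
  assumes "smashing S E H" "zero_object T (E \<boxtimes> W)"
  shows "isomorphic T (H \<boxtimes> W) W"
proof -
  obtain \<epsilon> \<phi> \<delta> where t: "tri E (Unit T) H \<epsilon> \<phi> \<delta>" using assms(1) unfolding smashing_def by blast
  obtain h where h: "tri (E \<boxtimes> W) (Unit T \<boxtimes> W) (H \<boxtimes> W) (\<epsilon> \<star> Ident T W) (\<phi> \<star> Ident T W) h"
    using tri_Tensor_right[OF t] .
  then have "isomorphic T (Unit T \<boxtimes> W) (H \<boxtimes> W)"
    using tri_zero_iff_iso2[OF h] assms(2) isomorphicI triD(4,5)[OF h] by metis
  then show ?thesis using isomorphic_trans isomorphic_Unit_left isomorphic_sym by blast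
qed

lemma smashing_orthogonal:
  assumes "smashing S E H" "localizing U T S"
  shows "zero_object T (H \<boxtimes> E)" "zero_object T (E \<boxtimes> H)"
proof -
  have "E \<boxtimes> Unit T \<in> S" using assms(1) unfolding smashing_def by blast
  then have "E \<in> S" by (rule localizing_iso[OF assms(2) isomorphic_Unit_right])
  then show "zero_object T (H \<boxtimes> E)" using assms(1) unfolding smashing_def by blast
  then show "zero_object T (E \<boxtimes> H)" by (simp add: zero_object_Tensor_comm)
qed

text \<open>In the naturality square of \<phi> against \<open>g\<close>, the map at the target is
  invertible because E \<otimes> H = 0, and the map at the source is zero because H annihilates
  S.\<close>

lemma smashing_Hom_zero:
  assumes "smashing S E H" "localizing U T S" "Dom T g \<in> S" "Cod T g = H \<boxtimes> X"
  shows "g = Zero T (Dom T g) (Cod T g)"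
proof -
  obtain \<epsilon> \<phi> \<delta> where t: "tri E (Unit T) H \<epsilon> \<phi> \<delta>" using assms(1) unfolding smashing_def by blast
  note [simp] = triD(4,5)[OF t]
  let ?W = "Dom T g" and ?Z = "H \<boxtimes> X"
  have "zero_object T (E \<boxtimes> ?Z)"
    using smashing_orthogonal(2)[OF assms(1,2)] zero_object_Tensor_left zero_object_Tensor_assoc by blast
  then have iso: "is_iso T (\<phi> \<star> Ident T ?Z)"
    using tri_Tensor_right[OF t, of ?Z] tri_zero_iff_iso2 by metis
  have "zero_object T (H \<boxtimes> ?W)" using assms(1,3) unfolding smashing_def by blast
  then have "\<phi> \<star> Ident T ?W = Zero T (Unit T \<boxtimes> ?W) (H \<boxtimes> ?W)"
    by (intro Zero_eqI[OF zero_object_Cod]) simp_all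
  moreover have "(\<phi> \<star> Ident T ?Z) \<cdot> (Ident T (Unit T) \<star> g) = (Ident T H \<star> g) \<cdot> (\<phi> \<star> Ident T ?W)"
    using assms(4) by (simp flip: TensorA_Comp)
  ultimately have "(\<phi> \<star> Ident T ?Z) \<cdot> (Ident T (Unit T) \<star> g) = (\<phi> \<star> Ident T ?Z) \<cdot> Zero T (Unit T \<boxtimes> ?W) (Unit T \<boxtimes> ?Z)"
    using assms(4) by simp
  then have "Ident T (Unit T) \<star> g = Zero T (Unit T \<boxtimes> ?W) (Unit T \<boxtimes> ?Z)"
    by (rule iffD1[OF iso_cancel_left[OF iso], rotated -1]) (use assms(4) in simp_all)
  then show ?thesis
    using arrow_iso_Zero[OF arrow_iso_Unit_left[of g]] assms(4) by simp
qed

text \<open>The point is E \<otimes> L = 0. The map E \<otimes> L \<rightarrow> L given by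
  \<epsilon> has its source in S, so it is zero by orthogonality, but it becomes invertible after
  tensoring with E. Tensoring the given triangle with E and with H then identifies its
  vertices.\<close>

lemma smashing_tri:
  assumes "smashing S E H" "localizing U T S" "tri G X L f g h" "G \<in> S"
    and orth: "\<And>k. Dom T k \<in> S \<Longrightarrow> Cod T k = L \<Longrightarrow> k = Zero T (Dom T k) L"
  shows "isomorphic T (E \<boxtimes> X) G" "isomorphic T (H \<boxtimes> X) L"
proof -
  obtain \<epsilon> \<phi> \<delta> where t: "tri E (Unit T) H \<epsilon> \<phi> \<delta>" using assms(1) unfolding smashing_def by blast
  note [simp] = triD(2-5)[OF t]
  have "LUnit T L \<cdot> (\<epsilon> \<star> Ident T L) = LUnit T L \<cdot> Zero T (E \<boxtimes> L) (Unit T \<boxtimes> L)"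
    using orth[of "LUnit T L \<cdot> (\<epsilon> \<star> Ident T L)"] assms(1) unfolding smashing_def by simp
  then have "\<epsilon> \<star> Ident T L = Zero T (E \<boxtimes> L) (Unit T \<boxtimes> L)"
    by (rule iffD1[OF iso_cancel_left, rotated -1]) simp_all
  then have 0: "(\<epsilon> \<star> Ident T L) \<star> Ident T E = Zero T ((E \<boxtimes> L) \<boxtimes> E) ((Unit T \<boxtimes> L) \<boxtimes> E)" by simp
  have "is_iso T (\<epsilon> \<star> Ident T E)"
    using tri_Tensor_right[OF t, of E] tri_zero_iff_iso smashing_orthogonal(1)[OF assms(1,2)] by metis
  then have "is_iso T ((\<epsilon> \<star> Ident T E) \<star> Ident T L)" by simp
  then have iso: "is_iso T ((\<epsilon> \<star> Ident T L) \<star> Ident T E)"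
    using arrow_iso_is_iso[OF arrow_iso_Tensor_swap] by blast
  have "zero_object T ((Unit T \<boxtimes> L) \<boxtimes> E)"
    using iso unfolding 0 by (rule iso_Zero)
  then have "zero_object T (E \<boxtimes> (Unit T \<boxtimes> L))" by (simp add: zero_object_Tensor_comm)
  then have EL: "zero_object T (E \<boxtimes> L)"
    by (rule zero_object_isomorphic[rotated]) (intro isomorphic_Tensor isomorphic_refl isomorphic_Unit_left)
  have HG: "zero_object T (H \<boxtimes> G)" using assms(1,4) unfolding smashing_def by blast
  obtain h1 where h1: "tri (E \<boxtimes> G) (E \<boxtimes> X) (E \<boxtimes> L) (Ident T E \<star> f) (Ident T E \<star> g) h1"
    using tri_Tensor_left[OF assms(3)] .
  have "isomorphic T (E \<boxtimes> G) (E \<boxtimes> X)"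
    using tri_zero_iff_iso[OF h1] EL isomorphicI triD(2,3)[OF h1] by metis
  then show "isomorphic T (E \<boxtimes> X) G"
    using smashing_zero_left[OF assms(1) HG] isomorphic_sym isomorphic_trans by blast
  obtain h2 where h2: "tri (H \<boxtimes> G) (H \<boxtimes> X) (H \<boxtimes> L) (Ident T H \<star> f) (Ident T H \<star> g) h2"
    using tri_Tensor_left[OF assms(3)] .
  have "isomorphic T (H \<boxtimes> X) (H \<boxtimes> L)"
    using tri_zero_iff_iso2[OF h2] HG isomorphicI triD(4,5)[OF h2] by metis
  then show "isomorphic T (H \<boxtimes> X) L"
    using smashing_zero_right[OF assms(1) EL] isomorphic_trans by blast
qed

lemma smashing_tri_exists:
  assumes "smashing S E H"
  obtains f g h where "tri (E \<boxtimes> X) X (H \<boxtimes> X) f g h"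
proof -
  obtain \<epsilon> \<phi> \<delta> where t: "tri E (Unit T) H \<epsilon> \<phi> \<delta>" using assms(1) unfolding smashing_def by blast
  note [simp] = triD(2-5)[OF t]
  obtain h where h: "tri (E \<boxtimes> X) (Unit T \<boxtimes> X) (H \<boxtimes> X) (\<epsilon> \<star> Ident T X) (\<phi> \<star> Ident T X) h"
    using tri_Tensor_right[OF t] .
  note [simp] = triD(6,7)[OF h]
  have "tri (E \<boxtimes> X) X (H \<boxtimes> X) (LUnit T X \<cdot> (\<epsilon> \<star> Ident T X)) ((\<phi> \<star> Ident T X) \<cdot> inverse_arrow T (LUnit T X)) h"
    by (rule tri_iso[OF h, where a = "Ident T (E \<boxtimes> X)" and b = "LUnit T X" and c = "Ident T (H \<boxtimes> X)"])
      (simp_all add: assoc)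
  then show thesis by (rule that)
qed

end

section \<open>Homogeneous prime ideals\<close>

context graded_commutative_ring begin

lemma component_carrier: "x \<in> component R i \<Longrightarrow> x \<in> carrier R"
  using additive_subgroup.a_subset[OF component_subgroup] by blast

lemma component_zero [simp]: "\<zero> \<in> component R i"
  by (rule additive_subgroup.zero_closed[OF component_subgroup])

lemma component_add: "x \<in> component R i \<Longrightarrow> y \<in> component R i \<Longrightarrow> x \<oplus> y \<in> component R i"
  by (rule additive_subgroup.a_closed[OF component_subgroup])

lemma component_minus: "x \<in> component R i \<Longrightarrow> \<ominus> x \<in> component R i"
  by (rule additive_subgroup.a_inv_closed[OF component_subgroup])

lemma component_pow: "x \<in> component R d \<Longrightarrow> x [^] (n :: nat) \<in> component R (int n * d)"
proof (induction n)
  case (Suc n)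
  then show ?case using component_mult[of "x [^] n" "int n * d" x d] by (simp add: algebra_simps)
qed (simp add: component_one)

lemma homogeneous_iff: "x \<in> homogeneous R \<longleftrightarrow> (\<exists>i. x \<in> component R i)"
  by (auto simp: homogeneous_def)

lemma graded_comm': 
  assumes "r \<in> component R i" "s \<in> component R j"
  shows "r \<otimes> s = s \<otimes> r \<or> r \<otimes> s = \<ominus> (s \<otimes> r)"
  using graded_comm[OF assms] by (simp split: if_splits)

text \<open>A homogeneous ideal is handled through its homogeneous elements, each paired with its degree.\<close>

definition homogeneous_part :: "(int \<times> 'a) set \<Rightarrow> bool" where
  "homogeneous_part G \<longleftrightarrow> (\<forall>i x. (i, x) \<in> G \<longrightarrow> x \<in> component R i) \<and> (\<forall>i. (i, \<zero>) \<in> G) \<and>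
     (\<forall>i x y. (i, x) \<in> G \<longrightarrow> (i, y) \<in> G \<longrightarrow> (i, x \<oplus> y) \<in> G) \<and>
     (\<forall>i x j b. (i, x) \<in> G \<longrightarrow> b \<in> component R j \<longrightarrow> (j + i, b \<otimes> x) \<in> G)"

lemma homogeneous_partD:
  assumes "homogeneous_part G"
  shows "(i, x) \<in> G \<Longrightarrow> x \<in> component R i" "(i, \<zero>) \<in> G"
    "(i, x) \<in> G \<Longrightarrow> (i, y) \<in> G \<Longrightarrow> (i, x \<oplus> y) \<in> G"
    "(i, x) \<in> G \<Longrightarrow> b \<in> component R j \<Longrightarrow> (j + i, b \<otimes> x) \<in> G"
  using assms unfolding homogeneous_part_def by blast+

lemma homogeneous_part_minus:
  assumes "homogeneous_part G" "(i, x) \<in> G"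
  shows "(i, \<ominus> x) \<in> G"
proof -
  have "(0 + i, (\<ominus> \<one>) \<otimes> x) \<in> G"
    using assms by (intro homogeneous_partD(4) component_minus component_one)
  then show ?thesis
    using component_carrier[OF homogeneous_partD(1)[OF assms]] by (simp add: l_minus)
qed

lemma homogeneous_part_mult_right:
  assumes "homogeneous_part G" "(i, x) \<in> G" "b \<in> component R j"
  shows "(i + j, x \<otimes> b) \<in> G"
  using graded_comm'[OF homogeneous_partD(1)[OF assms(1,2)] assms(3)]
    homogeneous_partD(4)[OF assms] homogeneous_part_minus[OF assms(1) homogeneous_partD(4)[OF assms]]
  by (auto simp: add.commute)

text \<open>Each degree occurs at most once in the sum. This loses nothing for a homogeneous part,
  which is closed under addition in each degree, and it makes uniqueness of decompositions
  applicable.\<close>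

definition generated :: "(int \<times> 'a) set \<Rightarrow> 'a set" where
  "generated G = {\<Oplus>i\<in>F. a i | F a. finite F \<and> (\<forall>i\<in>F. (i, a i) \<in> G)}"

lemma generatedI: "finite F \<Longrightarrow> (\<And>i. i \<in> F \<Longrightarrow> (i, a i) \<in> G) \<Longrightarrow> (\<Oplus>i\<in>F. a i) \<in> generated G"
  unfolding generated_def by blast

context
  fixes G assumes G: "homogeneous_part G"
begin

lemma part_carrier: "(i, x) \<in> G \<Longrightarrow> x \<in> carrier R"
  using homogeneous_partD(1)[OF G] component_carrier by blast

lemma generated_carrier: "generated G \<subseteq> carrier R"
  unfolding generated_def using part_carrier by (auto intro!: finsum_closed)

lemma generated_zero: "\<zero> \<in> generated G"
  using generatedI[of "{}"] by simp

lemma generated_part: "(i, x) \<in> G \<Longrightarrow> x \<in> generated G"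
  using generatedI[of "{i}" "\<lambda>_. x" G] part_carrier by simp

text \<open>A new term is merged with the summand of its own degree when there is one; otherwise the
  index set grows.\<close>

lemma generated_add_part:
  assumes "r \<in> generated G" "(j, h) \<in> G"
  shows "h \<oplus> r \<in> generated G"
proof -
  obtain F a where r: "r = (\<Oplus>i\<in>F. a i)" and F: "finite F" "\<forall>i\<in>F. (i, a i) \<in> G"
    using assms(1) unfolding generated_def by blast
  have [simp]: "a \<in> F \<rightarrow> carrier R" "h \<in> carrier R" using F(2) part_carrier assms(2) by auto
  show ?thesis
  proof (cases "j \<in> F")
    case True
    define F' where "F' = F - {j}"
    have F': "F = insert j F'" "j \<notin> F'" "finite F'" using True F(1) by (auto simp: F'_def)
    have [simp]: "a \<in> F' \<rightarrow> carrier R" "a j \<in> carrier R" using F(2) part_carrier F'(1) by auto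
    have "(\<Oplus>i\<in>F. (a(j := h \<oplus> a j)) i) = (h \<oplus> a j) \<oplus> (\<Oplus>i\<in>F'. (a(j := h \<oplus> a j)) i)"
      unfolding F'(1) using F'(2,3) by (subst finsum_insert) auto
    also have "(\<Oplus>i\<in>F'. (a(j := h \<oplus> a j)) i) = (\<Oplus>i\<in>F'. a i)"
      using F'(2) by (intro finsum_cong') auto
    also have "(h \<oplus> a j) \<oplus> (\<Oplus>i\<in>F'. a i) = h \<oplus> r"
      unfolding r F'(1) using F'(2,3) by (simp add: a_assoc)
    finally have "h \<oplus> r = (\<Oplus>i\<in>F. (a(j := h \<oplus> a j)) i)" by simp
    moreover have "(i, (a(j := h \<oplus> a j)) i) \<in> G" if "i \<in> F" for i
      using homogeneous_partD(3)[OF G assms(2)] F(2) that by auto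
    ultimately show ?thesis using generatedI[OF F(1), of "a(j := h \<oplus> a j)" G] by simp
  next
    case False
    have "(\<Oplus>i\<in>insert j F. (a(j := h)) i) = h \<oplus> (\<Oplus>i\<in>F. (a(j := h)) i)"
      using False F(1) by (subst finsum_insert) auto
    also have "(\<Oplus>i\<in>F. (a(j := h)) i) = r"
      unfolding r using False by (intro finsum_cong') auto
    finally have "h \<oplus> r = (\<Oplus>i\<in>insert j F. (a(j := h)) i)" by simp
    moreover have "(i, (a(j := h)) i) \<in> G" if "i \<in> insert j F" for i
      using assms(2) F(2) that by auto
    ultimately show ?thesis using generatedI[of "insert j F" "a(j := h)" G] F(1) by simp
  qed
qed

lemma generated_sum:
  assumes "finite F" "\<And>i. i \<in> F \<Longrightarrow> a i \<in> carrier R"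
    and "\<And>i r. i \<in> F \<Longrightarrow> r \<in> generated G \<Longrightarrow> a i \<oplus> r \<in> generated G" "r \<in> generated G"
  shows "(\<Oplus>i\<in>F. a i) \<oplus> r \<in> generated G"
  using assms(1-3)
proof (induction F rule: finite_induct)
  case empty
  then show ?case using assms(4) generated_carrier by auto
next
  case (insert j F)
  have [simp]: "a \<in> F \<rightarrow> carrier R" "a j \<in> carrier R" using insert.prems by auto
  have [simp]: "r \<in> carrier R" using assms(4) generated_carrier by auto
  have "a j \<oplus> ((\<Oplus>i\<in>F. a i) \<oplus> r) \<in> generated G" using insert by auto
  then show ?case using insert.hyps by (simp add: a_assoc)
qed

lemma generated_add:
  assumes "r \<in> generated G" "s \<in> generated G"
  shows "r \<oplus> s \<in> generated G"
proof -
  obtain F a where r: "r = (\<Oplus>i\<in>F. a i)" and F: "finite F" "\<forall>i\<in>F. (i, a i) \<in> G"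
    using assms(1) unfolding generated_def by blast
  show ?thesis unfolding r
    by (rule generated_sum[OF F(1) _ _ assms(2)]) (use F(2) part_carrier generated_add_part in auto)
qed

lemma generated_mult_component:
  assumes "r \<in> generated G" "b \<in> component R j"
  shows "b \<otimes> r \<in> generated G" "r \<otimes> b \<in> generated G"
proof -
  obtain F a where r: "r = (\<Oplus>i\<in>F. a i)" and F: "finite F" "\<forall>i\<in>F. (i, a i) \<in> G"
    using assms(1) unfolding generated_def by blast
  have [simp]: "a \<in> F \<rightarrow> carrier R" "b \<in> carrier R" using F(2) part_carrier assms(2) component_carrier by auto
  have "(\<Oplus>i\<in>F. b \<otimes> a i) \<oplus> \<zero> \<in> generated G"
  proof (rule generated_sum[OF F(1) _ _ generated_zero])
    fix i s assume i: "i \<in> F" and s: "s \<in> generated G"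
    then have "(j + i, b \<otimes> a i) \<in> G" using homogeneous_partD(4)[OF G] F(2) assms(2) by blast
    then show "(b \<otimes> a i) \<oplus> s \<in> generated G" using s generated_add_part by blast
  qed (use F(2) part_carrier in auto)
  moreover have "(\<Oplus>i\<in>F. b \<otimes> a i) \<in> carrier R" using F(2) part_carrier by (intro finsum_closed) auto
  ultimately show "b \<otimes> r \<in> generated G" unfolding r using F(1) by (simp add: finsum_rdistr)
  have "(\<Oplus>i\<in>F. a i \<otimes> b) \<oplus> \<zero> \<in> generated G"
  proof (rule generated_sum[OF F(1) _ _ generated_zero])
    fix i s assume i: "i \<in> F" and s: "s \<in> generated G"
    then have "(i + j, a i \<otimes> b) \<in> G" using homogeneous_part_mult_right[OF G] F(2) assms(2) by blast
    then show "(a i \<otimes> b) \<oplus> s \<in> generated G" using s generated_add_part by blast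
  qed (use F(2) part_carrier in auto)
  moreover have "(\<Oplus>i\<in>F. a i \<otimes> b) \<in> carrier R" using F(2) part_carrier by (intro finsum_closed) auto
  ultimately show "r \<otimes> b \<in> generated G" unfolding r using F(1) by (simp add: finsum_ldistr)
qed

lemma generated_mult:
  assumes "r \<in> generated G" "x \<in> carrier R"
  shows "x \<otimes> r \<in> generated G" "r \<otimes> x \<in> generated G"
proof -
  obtain a where a: "\<forall>i. a i \<in> component R i" "finite {i. a i \<noteq> \<zero>}" "x = (\<Oplus>i\<in>{i. a i \<noteq> \<zero>}. a i)"
    using decomposition[OF assms(2)] by blast
  let ?F = "{i. a i \<noteq> \<zero>}"
  have [simp]: "a \<in> ?F \<rightarrow> carrier R" "a i \<in> carrier R" "r \<in> carrier R" for i using a(1) component_carrier assms(1) generated_carrier by auto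
  have "(\<Oplus>i\<in>?F. a i \<otimes> r) \<oplus> \<zero> \<in> generated G"
    by (rule generated_sum[OF a(2) _ _ generated_zero])
      (simp, blast intro: generated_add generated_mult_component(1)[OF assms(1)] a(1)[rule_format])
  moreover have "(\<Oplus>i\<in>?F. a i \<otimes> r) \<in> carrier R" by (intro finsum_closed) auto
  ultimately show "x \<otimes> r \<in> generated G" unfolding a(3) using a(2) by (simp add: finsum_ldistr)
  have "(\<Oplus>i\<in>?F. r \<otimes> a i) \<oplus> \<zero> \<in> generated G"
    by (rule generated_sum[OF a(2) _ _ generated_zero])
      (simp, blast intro: generated_add generated_mult_component(2)[OF assms(1)] a(1)[rule_format])
  moreover have "(\<Oplus>i\<in>?F. r \<otimes> a i) \<in> carrier R" by (intro finsum_closed) auto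
  ultimately show "r \<otimes> x \<in> generated G" unfolding a(3) using a(2) by (simp add: finsum_rdistr)
qed

lemma generated_decomposition:
  assumes "r \<in> generated G"
  obtains a where "\<And>i. (i, a i) \<in> G" "finite {i. a i \<noteq> \<zero>}" "r = (\<Oplus>i\<in>{i. a i \<noteq> \<zero>}. a i)"
proof -
  obtain F a where r: "r = (\<Oplus>i\<in>F. a i)" and F: "finite F" "\<forall>i\<in>F. (i, a i) \<in> G"
    using assms unfolding generated_def by blast
  define b where "b i = (if i \<in> F then a i else \<zero>)" for i
  have b: "(i, b i) \<in> G" for i using F(2) homogeneous_partD(2)[OF G] by (simp add: b_def)
  have sub: "{i. b i \<noteq> \<zero>} \<subseteq> F" by (auto simp: b_def)
  have "r = (\<Oplus>i\<in>F. b i)"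
    unfolding r using F(2) part_carrier by (intro finsum_cong') (auto simp: b_def)
  also have "\<dots> = (\<Oplus>i\<in>{i. b i \<noteq> \<zero>}. b i)"
    using F(1) sub b part_carrier by (intro add.finprod_mono_neutral_cong_right) auto
  finally show thesis using that[of b] b finite_subset[OF sub F(1)] by blast
qed

lemma generated_homogeneous_ideal: "homogeneous_ideal R (generated G)"
proof -
  have "ideal (generated G) R"
  proof (rule idealI)
    show "subgroup (generated G) (add_monoid R)"
    proof (rule add.subgroupI)
      fix a assume a: "a \<in> generated G"
      then have "(\<ominus> \<one>) \<otimes> a \<in> generated G" by (intro generated_mult) auto
      then show "\<ominus> a \<in> generated G" using a generated_carrier by (auto simp: l_minus)
    qed (use generated_carrier generated_zero generated_add in auto)
  qed (use generated_mult ring_axioms in auto)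
  moreover have "\<exists>a. (\<forall>i. a i \<in> component R i \<inter> generated G) \<and> finite {i. a i \<noteq> \<zero>} \<and>
       r = (\<Oplus>i\<in>{i. a i \<noteq> \<zero>}. a i)" if "r \<in> generated G" for r
    by (rule generated_decomposition[OF that]) (use homogeneous_partD(1)[OF G] generated_part in blast)
  ultimately show ?thesis unfolding homogeneous_ideal_def by blast
qed

text \<open>Compared with the one-term decomposition of r, uniqueness forces the j-th component to
  be r itself. Hence passing to the generated ideal adds no homogeneous elements.\<close>

lemma generated_component:
  assumes "r \<in> generated G" "r \<in> component R j"
  shows "(j, r) \<in> G"
proof -
  obtain a where a: "\<And>i. (i, a i) \<in> G" "finite {i. a i \<noteq> \<zero>}" "r = (\<Oplus>i\<in>{i. a i \<noteq> \<zero>}. a i)"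
    using generated_decomposition[OF assms(1)] by blast
  define b where "b i = (if i = j then r else \<zero>)" for i
  have rc: "r \<in> carrier R" using assms(2) component_carrier by blast
  have b: "\<forall>i. b i \<in> component R i" using assms(2) by (simp add: b_def)
  have "finite {i. b i \<noteq> \<zero>}" by (rule finite_subset[of _ "{j}"]) (auto simp: b_def)
  moreover have "r = (\<Oplus>i\<in>{i. b i \<noteq> \<zero>}. b i)"
  \<comment> \<open>For r zero the support of the one-term decomposition is empty instead of
    {j}.\<close>
  proof (cases "r = \<zero>")
    case True
    then have "{i. b i \<noteq> \<zero>} = {}" by (auto simp: b_def)
    then show ?thesis using True by (simp only: finsum_empty)
  next
    case False
    then have "{i. b i \<noteq> \<zero>} = {j}" by (auto simp: b_def)
    moreover have "(\<Oplus>i\<in>{j}. b i) = r" using rc by (simp add: b_def)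
    ultimately show ?thesis by (simp only:)
  qed
  ultimately have "a = b"
    using decomposition[OF rc] a(2,3) homogeneous_partD(1)[OF G a(1)] b by blast
  then show ?thesis using a(1)[of j] by (simp add: b_def)
qed

end

text \<open>The prime is a maximal homogeneous ideal avoiding the powers of \<open>t\<close>.\<close>

lemma ex_prime_avoiding:
  assumes G0: "homogeneous_part G0" and t: "t \<in> component R d"
    and avoid: "\<And>n :: nat. (int n * d, t [^] n) \<notin> G0"
  obtains q where "q \<in> Spec R" "t \<notin> q" "\<And>i x. (i, x) \<in> G0 \<Longrightarrow> x \<in> q"
proof -
  let ?A = "{G. homogeneous_part G \<and> G0 \<subseteq> G \<and> (\<forall>n :: nat. (int n * d, t [^] n) \<notin> G)}"
  have "\<exists>M\<in>?A. \<forall>G\<in>?A. M \<subseteq> G \<longrightarrow> G = M"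
  proof (rule subset_Zorn_nonempty)
    show "?A \<noteq> {}" using G0 avoid by blast
    fix C assume C: "C \<noteq> {}" "subset.chain ?A C"
    have CA: "C \<subseteq> ?A" and lin: "\<And>G G'. G \<in> C \<Longrightarrow> G' \<in> C \<Longrightarrow> G \<subseteq> G' \<or> G' \<subseteq> G"
      using C(2) unfolding subset_chain_def by blast+
    then have hp: "homogeneous_part G" if "G \<in> C" for G using that by blast
    have "homogeneous_part (\<Union>C)"
      unfolding homogeneous_part_def
    proof (intro conjI allI impI)
      show "x \<in> component R i" if "(i, x) \<in> \<Union>C" for i x using that homogeneous_partD(1)[OF hp] by blast
      show "(i, \<zero>) \<in> \<Union>C" for i using C(1) homogeneous_partD(2)[OF hp] by blast
      show "(j + i, b \<otimes> x) \<in> \<Union>C" if "(i, x) \<in> \<Union>C" "b \<in> component R j" for i x j b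
        using that homogeneous_partD(4)[OF hp] by blast
      show "(i, x \<oplus> y) \<in> \<Union>C" if xy: "(i, x) \<in> \<Union>C" "(i, y) \<in> \<Union>C" for i x y
      proof -
        obtain G G' where "G \<in> C" "G' \<in> C" "(i, x) \<in> G" "(i, y) \<in> G'" using xy by blast
        then show ?thesis using lin[of G G'] homogeneous_partD(3)[OF hp] by blast
      qed
    qed
    then show "\<Union>C \<in> ?A" using CA C(1) by blast
  qed
  then obtain G where GA: "G \<in> ?A" and GM: "\<forall>G'\<in>?A. G \<subseteq> G' \<longrightarrow> G' = G" by (rule bexE)
  have G: "homogeneous_part G" "G0 \<subseteq> G" "\<And>n :: nat. (int n * d, t [^] n) \<notin> G" using GA by auto
  have max: "G' = G" if "homogeneous_part G'" "G \<subseteq> G'" "\<And>n :: nat. (int n * d, t [^] n) \<notin> G'" for G'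
    using GM that order_trans[OF G(2) that(2)] by auto
  \<comment> \<open>By maximality, enlarging G by left multiples of x in every degree must capture a
    power of t.\<close>
  have power: "\<exists>(n :: nat) h b. t [^] n = h \<oplus> b \<otimes> x \<and> (int n * d, h) \<in> G \<and> b \<in> component R (int n * d - k)"
    if x: "x \<in> component R k" "(k, x) \<notin> G" for x k
  proof (rule ccontr)
    assume no: "\<not> ?thesis"
    let ?G = "{(i, h \<oplus> b \<otimes> x) | i h b. (i, h) \<in> G \<and> b \<in> component R (i - k)}"
    note c = component_carrier
    have xc: "x \<in> carrier R" using x(1) c by blast
    have "homogeneous_part ?G"
      unfolding homogeneous_part_def
    proof (intro conjI allI impI)
      fix i z assume "(i, z) \<in> ?G"
      then obtain h b where z: "z = h \<oplus> b \<otimes> x" "(i, h) \<in> G" "b \<in> component R (i - k)" by blast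
      then show "z \<in> component R i"
        using component_mult[OF z(3) x(1)] homogeneous_partD(1)[OF G(1) z(2)] by (simp add: component_add)
      fix j a assume a: "a \<in> component R j"
      have "(j + i, a \<otimes> h) \<in> G" "a \<otimes> b \<in> component R (j + i - k)"
        using homogeneous_partD(4)[OF G(1) z(2) a] component_mult[OF a z(3)] by (simp_all add: algebra_simps)
      moreover have "a \<otimes> z = a \<otimes> h \<oplus> (a \<otimes> b) \<otimes> x"
        using z c[OF a] xc c[OF z(3)] c[OF homogeneous_partD(1)[OF G(1) z(2)]] by (simp add: r_distr m_assoc)
      ultimately show "(j + i, a \<otimes> z) \<in> ?G" by blast
    next
      fix i
      have "\<zero> = \<zero> \<oplus> \<zero> \<otimes> x" using xc by simp
      then show "(i, \<zero>) \<in> ?G" using homogeneous_partD(2)[OF G(1)] component_zero by blast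
    next
      fix i z z' assume "(i, z) \<in> ?G" "(i, z') \<in> ?G"
      then obtain h b h' b' where z: "z = h \<oplus> b \<otimes> x" "(i, h) \<in> G" "b \<in> component R (i - k)"
        "z' = h' \<oplus> b' \<otimes> x" "(i, h') \<in> G" "b' \<in> component R (i - k)" by blast
      have [simp]: "h \<in> carrier R" "h' \<in> carrier R" "b \<in> carrier R" "b' \<in> carrier R" "x \<in> carrier R"
        using c z xc homogeneous_partD(1)[OF G(1)] by blast+
      have "z \<oplus> z' = (h \<oplus> h') \<oplus> (b \<oplus> b') \<otimes> x"
        unfolding z(1,4) by (simp add: l_distr a_ac)
      then show "(i, z \<oplus> z') \<in> ?G"
        using homogeneous_partD(3)[OF G(1) z(2,5)] component_add[OF z(3,6)] by blast
    qed
    moreover have "G \<subseteq> ?G"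
    proof
      fix y assume y: "y \<in> G"
      obtain i h where y': "y = (i, h)" by (cases y)
      have "h \<in> carrier R" using c homogeneous_partD(1)[OF G(1)] y y' by blast
      then have "h = h \<oplus> \<zero> \<otimes> x" using xc by simp
      then show "y \<in> ?G" using y y' component_zero by blast
    qed
    ultimately have "?G = G" using max no by blast
    moreover have "(k, x) \<in> ?G"
    proof -
      have "x = \<zero> \<oplus> \<one> \<otimes> x" using xc by simp
      moreover have "\<one> \<in> component R (k - k)" using component_one by simp
      ultimately show ?thesis using homogeneous_partD(2)[OF G(1)] by blast
    qed
    ultimately show False using x(2) by simp
  qed
  \<comment> \<open>Expanding a product of two powers of t leaves three terms. Two lie in G because
    they have a factor in G; the third does after x and c are exchanged at the cost of a
    sign.\<close>
  have prime: "(k, x) \<in> G \<or> (l, y) \<in> G"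
    if xy: "x \<in> component R k" "y \<in> component R l" "(k + l, x \<otimes> y) \<in> G" for k l x y
  proof (rule ccontr)
    assume "\<not> ?thesis"
    then obtain n m :: nat and h h' b c where
      n: "t [^] n = h \<oplus> b \<otimes> x" "(int n * d, h) \<in> G" "b \<in> component R (int n * d - k)" and
      m: "t [^] m = h' \<oplus> c \<otimes> y" "(int m * d, h') \<in> G" "c \<in> component R (int m * d - l)"
      using power[OF xy(1)] power[OF xy(2)] by blast
    have [simp]: "h \<in> carrier R" "h' \<in> carrier R" "b \<in> carrier R" "c \<in> carrier R" "x \<in> carrier R" "y \<in> carrier R"
      "t \<in> carrier R"
      using component_carrier n m xy t homogeneous_partD(1)[OF G(1)] by blast+
    have bx: "b \<otimes> x \<in> component R (int n * d)" using component_mult[OF n(3) xy(1)] by simp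
    have 1: "(int n * d + int m * d, h \<otimes> t [^] m) \<in> G"
      by (rule homogeneous_part_mult_right[OF G(1) n(2) component_pow[OF t]])
    have 2: "(int n * d + int m * d, (b \<otimes> x) \<otimes> h') \<in> G"
      by (rule homogeneous_partD(4)[OF G(1) m(2) bx])
    have 3: "(int n * d + int m * d, (b \<otimes> x) \<otimes> (c \<otimes> y)) \<in> G"
    proof -
      have "(int n * d - k + (int m * d - l) + (k + l), (b \<otimes> c) \<otimes> (x \<otimes> y)) \<in> G"
        by (rule homogeneous_partD(4)[OF G(1) xy(3) component_mult[OF n(3) m(3)]])
      then have *: "(int n * d + int m * d, (b \<otimes> c) \<otimes> (x \<otimes> y)) \<in> G" by (simp add: algebra_simps)
      have "(b \<otimes> x) \<otimes> (c \<otimes> y) = b \<otimes> ((x \<otimes> c) \<otimes> y)"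
        "b \<otimes> ((c \<otimes> x) \<otimes> y) = (b \<otimes> c) \<otimes> (x \<otimes> y)"
        "b \<otimes> ((\<ominus> (c \<otimes> x)) \<otimes> y) = \<ominus> ((b \<otimes> c) \<otimes> (x \<otimes> y))"
        by (simp_all add: m_assoc l_minus r_minus)
      then have "(b \<otimes> x) \<otimes> (c \<otimes> y) = (b \<otimes> c) \<otimes> (x \<otimes> y) \<or> (b \<otimes> x) \<otimes> (c \<otimes> y) = \<ominus> ((b \<otimes> c) \<otimes> (x \<otimes> y))"
        using graded_comm'[OF xy(1) m(3)] by metis
      then show ?thesis using * homogeneous_part_minus[OF G(1) *] by auto
    qed
    have "t [^] (n + m) = t [^] n \<otimes> t [^] m" by (simp add: nat_pow_mult)
    also have "\<dots> = h \<otimes> t [^] m \<oplus> (b \<otimes> x) \<otimes> t [^] m" unfolding n(1) by (simp add: l_distr)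
    also have "(b \<otimes> x) \<otimes> t [^] m = (b \<otimes> x) \<otimes> h' \<oplus> (b \<otimes> x) \<otimes> (c \<otimes> y)" unfolding m(1) by (simp add: r_distr)
    finally have "(int n * d + int m * d, t [^] (n + m)) \<in> G"
      using homogeneous_partD(3)[OF G(1) 1 homogeneous_partD(3)[OF G(1) 2 3]] by simp
    then show False using G(3)[of "n + m"] by (simp add: algebra_simps)
  qed
  \<comment> \<open>The exponent 1 in the avoidance condition keeps t itself out of the
    ideal.\<close>
  have t1: "t \<notin> generated G"
    using generated_component[OF G(1) _ t] G(3)[of 1] component_carrier[OF t] by auto
  have "generated G \<in> Spec R"
    unfolding Spec_def
  proof (intro CollectI conjI ballI impI)
    show "homogeneous_ideal R (generated G)" by (rule generated_homogeneous_ideal[OF G(1)])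
    show "generated G \<noteq> carrier R" using t1 component_carrier[OF t] by auto
    fix r s assume "r \<in> homogeneous R" "s \<in> homogeneous R" and rs: "r \<otimes> s \<in> generated G"
    then obtain i j where ij: "r \<in> component R i" "s \<in> component R j" by (auto simp: homogeneous_iff)
    then have "(i + j, r \<otimes> s) \<in> G" using generated_component[OF G(1) rs] component_mult by blast
    then show "r \<in> generated G \<or> s \<in> generated G" using prime[OF ij] generated_part[OF G(1)] by blast
  qed
  then show thesis using that t1 G(2) generated_part[OF G(1)] by blast
qed

section \<open>Homogeneous primes and their generators\<close>

lemma Spec_ideal: "q \<in> Spec R \<Longrightarrow> ideal q R"
  by (simp add: Spec_def homogeneous_ideal_def)

lemma Spec_one: "q \<in> Spec R \<Longrightarrow> \<one> \<notin> q"
  using ideal.one_imp_carrier[OF Spec_ideal, of q] unfolding Spec_def by blast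

lemma Spec_mult:
  "q \<in> Spec R \<Longrightarrow> r \<in> component R i \<Longrightarrow> s \<in> component R j \<Longrightarrow> r \<notin> q \<Longrightarrow> s \<notin> q \<Longrightarrow> r \<otimes> s \<notin> q"
  unfolding Spec_def homogeneous_def by blast

lemma Spec_minus:
  assumes "q \<in> Spec R" "r \<in> carrier R" "r \<notin> q" shows "\<ominus> r \<notin> q"
proof
  assume "\<ominus> r \<in> q"
  then have "\<ominus> (\<ominus> r) \<in> q"
    using additive_subgroup.a_inv_closed[OF ideal.axioms(1)[OF Spec_ideal[OF assms(1)]]]
    by blast
  then show False using assms by simp
qed

lemma Spec_pow: "q \<in> Spec R \<Longrightarrow> t \<in> component R d \<Longrightarrow> t \<notin> q \<Longrightarrow> t [^] (n :: nat) \<notin> q"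
proof (induction n)
  case (Suc n)
  then show ?case using Spec_mult[OF Suc.prems(1) component_pow[OF Suc.prems(2), of n] Suc.prems(2)] by simp
qed (simp add: Spec_one)

text \<open>The homogeneous components of finitely many generators lie in p because p is
  homogeneous. The conclusion is phrased through primes q because it serves to compare closed
  sets.\<close>

lemma Spec_finite_generators:
  assumes "noetherian_ring R" "p \<in> Spec R"
  obtains B where "finite B" "B \<subseteq> homogeneous R" "B \<subseteq> p" "\<And>q. q \<in> Spec R \<Longrightarrow> B \<subseteq> q \<Longrightarrow> p \<subseteq> q"
proof -
  obtain A where A: "A \<subseteq> carrier R" "finite A" "p = Idl A"
    using noetherian_ring.finetely_gen[OF assms(1) Spec_ideal[OF assms(2)]] by blast
  have Ap: "A \<subseteq> p" using genideal_self[OF A(1)] A(3) by simp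
  have "\<forall>r\<in>p. \<exists>a. (\<forall>i. a i \<in> component R i \<inter> p) \<and> finite {i. a i \<noteq> \<zero>} \<and> r = (\<Oplus>i\<in>{i. a i \<noteq> \<zero>}. a i)"
    using assms(2) by (simp add: Spec_def homogeneous_ideal_def)
  then obtain a where a: "\<And>r i. r \<in> p \<Longrightarrow> a r i \<in> component R i \<inter> p" "\<And>r. r \<in> p \<Longrightarrow> finite {i. a r i \<noteq> \<zero>}"
    "\<And>r. r \<in> p \<Longrightarrow> r = (\<Oplus>i\<in>{i. a r i \<noteq> \<zero>}. a r i)" by metis
  let ?B = "\<Union>r\<in>A. a r ` {i. a r i \<noteq> \<zero>}"
  show thesis
  proof (rule that)
    show "finite ?B" using A(2) a(2) Ap by blast
    show "?B \<subseteq> homogeneous R" "?B \<subseteq> p" using a(1) Ap by (auto simp: homogeneous_def)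
    fix q assume q: "q \<in> Spec R" "?B \<subseteq> q"
    interpret q: ideal q R by (rule Spec_ideal[OF q(1)])
    have "A \<subseteq> q"
    proof
      fix r assume r: "r \<in> A"
      have sum: "(\<Oplus>i\<in>F. a r i) \<in> q" if "finite F" "\<And>i. i \<in> F \<Longrightarrow> a r i \<in> q" for F
        using that
      proof (induction F rule: finite_induct)
        case (insert i F)
        have "a r \<in> F \<rightarrow> carrier R" "a r i \<in> carrier R" using insert.prems q.a_subset by auto
        then show ?case using insert by (simp add: q.a_closed)
      qed simp
      have "(\<Oplus>i\<in>{i. a r i \<noteq> \<zero>}. a r i) \<in> q"
        using a(2)[of r] r Ap q(2) by (intro sum) auto
      then show "r \<in> q" using a(3)[of r] r Ap by auto
    qed
    then show "p \<subseteq> q" unfolding A(3) by (rule genideal_minimal[OF q.ideal_axioms])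
  qed
qed

end

section \<open>Objects supported on a set of primes\<close>

text \<open>A homogeneous \<open>g\<close> contributes to the convolution through the single index k
  - d. When that index is outside the support of \<open>f\<close>, all terms of the sum are zero and
  so is the right side.\<close>

lemma (in triangulated_category) graded_Compose_homogeneous:
  assumes "\<And>j. Dom T (g j) = Y \<and> Cod T (g j) = Susp_pow T j Z" "\<And>j. j \<noteq> d \<Longrightarrow> g j = Zero T Y (Susp_pow T j Z)"
    and f: "f \<in> graded_Hom T X Y"
  shows "graded_Compose T X Y Z g f k = SuspA_pow T (k - d) (g d) \<cdot> f (k - d)"
proof -
  have f' [simp]: "Dom T (f i) = X" "Cod T (f i) = Susp_pow T i Y" for i
    using f by (auto simp: graded_Hom_def Hom_iff)
  note [simp] = assms(1)
  let ?A = "{i. f i \<noteq> Zero T X (Susp_pow T i Y)}" and ?h = "\<lambda>i. SuspA_pow T i (g (k - i)) \<cdot> f i"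
  have fin: "finite ?A" using f by (simp add: graded_Hom_def)
  interpret G: comm_group "Hom_group T X (Susp_pow T k Z)" by (rule Hom_comm_group)
  have c: "?h i \<in> carrier (Hom_group T X (Susp_pow T k Z))" for i
    by (simp add: Hom_group_def Hom_iff)
  have z: "?h i = \<one>\<^bsub>Hom_group T X (Susp_pow T k Z)\<^esub>" if "i \<noteq> k - d" for i
    using that assms(2)[of "k - i"] by (simp add: Hom_group_def)
  have "finprod (Hom_group T X (Susp_pow T k Z)) ?h ?A = ?h (k - d)"
  proof (cases "k - d \<in> ?A")
    case True
    have "finprod (Hom_group T X (Susp_pow T k Z)) ?h ?A =
        finprod (Hom_group T X (Susp_pow T k Z)) (\<lambda>i. if k - d = i then ?h i else \<one>\<^bsub>Hom_group T X (Susp_pow T k Z)\<^esub>) ?A"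
      using z c by (intro G.finprod_cong') auto
    also have "\<dots> = ?h (k - d)" by (rule G.finprod_singleton[OF True fin]) (use c in auto)
    finally show ?thesis .
  next
    case False
    have "finprod (Hom_group T X (Susp_pow T k Z)) ?h ?A = \<one>\<^bsub>Hom_group T X (Susp_pow T k Z)\<^esub>"
      using z False by (intro G.finprod_one_eqI) (metis mem_Collect_eq)
    then show ?thesis using False by (simp add: Hom_group_def)
  qed
  then show ?thesis by (simp add: graded_Compose_def)
qed

text \<open>The homomorphism behind \<open>canonical_action\<close> is fixed as \<phi>, so that
  annihilation by ring elements can be expressed by maps out of the unit.\<close>

locale canonical_tensor_action = tensor_triangulated_category U T + R: graded_commutative_ring R
  for U :: "'u itself" and T :: "('o, 'm, 'c) tensor_category_scheme" (structure)
    and R :: "('r, 'k) graded_ring_scheme" +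
  fixes \<phi> :: "'r \<Rightarrow> int \<Rightarrow> 'm" and \<rho> :: "'o \<Rightarrow> 'r \<Rightarrow> int \<Rightarrow> 'm"
  assumes hom: "\<phi> \<in> graded_ring_hom R (graded_End T (Unit T))"
    and action: "r \<in> carrier R \<Longrightarrow> \<rho> X r = tensor_action T X (\<phi> r)"
begin

lemma \<phi>_graded_Hom: "r \<in> carrier R \<Longrightarrow> \<phi> r \<in> graded_Hom T (Unit T) (Unit T)"
  using hom by (auto simp: graded_ring_hom_def ring_hom_def graded_End_def)

lemma \<phi>_unit_map: "r \<in> carrier R \<Longrightarrow> unit_map d (\<phi> r d)"
  using \<phi>_graded_Hom by (auto simp: graded_Hom_def unit_map_def Hom_iff)

lemma \<phi>_component: "r \<in> component R d \<Longrightarrow> j \<noteq> d \<Longrightarrow> \<phi> r j = Zero T (Unit T) (Susp_pow T j (Unit T))"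
  using hom by (auto simp: graded_ring_hom_def graded_End_def)

lemma \<phi>_add: "r \<in> carrier R \<Longrightarrow> s \<in> carrier R \<Longrightarrow> \<phi> (r \<oplus>\<^bsub>R\<^esub> s) d = \<phi> r d \<boxplus> \<phi> s d"
  using hom by (simp add: graded_ring_hom_def ring_hom_def graded_End_def)

lemma \<phi>_zero: "\<phi> \<zero>\<^bsub>R\<^esub> d = Zero T (Unit T) (Susp_pow T d (Unit T))"
proof -
  have "\<phi> \<zero>\<^bsub>R\<^esub> d \<boxplus> \<phi> \<zero>\<^bsub>R\<^esub> d = \<phi> \<zero>\<^bsub>R\<^esub> d" using \<phi>_add[of "\<zero>\<^bsub>R\<^esub>" "\<zero>\<^bsub>R\<^esub>" d] by simp
  from Plus_cancel_self[OF this] show ?thesis using \<phi>_unit_map[of "\<zero>\<^bsub>R\<^esub>" d] by (simp add: unit_map_def)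
qed

lemma \<phi>_minus:
  assumes "r \<in> carrier R" shows "\<phi> (\<ominus>\<^bsub>R\<^esub> r) d = Neg T (\<phi> r d)"
proof (rule Neg_unique)
  show "\<phi> r d \<boxplus> \<phi> (\<ominus>\<^bsub>R\<^esub> r) d = Zero T (Dom T (\<phi> r d)) (Cod T (\<phi> r d))"
    using \<phi>_add[of r "\<ominus>\<^bsub>R\<^esub> r" d] \<phi>_zero[of d] \<phi>_unit_map[OF assms, of d] assms
    by (simp add: R.r_neg unit_map_def)
qed (use \<phi>_unit_map[OF assms, of d] \<phi>_unit_map[of "\<ominus>\<^bsub>R\<^esub> r" d] assms in \<open>simp_all add: unit_map_def\<close>)

lemma \<phi>_mult:
  assumes "r \<in> component R d" "s \<in> component R e"
  shows "\<phi> (r \<otimes>\<^bsub>R\<^esub> s) (e + d) = SuspA_pow T e (\<phi> r d) \<cdot> \<phi> s e"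
proof -
  have rs: "r \<in> carrier R" "s \<in> carrier R" using assms R.component_carrier by auto
  have "\<phi> (r \<otimes>\<^bsub>R\<^esub> s) = graded_Compose T (Unit T) (Unit T) (Unit T) (\<phi> r) (\<phi> s)"
    using hom rs by (simp add: graded_ring_hom_def ring_hom_def graded_End_def)
  moreover have "graded_Compose T (Unit T) (Unit T) (Unit T) (\<phi> r) (\<phi> s) (e + d) =
      SuspA_pow T (e + d - d) (\<phi> r d) \<cdot> \<phi> s (e + d - d)"
    using \<phi>_unit_map[OF rs(1)] \<phi>_component[OF assms(1)] \<phi>_graded_Hom[OF rs(2)]
    by (intro graded_Compose_homogeneous) (auto simp: unit_map_def)
  ultimately show ?thesis by simp
qed

text \<open>The two composites are images of r s and s r, which agree up to sign in R.\<close>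

lemma \<phi>_commute:
  assumes "r \<in> component R d" "s \<in> component R e"
  shows "eq_upto_sign (SuspA_pow T e (\<phi> r d) \<cdot> \<phi> s e) (SuspA_pow T d (\<phi> s e) \<cdot> \<phi> r d)"
proof -
  have rs: "r \<in> carrier R" "s \<in> carrier R" using assms R.component_carrier by auto
  have "eq_upto_sign (\<phi> (r \<otimes>\<^bsub>R\<^esub> s) (e + d)) (\<phi> (s \<otimes>\<^bsub>R\<^esub> r) (e + d))"
    using R.graded_comm'[OF assms] rs by (auto simp: eq_upto_sign_def \<phi>_minus)
  then show ?thesis using \<phi>_mult[OF assms] \<phi>_mult[OF assms(2,1)] by (simp add: add.commute)
qed

text \<open>Membership in the component is included so that, for fixed f, the pairs (d, r) form a
  homogeneous part; the degree is recorded since zero lies in every component.\<close>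

definition kills :: "int \<Rightarrow> 'r \<Rightarrow> 'm \<Rightarrow> bool" where
  "kills d r f \<longleftrightarrow> r \<in> component R d \<and> kill d (\<phi> r d) f"

lemma kills_component: "kills d r f \<Longrightarrow> r \<in> component R d"
  by (simp add: kills_def)

lemma component_unit_map: "r \<in> component R d \<Longrightarrow> unit_map e (\<phi> r e)"
  using \<phi>_unit_map R.component_carrier by blast

lemma kills_mult_left:
  assumes "r \<in> component R d" "kills e s f"
  shows "kills (d + e) (r \<otimes>\<^bsub>R\<^esub> s) f"
  using assms kill_comp[OF component_unit_map component_unit_map] \<phi>_mult R.component_mult
  unfolding kills_def by (metis add.commute)

lemma kills_minus: "kills d r f \<Longrightarrow> kills d (\<ominus>\<^bsub>R\<^esub> r) f"
  using \<phi>_minus kill_Neg_iff component_unit_map R.component_minus R.component_carrier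
  unfolding kills_def by metis

lemma kills_mult_right:
  assumes "s \<in> component R e" "kills d r f"
  shows "kills (d + e) (r \<otimes>\<^bsub>R\<^esub> s) f"
proof -
  have "kills (d + e) (s \<otimes>\<^bsub>R\<^esub> r) f" using kills_mult_left[OF assms] by (simp add: add.commute)
  then show ?thesis
    using kills_minus R.graded_comm'[of r d s e] assms unfolding kills_def by metis
qed

lemma kills_add: "kills d r f \<Longrightarrow> kills d s f \<Longrightarrow> kills d (r \<oplus>\<^bsub>R\<^esub> s) f"
  using kill_add \<phi>_add component_unit_map R.component_add R.component_carrier unfolding kills_def by metis

lemma kills_zero: "kills d \<zero>\<^bsub>R\<^esub> f"
  by (simp add: kills_def \<phi>_zero kill_def)

lemma kills_Zero: "r \<in> component R d \<Longrightarrow> kills d r (Zero T X Y)"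
  by (simp add: kills_def component_unit_map)

lemma kills_SuspA_pow_iff: "kills d r (SuspA_pow T i f) \<longleftrightarrow> kills d r f"
  using kill_SuspA_pow_iff component_unit_map unfolding kills_def by blast

text \<open>This annihilator is what the prime avoidance argument is applied to.\<close>

lemma annihilator_homogeneous_part: "R.homogeneous_part {(d, r). kills d r f}"
  unfolding R.homogeneous_part_def
  by (auto simp: kills_zero kills_add kills_mult_left dest: kills_component)

text \<open>The module action on the k-th component is the suspended action on X, whereas
  \<open>kills\<close> uses the action on the suspension of X. They agree up to sign, so
  annihilation is the same.\<close>

lemma smult_Hom_module:
  assumes "r \<in> component R d" "m \<in> graded_Hom T C X"
  shows "r \<odot>\<^bsub>Hom_module T \<rho> C X\<^esub> m = \<zero>\<^bsub>Hom_module T \<rho> C X\<^esub> \<longleftrightarrow> (\<forall>k. kills d r (m k))"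
proof -
  have r: "r \<in> carrier R" using assms(1) R.component_carrier by blast
  note [simp] = \<phi>_unit_map[OF r]
  have m [simp]: "Dom T (m k) = C" "Cod T (m k) = Susp_pow T k X" for k
    using assms(2) by (auto simp: graded_Hom_def Hom_iff)
  have \<rho>: "\<rho> X r j = act X j (\<phi> r j)" for j using action[OF r] by (simp add: tensor_action_act)
  have "graded_Compose T C X X (\<rho> X r) m k = SuspA_pow T (k - d) (\<rho> X r d) \<cdot> m (k - d)" for k
    using assms by (intro graded_Compose_homogeneous) (simp_all add: \<rho> \<phi>_component)
  then have "r \<odot>\<^bsub>Hom_module T \<rho> C X\<^esub> m = \<zero>\<^bsub>Hom_module T \<rho> C X\<^esub> \<longleftrightarrow>
      (\<forall>k. SuspA_pow T (k - d) (act X d (\<phi> r d)) \<cdot> m (k - d) = Zero T C (Susp_pow T k X))"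
    by (simp add: Hom_module_def fun_eq_iff \<rho>)
  \<comment> \<open>Shifts the index by d, from the degree of the product to the degree of the
    factor.\<close>
  also have "\<dots> \<longleftrightarrow> (\<forall>k. SuspA_pow T k (act X d (\<phi> r d)) \<cdot> m k = Zero T C (Susp_pow T (k + d) X))"
    by (metis add_diff_cancel_right' diff_add_cancel)
  also have "\<dots> \<longleftrightarrow> (\<forall>k. kills d r (m k))"
  proof -
    have "SuspA_pow T k (act X d (\<phi> r d)) \<cdot> m k = Zero T C (Susp_pow T (k + d) X) \<longleftrightarrow> kills d r (m k)" for k
    proof -
      have *: "eq_upto_sign (act (Susp_pow T k X) d (\<phi> r d) \<cdot> m k) (SuspA_pow T k (act X d (\<phi> r d)) \<cdot> m k)"
        by (intro eq_upto_sign_Compose_right act_Susp_pow) simp_all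
      have 1: "kills d r (m k) \<longleftrightarrow> act (Susp_pow T k X) d (\<phi> r d) \<cdot> m k = Zero T C (Susp_pow T (k + d) X)"
        using assms(1) by (simp add: kills_def kill_def add.commute)
      show ?thesis
        unfolding 1 using eq_upto_sign_Zero[OF *] eq_upto_sign_Zero[OF eq_upto_sign_sym[OF *]] by blast
    qed
    then show ?thesis by simp
  qed
  finally show ?thesis .
qed

section \<open>Vanishing of localized Hom modules\<close>

lemma denominators_iff: "r \<in> denominators R p \<longleftrightarrow> (\<exists>d. r \<in> component R d) \<and> r \<notin> p"
  by (auto simp: denominators_def homogeneous_def)

text \<open>If m/1 equals 0/1, a denominator annihilates m. Conversely, annihilators of two
  numerators multiply to an element that makes any two fractions equivalent, so there is a single
  class.\<close>

lemma localizes_to_zero_iff: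
  assumes p: "p \<in> Spec R"
  shows "localizes_to_zero R p (Hom_module T \<rho> C X) \<longleftrightarrow>
    (\<forall>m\<in>graded_Hom T C X. \<exists>d r. r \<notin> p \<and> (\<forall>k. kills d r (m k)))"
proof -
  let ?M = "Hom_module T \<rho> C X" and ?D = "denominators R p"
  let ?rel = "fraction_rel R p ?M"
  have car [simp]: "carrier ?M = graded_Hom T C X" by (simp add: Hom_module_def)
  have zeroM: "\<zero>\<^bsub>?M\<^esub> \<in> graded_Hom T C X" by (simp add: Hom_module_def graded_Hom_def Hom_iff)
  have one: "\<one>\<^bsub>R\<^esub> \<in> ?D" using R.Spec_one[OF p] R.component_one by (auto simp: denominators_iff)
  show ?thesis
  proof
    assume L: "localizes_to_zero R p ?M"
    show "\<forall>m\<in>graded_Hom T C X. \<exists>d r. r \<notin> p \<and> (\<forall>k. kills d r (m k))"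
    proof
      fix m assume m: "m \<in> graded_Hom T C X"
      have "?rel `` {(m, \<one>\<^bsub>R\<^esub>)} \<in> localized_module R p ?M"
        unfolding localized_module_def using m one by (intro quotientI) simp
      then have "?rel `` {(m, \<one>\<^bsub>R\<^esub>)} = ?rel `` {(\<zero>\<^bsub>?M\<^esub>, \<one>\<^bsub>R\<^esub>)}"
        using L by (simp add: localizes_to_zero_def)
      moreover have "(m, \<one>\<^bsub>R\<^esub>) \<in> ?rel `` {(m, \<one>\<^bsub>R\<^esub>)}"
        using m one by (auto simp: fraction_rel_def)
      ultimately have "(m, \<one>\<^bsub>R\<^esub>) \<in> ?rel `` {(\<zero>\<^bsub>?M\<^esub>, \<one>\<^bsub>R\<^esub>)}" by simp
      then obtain a b where ab: "a \<in> ?D" "b \<in> ?D" "a \<odot>\<^bsub>?M\<^esub> \<zero>\<^bsub>?M\<^esub> = b \<odot>\<^bsub>?M\<^esub> m"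
        by (auto simp: fraction_rel_def)
      obtain d where a: "a \<in> component R d" using ab(1) by (auto simp: denominators_iff)
      obtain e where b: "b \<in> component R e" "b \<notin> p" using ab(2) by (auto simp: denominators_iff)
      have "a \<odot>\<^bsub>?M\<^esub> \<zero>\<^bsub>?M\<^esub> = \<zero>\<^bsub>?M\<^esub>"
        unfolding smult_Hom_module[OF a zeroM] using kills_Zero[OF a] by (simp add: Hom_module_def)
      then have "\<forall>k. kills e b (m k)" using smult_Hom_module[OF b(1) m] ab(3) by simp
      then show "\<exists>d r. r \<notin> p \<and> (\<forall>k. kills d r (m k))" using b(2) by blast
    qed
  next
    assume K: "\<forall>m\<in>graded_Hom T C X. \<exists>d r. r \<notin> p \<and> (\<forall>k. kills d r (m k))"
    have all: "((m, s), (n, t)) \<in> ?rel" if m: "m \<in> graded_Hom T C X" and n: "n \<in> graded_Hom T C X"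
      and s: "s \<in> ?D" and t: "t \<in> ?D" for m s n t
    proof -
      obtain d r where r: "r \<notin> p" "\<And>k. kills d r (m k)" using K m by blast
      obtain d' r' where r': "r' \<notin> p" "\<And>k. kills d' r' (n k)" using K n by blast
      have rc: "r \<in> component R d" "r' \<in> component R d'" using r(2) r'(2) by (simp_all add: kills_def)
      obtain i j where ij: "s \<in> component R i" "t \<in> component R j" and st: "s \<notin> p" "t \<notin> p"
        using s t by (auto simp: denominators_iff)
      have c [simp]: "r \<in> carrier R" "r' \<in> carrier R" "s \<in> carrier R" "t \<in> carrier R"
        using R.component_carrier rc ij by blast+
      let ?u = "r' \<otimes>\<^bsub>R\<^esub> r"
      have u: "?u \<in> component R (d' + d)" "?u \<notin> p"
        using R.component_mult[OF rc(2,1)] R.Spec_mult[OF p rc(2,1) r'(1) r(1)] by auto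
      have um: "kills (d' + d + j) (?u \<otimes>\<^bsub>R\<^esub> t) (m k)" "kills (d' + d + i) (?u \<otimes>\<^bsub>R\<^esub> s) (n k)" for k
        using kills_mult_right[OF ij(2) kills_mult_left[OF rc(2) r(2)]]
          kills_mult_right[OF ij(1) kills_mult_right[OF rc(1) r'(2)]] by auto
      define a where "a = ?u \<otimes>\<^bsub>R\<^esub> t"
      \<comment> \<open>The sign compensates for t s = - s t, so that a s = b t holds exactly; the
        common factor \<open>?u\<close> makes \<open>a\<close> annihilate m and \<open>b\<close>
        annihilate n.\<close>
      define b where "b = (if t \<otimes>\<^bsub>R\<^esub> s = s \<otimes>\<^bsub>R\<^esub> t then ?u \<otimes>\<^bsub>R\<^esub> s else \<ominus>\<^bsub>R\<^esub> (?u \<otimes>\<^bsub>R\<^esub> s))"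
      have kb: "kills (d' + d + i) b (n k)" for k using um(2) kills_minus by (simp add: b_def)
      have ac: "a \<in> component R (d' + d + j)" and bc: "b \<in> component R (d' + d + i)"
        using um(1) kb by (simp_all add: kills_def a_def)
      have "a \<in> ?D" using R.Spec_mult[OF p u(1) ij(2) u(2) st(2)] ac by (auto simp: denominators_iff a_def)
      moreover have "b \<in> ?D"
        using R.Spec_mult[OF p u(1) ij(1) u(2) st(1)] R.Spec_minus[OF p] bc by (auto simp: denominators_iff b_def)
      moreover have "a \<otimes>\<^bsub>R\<^esub> s = b \<otimes>\<^bsub>R\<^esub> t"
      proof (cases "t \<otimes>\<^bsub>R\<^esub> s = s \<otimes>\<^bsub>R\<^esub> t")
        case True
        then show ?thesis by (simp add: a_def b_def R.m_assoc)
      next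
        case False
        then have "t \<otimes>\<^bsub>R\<^esub> s = \<ominus>\<^bsub>R\<^esub> (s \<otimes>\<^bsub>R\<^esub> t)" using R.graded_comm'[OF ij(2,1)] by simp
        then show ?thesis using False by (simp add: a_def b_def R.m_assoc R.l_minus R.r_minus)
      qed
      moreover have "a \<odot>\<^bsub>?M\<^esub> m = \<zero>\<^bsub>?M\<^esub>" "b \<odot>\<^bsub>?M\<^esub> n = \<zero>\<^bsub>?M\<^esub>"
        using smult_Hom_module[OF ac m] smult_Hom_module[OF bc n] um(1) kb by (simp_all add: a_def)
      ultimately have "\<exists>a\<in>?D. \<exists>b\<in>?D. a \<otimes>\<^bsub>R\<^esub> s = b \<otimes>\<^bsub>R\<^esub> t \<and> a \<odot>\<^bsub>?M\<^esub> m = b \<odot>\<^bsub>?M\<^esub> n" by metis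
      then show ?thesis using m n s t by (simp add: fraction_rel_def)
    qed
    have rel: "?rel `` {x} = graded_Hom T C X \<times> ?D" if "x \<in> graded_Hom T C X \<times> ?D" for x
    proof -
      have "?rel `` {x} \<subseteq> graded_Hom T C X \<times> ?D" by (auto simp: fraction_rel_def)
      then show ?thesis using that all by (cases x) fast
    qed
    have z: "(\<zero>\<^bsub>?M\<^esub>, \<one>\<^bsub>R\<^esub>) \<in> graded_Hom T C X \<times> ?D" using zeroM one by simp
    then show "localizes_to_zero R p ?M"
      unfolding localizes_to_zero_def localized_module_def quotient_def using rel by auto
  qed
qed

text \<open>Homogeneous elements outside p are closed under products, so finitely many annihilators
  have a common multiple outside p. It will be used for the nonzero components of a graded
  map.\<close>

lemma kills_common:
  assumes "finite K" "p \<in> Spec R" "\<And>k. k \<in> K \<Longrightarrow> \<exists>d r. r \<notin> p \<and> kills d r (m k)"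
  shows "\<exists>d r. r \<in> component R d \<and> r \<notin> p \<and> (\<forall>k\<in>K. kills d r (m k))"
  using assms(1,3)
proof (induction K rule: finite_induct)
  case empty
  then show ?case using R.Spec_one[OF assms(2)] R.component_one by blast
next
  case (insert k K)
  then obtain d r e s where r: "r \<in> component R d" "r \<notin> p" "\<And>k. k \<in> K \<Longrightarrow> kills d r (m k)"
    and s: "s \<notin> p" "kills e s (m k)" by (metis insert_iff)
  have sc: "s \<in> component R e" using s(2) by (simp add: kills_def)
  have "r \<otimes>\<^bsub>R\<^esub> s \<notin> p" by (rule R.Spec_mult[OF assms(2) r(1) sc r(2) s(1)])
  moreover have "\<forall>l\<in>insert k K. kills (d + e) (r \<otimes>\<^bsub>R\<^esub> s) (m l)"
    using kills_mult_left[OF r(1) s(2)] kills_mult_right[OF sc r(3)] by blast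
  ultimately show ?case using R.component_mult[OF r(1) sc] by blast
qed

text \<open>A map from \<open>\<Sigma>\<^sup>i C\<close> to X is a homogeneous element of degree -i
  of the Hom module of C. Conversely a graded element has finitely many nonzero components, and
  these share an annihilator.\<close>

lemma supported_on_iff:
  "X \<in> supported_on U R T \<rho> V \<longleftrightarrow>
    (\<forall>f. shifted_compact (Dom T f) \<longrightarrow> Cod T f = X \<longrightarrow> (\<forall>p\<in>Spec R - V. \<exists>d r. r \<notin> p \<and> kills d r f))"
proof
  assume X: "X \<in> supported_on U R T \<rho> V"
  show "\<forall>f. shifted_compact (Dom T f) \<longrightarrow> Cod T f = X \<longrightarrow> (\<forall>p\<in>Spec R - V. \<exists>d r. r \<notin> p \<and> kills d r f)"
  proof (intro allI impI ballI)
    fix f p assume f: "shifted_compact (Dom T f)" "Cod T f = X" and p: "p \<in> Spec R - V"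
    obtain C i where C: "compact_object U T C" "Dom T f = Susp_pow T i C"
      using f(1) unfolding shifted_compact_def by blast
    define m where "m k = (if k = - i then SuspA_pow T (- i) f else Zero T C (Susp_pow T k X))" for k
    have "finite {k. m k \<noteq> Zero T C (Susp_pow T k X)}"
      by (rule finite_subset[of _ "{- i}"]) (auto simp: m_def)
    then have "m \<in> graded_Hom T C X"
      using f C by (auto simp: graded_Hom_def Hom_iff m_def)
    then obtain d r where "r \<notin> p" "\<forall>k. kills d r (m k)"
      using X C(1) p localizes_to_zero_iff unfolding supported_on_def by blast
    then have "kills d r (SuspA_pow T (- i) f)" by (metis m_def)
    then show "\<exists>d r. r \<notin> p \<and> kills d r f" using kills_SuspA_pow_iff \<open>r \<notin> p\<close> by blast
  qed
next
  assume X: "\<forall>f. shifted_compact (Dom T f) \<longrightarrow> Cod T f = X \<longrightarrow> (\<forall>p\<in>Spec R - V. \<exists>d r. r \<notin> p \<and> kills d r f)"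
  show "X \<in> supported_on U R T \<rho> V"
    unfolding supported_on_def
  proof (intro CollectI allI impI ballI)
    fix C p assume C: "compact_object U T C" and p: "p \<in> Spec R - V"
    have "\<exists>d r. r \<notin> p \<and> (\<forall>k. kills d r (m k))" if m: "m \<in> graded_Hom T C X" for m
    proof -
      let ?K = "{k. m k \<noteq> Zero T C (Susp_pow T k X)}"
      have fin: "finite ?K" using m by (simp add: graded_Hom_def)
      have "\<exists>d r. r \<notin> p \<and> kills d r (m k)" for k
      proof -
        have "shifted_compact (Dom T (SuspA_pow T (- k) (m k)))" "Cod T (SuspA_pow T (- k) (m k)) = X"
          using m shifted_compact_Susp_pow[OF compact_shifted_compact[OF C]] by (auto simp: graded_Hom_def Hom_iff)
        then show ?thesis using X p kills_SuspA_pow_iff by metis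
      qed
      then obtain d r where r: "r \<in> component R d" "r \<notin> p" "\<forall>k\<in>?K. kills d r (m k)"
        using kills_common[OF fin, of p m] p by blast
      have "kills d r (m k)" for k
        by (cases "k \<in> ?K") (use r kills_Zero[OF r(1)] in auto)
      then show ?thesis using r(2) by blast
    qed
    then show "localizes_to_zero R p (Hom_module T \<rho> C X)"
      using localizes_to_zero_iff p by blast
  qed
qed

section \<open>From sets of primes to multiplicative sets\<close>

lemma supported_on_Int: "supported_on U R T \<rho> (V \<inter> W) = supported_on U R T \<rho> V \<inter> supported_on U R T \<rho> W"
  unfolding supported_on_def by blast

definition endos :: "'r set \<Rightarrow> (int \<times> 'm) set" where
  "endos S = {(d, \<phi> r d) | d r. r \<in> S \<and> r \<in> component R d}"

lemma multiplicative_set_endos: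
  assumes "\<one>\<^bsub>R\<^esub> \<in> S" "\<And>r s. r \<in> S \<Longrightarrow> s \<in> S \<Longrightarrow> r \<otimes>\<^bsub>R\<^esub> s \<in> S"
  shows "multiplicative_set U T (endos S)"
proof unfold_locales
  show "unit_map d \<psi>" if "(d, \<psi>) \<in> endos S" for d \<psi>
    using that component_unit_map by (auto simp: endos_def)
  show "endos S \<noteq> {}" using assms(1) R.component_one by (auto simp: endos_def)
  show "(e + d, SuspA_pow T e \<psi> \<cdot> \<chi>) \<in> endos S" if *: "(d, \<psi>) \<in> endos S" "(e, \<chi>) \<in> endos S" for d \<psi> e \<chi>
  proof -
    obtain r s where rs: "\<psi> = \<phi> r d" "r \<in> S" "r \<in> component R d" "\<chi> = \<phi> s e" "s \<in> S" "s \<in> component R e"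
      using * unfolding endos_def by blast
    then have "SuspA_pow T e \<psi> \<cdot> \<chi> = \<phi> (r \<otimes>\<^bsub>R\<^esub> s) (e + d)" "r \<otimes>\<^bsub>R\<^esub> s \<in> component R (e + d)"
      using \<phi>_mult[of r d s e] R.component_mult[of r d s e] by (simp_all add: add.commute)
    then show ?thesis using assms(2) rs unfolding endos_def by blast
  qed
  show "eq_upto_sign (SuspA_pow T e \<psi> \<cdot> \<chi>) (SuspA_pow T d \<chi> \<cdot> \<psi>)"
    if "(d, \<psi>) \<in> endos S" "(e, \<chi>) \<in> endos S" for d \<psi> e \<chi>
    using that \<phi>_commute by (auto simp: endos_def)
qed

text \<open>Reduces the existence of a smashing triangle to a statement about annihilators of single
  maps.\<close>

lemma smashing_endos:
  assumes "\<one>\<^bsub>R\<^esub> \<in> S" "\<And>r s. r \<in> S \<Longrightarrow> s \<in> S \<Longrightarrow> r \<otimes>\<^bsub>R\<^esub> s \<in> S"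
    and V: "\<And>X. X \<in> supported_on U R T \<rho> V \<longleftrightarrow>
      (\<forall>f. shifted_compact (Dom T f) \<longrightarrow> Cod T f = X \<longrightarrow> (\<exists>d r. r \<in> S \<and> kills d r f))"
  shows "\<exists>E H. smashing (supported_on U R T \<rho> V) E H" "localizing U T (supported_on U R T \<rho> V)"
proof -
  interpret S: multiplicative_set U T "endos S" by (rule multiplicative_set_endos[OF assms(1,2)])
  have "S.killed f \<longleftrightarrow> (\<exists>d r. r \<in> S \<and> kills d r f)" for f
    unfolding S.killed_def by (auto simp: endos_def kills_def)
  then have "supported_on U R T \<rho> V = S.tors" using V by (auto simp: S.tors_def)
  then show "\<exists>E H. smashing (supported_on U R T \<rho> V) E H" "localizing U T (supported_on U R T \<rho> V)"
    using S.smashing_tors S.localizing_tors by metis+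
qed

text \<open>The primes outside \<open>not_below R p\<close> are those contained in p, and p is the
  largest. An annihilator outside p is outside all of them, so the condition at p decides.\<close>

lemma smashing_not_below:
  assumes p: "p \<in> Spec R"
  shows "\<exists>E H. smashing (supported_on U R T \<rho> (not_below R p)) E H"
    "localizing U T (supported_on U R T \<rho> (not_below R p))"
proof -
  have "X \<in> supported_on U R T \<rho> (not_below R p) \<longleftrightarrow>
      (\<forall>f. shifted_compact (Dom T f) \<longrightarrow> Cod T f = X \<longrightarrow> (\<exists>d r. r \<in> homogeneous R - p \<and> kills d r f))" for X
  proof -
    have "(\<forall>q\<in>Spec R - not_below R p. \<exists>d r. r \<notin> q \<and> kills d r f) \<longleftrightarrow>
        (\<exists>d r. r \<in> homogeneous R - p \<and> kills d r f)" for f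
    proof -
      have "p \<in> Spec R - not_below R p" "\<And>q. q \<in> Spec R - not_below R p \<Longrightarrow> q \<subseteq> p"
        "\<And>d r. kills d r f \<Longrightarrow> r \<in> homogeneous R"
        using p by (auto simp: not_below_def kills_def R.homogeneous_iff)
      then show ?thesis by blast
    qed
    then show ?thesis unfolding supported_on_iff by simp
  qed
  moreover have "\<one>\<^bsub>R\<^esub> \<in> homogeneous R - p" using R.Spec_one[OF p] R.component_one by (auto simp: R.homogeneous_iff)
  moreover have "r \<otimes>\<^bsub>R\<^esub> s \<in> homogeneous R - p" if rs: "r \<in> homogeneous R - p" "s \<in> homogeneous R - p" for r s
  proof -
    obtain i j where "r \<in> component R i" "s \<in> component R j" using rs by (auto simp: R.homogeneous_iff)
    then show ?thesis using rs R.Spec_mult[OF p] R.component_mult R.homogeneous_iff by blast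
  qed
  ultimately show "\<exists>E H. smashing (supported_on U R T \<rho> (not_below R p)) E H"
    "localizing U T (supported_on U R T \<rho> (not_below R p))"
    using smashing_endos[of "homogeneous R - p"] by blast+
qed

text \<open>If no power of t annihilates f, \<open>ex_prime_avoiding\<close> produces a prime that
  contains the whole annihilator of f but not t, contradicting the support condition at that
  prime.\<close>

lemma smashing_principal:
  assumes t: "t \<in> component R d"
  shows "\<exists>E H. smashing (supported_on U R T \<rho> (closed_set R {t})) E H"
    "localizing U T (supported_on U R T \<rho> (closed_set R {t}))"
proof -
  have tc: "t \<in> carrier R" using t R.component_carrier by blast
  let ?S = "{t [^]\<^bsub>R\<^esub> n | n :: nat. True}"
  have "(\<forall>q\<in>Spec R - closed_set R {t}. \<exists>d r. r \<notin> q \<and> kills d r f) \<longleftrightarrow> (\<exists>d r. r \<in> ?S \<and> kills d r f)" for f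
  proof
    assume q: "\<forall>q\<in>Spec R - closed_set R {t}. \<exists>d r. r \<notin> q \<and> kills d r f"
    show "\<exists>d r. r \<in> ?S \<and> kills d r f"
    proof (rule ccontr)
      assume no: "\<nexists>d r. r \<in> ?S \<and> kills d r f"
      have "(int n * d, t [^]\<^bsub>R\<^esub> n) \<notin> {(d, r). kills d r f}" for n :: nat using no by blast
      then obtain q' where "q' \<in> Spec R" "t \<notin> q'" "\<And>i x. (i, x) \<in> {(d, r). kills d r f} \<Longrightarrow> x \<in> q'"
        using R.ex_prime_avoiding[OF annihilator_homogeneous_part t] by blast
      then show False using q unfolding closed_set_def by blast
    qed
  next
    assume "\<exists>d r. r \<in> ?S \<and> kills d r f"
    then show "\<forall>q\<in>Spec R - closed_set R {t}. \<exists>d r. r \<notin> q \<and> kills d r f"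
      using R.Spec_pow t by (fastforce simp: closed_set_def)
  qed
  then have "X \<in> supported_on U R T \<rho> (closed_set R {t}) \<longleftrightarrow>
      (\<forall>f. shifted_compact (Dom T f) \<longrightarrow> Cod T f = X \<longrightarrow> (\<exists>d r. r \<in> ?S \<and> kills d r f))" for X
    unfolding supported_on_iff by simp
  moreover have "\<one>\<^bsub>R\<^esub> \<in> ?S" by (intro CollectI exI[of _ 0]) simp
  moreover have "r \<otimes>\<^bsub>R\<^esub> s \<in> ?S" if "r \<in> ?S" "s \<in> ?S" for r s
    using that R.nat_pow_mult[OF tc] by blast
  ultimately show "\<exists>E H. smashing (supported_on U R T \<rho> (closed_set R {t})) E H"
    "localizing U T (supported_on U R T \<rho> (closed_set R {t}))"
    using smashing_endos[of ?S "closed_set R {t}"] by blast+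
qed

text \<open>Adding a generator intersects the closed sets, and the objects E are tensored
  accordingly; with no generators the closed set is all of Spec R and every object is supported
  there.\<close>

lemma smashing_finite:
  assumes "finite B" "B \<subseteq> homogeneous R"
  shows "(\<exists>E H. smashing (supported_on U R T \<rho> (closed_set R B)) E H) \<and>
    localizing U T (supported_on U R T \<rho> (closed_set R B))"
  using assms
proof (induction B rule: finite_induct)
  case empty
  have "supported_on U R T \<rho> (closed_set R {}) = UNIV" by (auto simp: supported_on_def closed_set_def)
  moreover have "localizing U T UNIV" by (simp add: localizing_def)
  ultimately show ?case using smashing_UNIV ex_zero_object by auto
next
  case (insert t B)
  obtain d where "t \<in> component R d" using insert.prems by (auto simp: R.homogeneous_iff)
  note 1 = smashing_principal[OF this]
  have 2: "closed_set R (insert t B) = closed_set R {t} \<inter> closed_set R B" by (auto simp: closed_set_def)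
  obtain E1 H1 E2 H2 where sm: "smashing (supported_on U R T \<rho> (closed_set R {t})) E1 H1"
    "smashing (supported_on U R T \<rho> (closed_set R B)) E2 H2"
    using 1 insert by blast
  have l: "localizing U T (supported_on U R T \<rho> (closed_set R B))" using insert by blast
  then have "localizing U T (supported_on U R T \<rho> (closed_set R {t}) \<inter> supported_on U R T \<rho> (closed_set R B))"
    using localizing_Inter[of "{supported_on U R T \<rho> (closed_set R {t}), supported_on U R T \<rho> (closed_set R B)}"] 1
    by auto
  moreover obtain H where "smashing (supported_on U R T \<rho> (closed_set R {t}) \<inter> supported_on U R T \<rho> (closed_set R B)) (E1 \<boxtimes> E2) H"
    by (rule smashing_Int[OF sm(1) 1(2) sm(2) l])
  ultimately show ?case unfolding 2 supported_on_Int by (intro conjI exI)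
qed

lemma smashing_closed_set:
  assumes "noetherian_ring R" "p \<in> Spec R"
  shows "\<exists>E H. smashing (supported_on U R T \<rho> (closed_set R p)) E H"
    "localizing U T (supported_on U R T \<rho> (closed_set R p))"
proof -
  obtain B where B: "finite B" "B \<subseteq> homogeneous R" "B \<subseteq> p" "\<And>q. q \<in> Spec R \<Longrightarrow> B \<subseteq> q \<Longrightarrow> p \<subseteq> q"
    using R.Spec_finite_generators[OF assms] by blast
  have "closed_set R p = closed_set R B" using B(3,4) by (auto simp: closed_set_def)
  then show "\<exists>E H. smashing (supported_on U R T \<rho> (closed_set R p)) E H"
    "localizing U T (supported_on U R T \<rho> (closed_set R p))"
    using smashing_finite[OF B(1,2)] by auto
qed

end

section \<open>The tensor product formula for supports\<close>

context canonical_tensor_action begin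

text \<open>The tensored triangle witnesses the predicate under \<open>SOME\<close>, so the chosen
  pair satisfies it too, and \<open>smashing_tri\<close> compares the two.\<close>

lemma chosen_localization_iso:
  assumes sm: "smashing (supported_on U R T \<rho> V) E H" and loc: "localizing U T (supported_on U R T \<rho> V)"
  shows "isomorphic T (E \<boxtimes> X) (Gamma_V U R T \<rho> V X)" "isomorphic T (H \<boxtimes> X) (L_V U R T \<rho> V X)"
proof -
  let ?S = "supported_on U R T \<rho> V"
  obtain f g h where t: "tri (E \<boxtimes> X) X (H \<boxtimes> X) f g h" using smashing_tri_exists[OF sm] .
  have "E \<boxtimes> X \<in> ?S" using sm unfolding smashing_def by blast
  moreover have "Hom T W (H \<boxtimes> X) = {Zero T W (H \<boxtimes> X)}" if W: "W \<in> ?S" for W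
  proof (intro equalityI subsetI)
    fix k assume "k \<in> Hom T W (H \<boxtimes> X)"
    then have "Dom T k = W" "Cod T k = H \<boxtimes> X" by (simp_all add: Hom_iff)
    then show "k \<in> {Zero T W (H \<boxtimes> X)}" using smashing_Hom_zero[OF sm loc, of k X] W by simp
  qed (simp add: Hom_iff)
  ultimately have "localization_triangle U R T \<rho> V X (E \<boxtimes> X, H \<boxtimes> X)"
    using triD[OF t] unfolding localization_triangle_def by (auto simp: Hom_iff)
  then have ex: "localization_triangle U R T \<rho> V X (chosen_localization U R T \<rho> V X)"
    unfolding chosen_localization_def by (rule someI)
  obtain G L where GL: "chosen_localization U R T \<rho> V X = (G, L)" by (cases "chosen_localization U R T \<rho> V X")
  obtain f' g' h' where "f' \<in> Hom T G X" "g' \<in> Hom T X L" "Triangle T f' g' h'" and G: "G \<in> ?S"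
    and L: "\<forall>W\<in>?S. Hom T W L = {Zero T W L}"
    using ex unfolding GL localization_triangle_def by auto
  then have "tri G X L f' g' h'" using triI[of f' g' h'] by (auto simp: Hom_iff)
  moreover have "k = Zero T (Dom T k) L" if "Dom T k \<in> ?S" "Cod T k = L" for k
  proof -
    have "k \<in> Hom T (Dom T k) L" using that(2) by (simp add: Hom_iff)
    then show ?thesis using L that(1) by blast
  qed
  ultimately have "isomorphic T (E \<boxtimes> X) G \<and> isomorphic T (H \<boxtimes> X) L"
    using smashing_tri[OF sm loc _ G, of X L f' g' h'] by blast
  then show "isomorphic T (E \<boxtimes> X) (Gamma_V U R T \<rho> V X)" "isomorphic T (H \<boxtimes> X) (L_V U R T \<rho> V X)"
    by (simp_all add: Gamma_V_def L_V_def GL)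
qed

theorem supp_Tensor:
  assumes "noetherian_ring R" and str: "stratified U R T \<rho>"
  shows "supp U R T \<rho> (X \<boxtimes> Y) = supp U R T \<rho> X \<inter> supp U R T \<rho> Y"
proof -
  have "zero_object T (Gamma U R T \<rho> p (X \<boxtimes> Y)) \<longleftrightarrow>
      zero_object T (Gamma U R T \<rho> p X) \<or> zero_object T (Gamma U R T \<rho> p Y)" if p: "p \<in> Spec R" for p
  proof -
    note l1 = smashing_closed_set(2)[OF assms(1) p] and l2 = smashing_not_below(2)[OF p]
    obtain E1 H1 E2 H2 where sm1: "smashing (supported_on U R T \<rho> (closed_set R p)) E1 H1"
      and sm2: "smashing (supported_on U R T \<rho> (not_below R p)) E2 H2"
      using smashing_closed_set(1)[OF assms(1) p] smashing_not_below(1)[OF p] by blast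
    have iso: "isomorphic T (E1 \<boxtimes> (H2 \<boxtimes> Z)) (Gamma U R T \<rho> p Z)" for Z
      unfolding Gamma_def
      using isomorphic_trans[OF isomorphic_Tensor[OF isomorphic_refl chosen_localization_iso(2)[OF sm2 l2]]
          chosen_localization_iso(1)[OF sm1 l1]] .
    have zero: "zero_object T (Gamma U R T \<rho> p Z) \<longleftrightarrow> zero_object T (E1 \<boxtimes> (H2 \<boxtimes> Z))" for Z
      using iso[of Z] zero_object_isomorphic isomorphic_sym by blast
    \<comment> \<open>Z \<otimes> \<Gamma>W and \<Gamma>(Z \<otimes> W) differ by a permutation of
      tensor factors.\<close>
    have perm: "zero_object T (Z \<boxtimes> (E1 \<boxtimes> (H2 \<boxtimes> W))) \<longleftrightarrow> zero_object T (E1 \<boxtimes> (H2 \<boxtimes> (Z \<boxtimes> W)))" for Z W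
    proof -
      have "isomorphic T (Z \<boxtimes> (E1 \<boxtimes> (H2 \<boxtimes> W))) (E1 \<boxtimes> (Z \<boxtimes> (H2 \<boxtimes> W)))"
        by (rule isomorphic_Tensor_left_comm)
      also have "isomorphic T (E1 \<boxtimes> (Z \<boxtimes> (H2 \<boxtimes> W))) (E1 \<boxtimes> (H2 \<boxtimes> (Z \<boxtimes> W)))"
        by (intro isomorphic_Tensor isomorphic_refl isomorphic_Tensor_left_comm)
      finally show ?thesis using zero_object_isomorphic isomorphic_sym by blast
    qed
    have zero_right: "zero_object T (Gamma U R T \<rho> p (Z \<boxtimes> W))" if "zero_object T (Gamma U R T \<rho> p W)" for Z W
      using that perm[of Z W] zero_object_Tensor_right unfolding zero by blast
    have comm: "zero_object T (Gamma U R T \<rho> p (Z \<boxtimes> W)) \<longleftrightarrow> zero_object T (Gamma U R T \<rho> p (W \<boxtimes> Z))" for Z W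
    proof -
      have "isomorphic T (E1 \<boxtimes> (H2 \<boxtimes> (Z \<boxtimes> W))) (E1 \<boxtimes> (H2 \<boxtimes> (W \<boxtimes> Z)))"
        by (intro isomorphic_Tensor isomorphic_refl isomorphic_Tensor_comm)
      then show ?thesis unfolding zero using zero_object_isomorphic isomorphic_sym by blast
    qed
    \<comment> \<open>With kernels of tensoring in place of an essential image, closure under
      triangles, coproducts and the tensor action can be read off.\<close>
    have image: "Gamma_image U R T \<rho> p = {W. zero_object T (W \<boxtimes> H1)} \<inter> {W. zero_object T (W \<boxtimes> E2)}"
    proof (intro equalityI subsetI)
      fix W assume "W \<in> Gamma_image U R T \<rho> p"
      then obtain Z where Z: "isomorphic T (E1 \<boxtimes> (H2 \<boxtimes> Z)) W"
        unfolding Gamma_image_def using iso isomorphic_trans by blast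
      have "zero_object T (H1 \<boxtimes> (E1 \<boxtimes> (H2 \<boxtimes> Z)))"
        using smashing_orthogonal(1)[OF sm1 l1] zero_object_Tensor_left zero_object_Tensor_assoc by blast
      moreover have "zero_object T (E2 \<boxtimes> (E1 \<boxtimes> (H2 \<boxtimes> Z)))"
        using smashing_orthogonal(2)[OF sm2 l2] zero_object_Tensor_left zero_object_Tensor_right
          zero_object_Tensor_assoc zero_object_Tensor_left_comm by blast
      ultimately have "zero_object T (H1 \<boxtimes> W)" "zero_object T (E2 \<boxtimes> W)"
        using zero_object_isomorphic[OF isomorphic_Tensor[OF isomorphic_refl Z]] by blast+
      then show "W \<in> {W. zero_object T (W \<boxtimes> H1)} \<inter> {W. zero_object T (W \<boxtimes> E2)}"
        by (simp add: zero_object_Tensor_comm)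
    next
      fix W assume "W \<in> {W. zero_object T (W \<boxtimes> H1)} \<inter> {W. zero_object T (W \<boxtimes> E2)}"
      then have W: "zero_object T (H1 \<boxtimes> W)" "zero_object T (E2 \<boxtimes> W)" by (simp_all add: zero_object_Tensor_comm)
      have "isomorphic T (E1 \<boxtimes> (H2 \<boxtimes> W)) (E1 \<boxtimes> W)"
        by (intro isomorphic_Tensor isomorphic_refl smashing_zero_right[OF sm2 W(2)])
      then have "isomorphic T (E1 \<boxtimes> (H2 \<boxtimes> W)) W"
        using smashing_zero_left[OF sm1 W(1)] isomorphic_trans by blast
      then have "isomorphic T (Gamma U R T \<rho> p W) W" using iso isomorphic_sym isomorphic_trans by blast
      then show "W \<in> Gamma_image U R T \<rho> p" unfolding Gamma_image_def by blast
    qed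
    have "zero_object T (Gamma U R T \<rho> p X) \<or> zero_object T (Gamma U R T \<rho> p Y)"
      if XY: "zero_object T (Gamma U R T \<rho> p (X \<boxtimes> Y))"
    proof (rule ccontr)
      assume no: "\<not> ?thesis"
      define S where "S = Gamma_image U R T \<rho> p \<inter> {W. zero_object T (W \<boxtimes> X)}"
      have "localizing U T S"
        using localizing_Inter[of "{{W. zero_object T (W \<boxtimes> H1)}, {W. zero_object T (W \<boxtimes> E2)}, {W. zero_object T (W \<boxtimes> X)}}"]
          localizing_Tensor_zero unfolding S_def image by (auto simp: Int_assoc)
      moreover have "tensor_ideal T S"
        unfolding tensor_ideal_def S_def image using zero_object_Tensor_right zero_object_Tensor_assoc by blast
      moreover have "Gamma U R T \<rho> p Y \<in> S"
      proof -
        have "zero_object T (X \<boxtimes> (E1 \<boxtimes> (H2 \<boxtimes> Y)))" using XY perm unfolding zero by blast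
        then have "zero_object T (X \<boxtimes> Gamma U R T \<rho> p Y)"
          by (rule zero_object_isomorphic[rotated]) (intro isomorphic_Tensor isomorphic_refl iso)
        moreover have "Gamma U R T \<rho> p Y \<in> Gamma_image U R T \<rho> p"
          unfolding Gamma_image_def using isomorphic_refl by blast
        ultimately show ?thesis by (simp add: S_def zero_object_Tensor_comm)
      qed
      moreover have gi: "Gamma U R T \<rho> p Z \<in> Gamma_image U R T \<rho> p" for Z
        unfolding Gamma_image_def using isomorphic_refl by blast
      \<comment> \<open>Of the alternatives in \<open>stratified\<close>, a zero image and a zero S
        are both excluded, since \<Gamma>Y is nonzero and lies in both.\<close>
      ultimately have "S = Gamma_image U R T \<rho> p"
        using str p no unfolding stratified_def S_def by blast
      then have "Gamma U R T \<rho> p (Unit T) \<in> S" using gi by blast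
      then have "zero_object T (X \<boxtimes> Gamma U R T \<rho> p (Unit T))" by (simp add: S_def zero_object_Tensor_comm)
      then have "zero_object T (X \<boxtimes> (E1 \<boxtimes> (H2 \<boxtimes> Unit T)))"
        by (rule zero_object_isomorphic[rotated]) (intro isomorphic_Tensor isomorphic_refl isomorphic_sym[OF iso])
      \<comment> \<open>Commuting X past \<Gamma> turns X \<otimes> \<Gamma>1 into
        \<Gamma>X.\<close>
      then have "zero_object T (E1 \<boxtimes> (H2 \<boxtimes> (X \<boxtimes> Unit T)))" using perm by blast
      then have "zero_object T (E1 \<boxtimes> (H2 \<boxtimes> X))"
        by (rule zero_object_isomorphic[rotated]) (intro isomorphic_Tensor isomorphic_refl isomorphic_Unit_right)
      then show False using no unfolding zero by blast
    qed
    then show ?thesis using zero_right comm by blast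
  qed
  then show ?thesis unfolding supp_def by blast
qed

end

theorem theorem1p6:
  fixes U :: "'u itself"
    and R :: "('r, 'k) graded_ring_scheme"
    and T :: "('o, 'm, 'c) tensor_category_scheme"
    and \<rho> :: "'o \<Rightarrow> 'r \<Rightarrow> int \<Rightarrow> 'm"
    and X Y :: 'o
  assumes "graded_commutative_ring R"
    and "noetherian_ring R"
    and "tensor_triangulated_category U T"
    and "canonical_action R T \<rho>"
    and "stratified U R T \<rho>"
  shows "supp U R T \<rho> (X \<boxtimes>\<^bsub>T\<^esub> Y) = supp U R T \<rho> X \<inter> supp U R T \<rho> Y"
proof -
  obtain \<phi> where "\<phi> \<in> graded_ring_hom R (graded_End T (Unit T))"
    "\<forall>X. \<forall>r \<in> carrier R. \<rho> X r = tensor_action T X (\<phi> r)"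
    using assms(4) unfolding canonical_action_def by blast
  then have "canonical_tensor_action U T R \<phi> \<rho>"
    using assms(1,3) by (simp add: canonical_tensor_action_def canonical_tensor_action_axioms_def)
  then show ?thesis using assms(2,5) by (rule canonical_tensor_action.supp_Tensor)
qed

end
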